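(* Denote by $v$ the mild solution of the system of stochastic fractional heat equations described in the context (the case $\sigma\equiv\mathrm{Id}$ and $b\equiv0$). Fix $T>0$. Let $I\subset\,]0,T]$ and $J\subset\mathbb{R}$ be two fixed non-trivial compact intervals. (a) There exists $C>0$ depending on $I$ and $J$ such that for all compact sets $A\subseteq\mathbb{R}^d$, $$\mathrm P\{v(I\times J)\cap A\neq\emptyset\}\le C\,\mathscr H_{d-\frac{2(\alpha+1)}{\alpha-1}}(A).$$ (b) For all $t\in\,]0,T]$, there exists $C>0$ depending on $J$ such that for all compact sets $A\subseteq\mathbb{R}^d$, $$\mathrm P\{v(\{t\}\times J)\cap A\neq\emptyset\}\le C\,\mathscr H_{d-\frac{2}{\alpha-1}}(A).$$ (c) For all $x\in\mathbb{R}$, there exists $C>0$ depending on $I$ such that for all compact sets $A\subseteq\mathbb{R}^d$, $$\mathrm P\{v(I\times\{x\})\cap A\neq\emptyset\}\le C\,\mathscr H_{d-\frac{2\alpha}{\alpha-1}}(A).$$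
   Context: Fix an integer $d\ge1$, a real number $1<\alpha\le2$ and $T>0$. Let $W=(W^1,\dots,W^d)$ be $d$ independent space-time white noises on $[0,T]\times\mathbb{R}$ defined on a probability space $(\Omega,\mathscr F,\mathrm P)$. The Green kernel is $G_\alpha(t,x)=\frac1{2\pi}\int_{\mathbb{R}}\exp(-i\lambda x-t|\lambda|^\alpha)\,d\lambda$ (for $\alpha=2$, $G_2(t,x)=(4\pi t)^{-1/2}e^{-x^2/(4t)}$). The process $v=(v_1,\dots,v_d)$ is the mild solution of $\frac{\partial v_i}{\partial t}(t,x)=D^\alpha v_i(t,x)+\dot W^i(t,x)$, $1\le i\le d$, $v(0,\cdot)\equiv0$, where $D^\alpha$ is the Fourier multiplier operator with symbol $-|\lambda|^\alpha$; that is, $v$ is (a continuous modification of) the Gaussian process $$v_i(t,x)=\int_0^t\int_{\mathbb{R}}G_\alpha(t-r,x-w)\,W^i(dr,dw),\qquad t\in[0,T],\ x\in\mathbb{R}.$$ For a set $E\subset[0,T]\times\mathbb{R}$, $v(E)$ denotes the (random) range of $E$ under $(t,x)\mapsto v(t,x)$. "Non-trivial" interval means of positive length. Hausdorff measure: for $\beta\ge0$ and $F\subseteq\mathbb{R}^d$, $$\mathscr H_\beta(F)=\lim_{\epsilon\to0^+}\inf\Big\{\sum_{i=1}^\infty(2r_i)^\beta:F\subseteq\bigcup_{i=1}^\infty B(x_i,r_i),\ \sup_{i\ge1}r_i\le\epsilon\Big\},$$ and $\mathscr H_\beta(F):=\infty$ if $\beta<0$. *)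

theory Defs
  imports "HOL-Probability.Probability"
begin

text \<open>Degenerate laws are Gaussian too: standard deviation 0 means almost surely constant.\<close>

definition gaussian_rv :: "'m measure \<Rightarrow> ('m \<Rightarrow> real) \<Rightarrow> bool" where
  "gaussian_rv M X \<longleftrightarrow> X \<in> borel_measurable M \<and>
     ((\<exists>m. AE \<omega> in M. X \<omega> = m) \<or>
      (\<exists>m s. s > 0 \<and> distributed M lborel X (\<lambda>x. ennreal (normal_density m s x))))"

definition gaussian_process :: "'m measure \<Rightarrow> 'k set \<Rightarrow> ('k \<Rightarrow> 'm \<Rightarrow> real) \<Rightarrow> bool" where
  "gaussian_process M K X \<longleftrightarrow>
     (\<forall>F c. finite F \<and> F \<subseteq> K \<longrightarrow> gaussian_rv M (\<lambda>\<omega>. \<Sum>k\<in>F. c k * X k \<omega>))"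

text \<open>White noise on $[0,T] \times \mathbb{R}$ is a centred Gaussian process indexed by the Borel
  sets of finite Lebesgue measure, with covariance $E[W(A) W(B)] = |A \cap B|$.\<close>

definition noise_sets :: "real \<Rightarrow> (real \<times> real) set set" where
  "noise_sets T = {A \<in> sets borel. A \<subseteq> {0..T} \<times> UNIV \<and> emeasure lborel A < \<infinity>}"

definition white_noise :: "real \<Rightarrow> 'm measure \<Rightarrow> ((real \<times> real) set \<Rightarrow> 'm \<Rightarrow> real) \<Rightarrow> bool" where
  "white_noise T M W \<longleftrightarrow>
     gaussian_process M (noise_sets T) W \<and>
     (\<forall>A\<in>noise_sets T. (\<integral>\<omega>. W A \<omega> \<partial>M) = 0) \<and>
     (\<forall>A\<in>noise_sets T. \<forall>B\<in>noise_sets T.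
        (\<integral>\<omega>. W A \<omega> * W B \<omega> \<partial>M) = measure lborel (A \<inter> B))"

definition indep_white_noises ::
    "real \<Rightarrow> 'm measure \<Rightarrow> ('i \<Rightarrow> (real \<times> real) set \<Rightarrow> 'm \<Rightarrow> real) \<Rightarrow> bool" where
  "indep_white_noises T M W \<longleftrightarrow>
     (\<forall>i. white_noise T M (W i)) \<and>
     prob_space.indep_vars M (\<lambda>_. Pi\<^sub>M (noise_sets T) (\<lambda>_. borel))
       (\<lambda>i \<omega>. \<lambda>A\<in>noise_sets T. W i A \<omega>) UNIV"

text \<open>\<open>X\<close> is a version of $\int h\,dW$: the simple integrands $\sum_{A \in F_n} c_n(A) 1_A$ converge
  to \<open>h\<close> in $L^2([0,T] \times \mathbb{R})$ and their integrals $\sum_{A \in F_n} c_n(A) W(A)$ converge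
  to \<open>X\<close> in $L^2(\Omega)$. By the Wiener isometry, \<open>X\<close> is determined by \<open>h\<close> almost surely.\<close>

definition has_wiener_integral ::
    "real \<Rightarrow> 'm measure \<Rightarrow> ((real \<times> real) set \<Rightarrow> 'm \<Rightarrow> real) \<Rightarrow> (real \<times> real \<Rightarrow> real) \<Rightarrow>
     ('m \<Rightarrow> real) \<Rightarrow> bool" where
  "has_wiener_integral T M W h X \<longleftrightarrow>
     h \<in> borel_measurable borel \<and> X \<in> borel_measurable M \<and>
     (\<exists>F c. (\<forall>n::nat. finite (F n) \<and> F n \<subseteq> noise_sets T) \<and>
        (\<lambda>n. \<integral>\<^sup>+p\<in>{0..T} \<times> UNIV. ennreal ((h p - (\<Sum>A\<in>F n. c n A * indicator A p))\<^sup>2) \<partial>lborel)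
          \<longlonglongrightarrow> 0 \<and>
        (\<lambda>n. \<integral>\<^sup>+\<omega>. ennreal ((X \<omega> - (\<Sum>A\<in>F n. c n A * W A \<omega>))\<^sup>2) \<partial>M) \<longlonglongrightarrow> 0)"

text \<open>For \<open>t > 0\<close> the integral is real because the imaginary part of the integrand is odd in
  \<open>l\<close>, so \<open>Re\<close> only changes the type. The value for \<open>t \<le> 0\<close> is never used, except on the null
  set \<open>r = t\<close> below.\<close>

definition green_kernel :: "real \<Rightarrow> real \<Rightarrow> real \<Rightarrow> real" where
  "green_kernel \<alpha> t x =
     Re (1 / (2 * of_real pi) *
       (\<integral>l. exp (- (\<i> * of_real l * of_real x) - of_real (t * \<bar>l\<bar> powr \<alpha>)) \<partial>lborel))"

text \<open>The mild solution is taken to be a modification all of whose paths are continuous, so that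
  hitting a compact set from a compact parameter set is a measurable event.\<close>

definition mild_solution ::
    "real \<Rightarrow> real \<Rightarrow> 'm measure \<Rightarrow> ('d::finite \<Rightarrow> (real \<times> real) set \<Rightarrow> 'm \<Rightarrow> real) \<Rightarrow>
     (real \<times> real \<Rightarrow> 'm \<Rightarrow> real ^ 'd) \<Rightarrow> bool" where
  "mild_solution \<alpha> T M W v \<longleftrightarrow>
     (\<forall>t\<in>{0..T}. \<forall>x i.
        has_wiener_integral T M (W i)
          (\<lambda>(r, w). indicator {0..t} r * green_kernel \<alpha> (t - r) (x - w))
          (\<lambda>\<omega>. v (t, x) \<omega> $ i)) \<and>
     (\<forall>\<omega>\<in>space M. continuous_on ({0..T} \<times> UNIV) (\<lambda>p. v p \<omega>))"

text \<open>Radius 0 is allowed so that finite covers can be padded: \<open>ball x 0 = {}\<close>, and since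
  \<open>0 powr \<beta> = 0\<close> also for \<open>\<beta> = 0\<close>, the padding costs nothing. In particular, the
  0-dimensional measure is the counting measure.\<close>

definition hausdorff_content :: "real \<Rightarrow> real \<Rightarrow> 'a::euclidean_space set \<Rightarrow> ennreal" where
  "hausdorff_content \<beta> \<epsilon> F =
     Inf {\<Sum>i. ennreal ((2 * r i) powr \<beta>) | (x :: nat \<Rightarrow> 'a) (r :: nat \<Rightarrow> real).
            (\<forall>i. 0 \<le> r i \<and> r i \<le> \<epsilon>) \<and> F \<subseteq> (\<Union>i. ball (x i) (r i))}"

definition hausdorff_measure :: "real \<Rightarrow> 'a::euclidean_space set \<Rightarrow> ennreal" where
  "hausdorff_measure \<beta> F =
     (if \<beta> < 0 then \<infinity> else Lim (at_right 0) (\<lambda>\<epsilon>. hausdorff_content \<beta> \<epsilon> F))"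

definition hitting_event ::
    "'m measure \<Rightarrow> ('p \<Rightarrow> 'm \<Rightarrow> 'a) \<Rightarrow> 'p set \<Rightarrow> 'a set \<Rightarrow> 'm set" where
  "hitting_event M v E A = {\<omega> \<in> space M. (\<lambda>p. v p \<omega>) ` E \<inter> A \<noteq> {}}"

end

theory Submission
  imports Defs "HOL-Real_Asymp.Real_Asymp"
begin

text \<open>Fix a radius \<open>\<epsilon>\<close> and cut the parameter set into cells with sides
  $\epsilon^{2\alpha/(\alpha-1)}$ in time and $\epsilon^{2/(\alpha-1)}$ in space, the scales at which
  the solution oscillates by about \<open>\<epsilon>\<close>. If the probability that \<open>v\<close> maps some point of one cell
  into a given ball of radius \<open>\<epsilon>\<close> is at most $C\epsilon^d$, as it is for a single point, then a
  union over the cells bounds the probability that \<open>v\<close> hits the ball by $C\epsilon^{d-Q}$, where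
  $\epsilon^{-Q}$ is the order of the number of cells: both factors count on a rectangle, only one of
  them on a vertical or horizontal segment. A union over the balls of a cover of \<open>A\<close> then gives the
  Hausdorff measure.

  The bound for a cell (\<open>hit_ball_from_cell\<close>) comes from chaining along dyadic points. If \<open>v\<close> comes
  within \<open>\<epsilon>\<close> of \<open>z\<close> in the cell, then either one of the corners is already mapped within \<open>2 * \<epsilon>\<close> of \<open>z\<close>, or
  it is mapped to distance at most \<open>(k + 3) * \<epsilon>\<close> from \<open>z\<close> and one of the dyadic increments is too long by a
  factor growing with \<open>k\<close> and with the level. The latter event involves only two jointly Gaussian
  vectors, the value \<open>X\<close> at a corner and an increment \<open>Y\<close>; by \<open>gaussian_pair_bound\<close> its
  probability is of order $((k+3)\epsilon)^d$, with a constant independent of \<open>z\<close>, times a Gaussian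
  tail for \<open>Y\<close>. The tails make the sum over \<open>k\<close>, over the levels and over the increments converge.

  The variances needed are $L^2$-norms of the Green kernel. Increments are bounded above through
  the inequality half of Plancherel's theorem (\<open>plancherel_le\<close>, \<open>nn_integral_heat_integrand_diff\<close>), and the
  variance at a point is bounded below because it increases with time and does not depend on space
  (\<open>nn_integral_heat_integrand_ge\<close>). Wiener integrals are $L^2$-limits of simple integrals, so
  their joint characteristic functions are Gaussian (\<open>wiener_integral_gaussian\<close>), and they are
  almost surely measurable functions of the noise, so that the components of \<open>v\<close> are independent
  (\<open>indep_wiener_integrals\<close>).\<close>

section \<open>Gaussian random variables\<close>

lemma char_normal_density:
  fixes \<sigma> :: real
  assumes "0 < \<sigma>"
  shows "char (density lborel (normal_density 0 \<sigma>)) t = complex_of_real (exp (- (\<sigma>\<^sup>2 * t\<^sup>2) / 2))"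
proof -
  let ?N = "density lborel (\<lambda>x. ennreal (std_normal_density x))"
  interpret N: prob_space ?N by (rule prob_space_normal_density) simp
  have "distributed ?N lborel (\<lambda>x. x) std_normal_density"
    by (auto simp: distributed_def distr_id2)
  from N.normal_density_affine[OF this, of \<sigma> 0]
  have "distributed ?N lborel (\<lambda>x. \<sigma> * x) (normal_density 0 \<sigma>)"
    using assms by simp
  then have eq: "distr ?N borel (\<lambda>x. \<sigma> * x) = density lborel (normal_density 0 \<sigma>)"
    by (simp add: distributed_def distr_cong[OF refl _ refl, of borel lborel])
  have "char (density lborel (normal_density 0 \<sigma>)) t = char ?N (\<sigma> * t)"
    unfolding eq[symmetric] char_def by (subst integral_distr) (auto simp: mult_ac)
  then show ?thesis
    by (simp add: char_std_normal_distribution power_mult_distrib)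
qed

lemma real_distribution_normal_density:
  "0 < \<sigma> \<Longrightarrow> real_distribution (density lborel (normal_density 0 \<sigma>))"
  using prob_space_normal_density[of \<sigma> 0]
  by (simp add: real_distribution_def real_distribution_axioms_def)

lemma real_distribution_return: "real_distribution (return borel (x :: real))"
  by (simp add: real_distribution_def real_distribution_axioms_def prob_space_return)

text \<open>The centred Gaussian laws are those with characteristic function $\exp(-\xi^2 V/2)$; the
  variance \<open>V\<close> may vanish. Phrasing the notion through characteristic functions makes it stable
  under $L^2$-limits.\<close>

definition centred_gaussian :: "'m measure \<Rightarrow> ('m \<Rightarrow> real) \<Rightarrow> real \<Rightarrow> bool" where
  "centred_gaussian M X V \<longleftrightarrow> X \<in> borel_measurable M \<and> 0 \<le> V \<and>
     (\<forall>\<xi>. (\<integral>\<omega>. iexp (\<xi> * X \<omega>) \<partial>M) = complex_of_real (exp (- (\<xi>\<^sup>2 * V) / 2)))"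

context prob_space
begin

lemma char_distr: "X \<in> borel_measurable M \<Longrightarrow> char (distr M borel X) \<xi> = (\<integral>\<omega>. iexp (\<xi> * X \<omega>) \<partial>M)"
  unfolding char_def by (subst integral_distr) auto

lemma centred_gaussian_distr:
  assumes "centred_gaussian M X V" "0 < V"
  shows "distr M borel X = density lborel (normal_density 0 (sqrt V))"
proof (rule Levy_uniqueness)
  have X: "X \<in> borel_measurable M" using assms by (simp add: centred_gaussian_def)
  then show "real_distribution (distr M borel X)" by simp
  show "real_distribution (density lborel (normal_density 0 (sqrt V)))"
    using assms by (intro real_distribution_normal_density) simp
  show "char (distr M borel X) = char (density lborel (normal_density 0 (sqrt V)))"
    using assms X by (intro ext) (simp add: char_distr char_normal_density centred_gaussian_def mult.commute)
qed

lemma centred_gaussian_0: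
  assumes "centred_gaussian M X 0"
  shows "AE \<omega> in M. X \<omega> = 0"
proof -
  have X[measurable]: "X \<in> borel_measurable M" using assms by (simp add: centred_gaussian_def)
  have eq: "distr M borel X = return borel 0"
  proof (rule Levy_uniqueness)
    show "real_distribution (distr M borel X)" by simp
    show "real_distribution (return borel (0::real))" by (rule real_distribution_return)
    show "char (distr M borel X) = char (return borel 0)"
      using assms X by (intro ext) (simp add: char_distr, simp add: centred_gaussian_def char_def integral_return)
  qed
  have "AE x in distr M borel X. x = 0"
    unfolding eq by (subst AE_return) auto
  then show ?thesis by (subst (asm) AE_distr_iff) auto
qed

text \<open>On $|x| > u$ the density of $N(0,V)$ is at most $\sqrt2 e^{-u^2/4V}$ times that of
  $N(0,2V)$.\<close>

lemma centred_gaussian_tail: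
  assumes X: "centred_gaussian M X V" and V: "V \<le> \<delta>" and \<delta>: "0 < \<delta>" and u: "0 \<le> u"
  shows "prob {\<omega> \<in> space M. u < \<bar>X \<omega>\<bar>} \<le> sqrt 2 * exp (- u\<^sup>2 / (4 * \<delta>))"
proof (cases "V = 0")
  case True
  have [measurable]: "X \<in> borel_measurable M" using X by (simp add: centred_gaussian_def)
  have "AE \<omega> in M. X \<omega> = 0" using X True centred_gaussian_0 by simp
  then have "prob {\<omega> \<in> space M. u < \<bar>X \<omega>\<bar>} = 0"
    using u by (intro prob_eq_0_AE) (auto elim!: eventually_mono)
  then show ?thesis by simp
next
  case False
  have [measurable]: "X \<in> borel_measurable M" using X by (simp add: centred_gaussian_def)
  have Vp: "0 < V" using X False by (simp add: centred_gaussian_def)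
  let ?c = "sqrt 2 * exp (- u\<^sup>2 / (4 * V))"
  have "emeasure M {\<omega> \<in> space M. u < \<bar>X \<omega>\<bar>} = emeasure (distr M borel X) {x. u < \<bar>x\<bar>}"
    by (subst emeasure_distr) (auto intro!: arg_cong[where f="emeasure M"])
  also have "\<dots> = (\<integral>\<^sup>+x. ennreal (normal_density 0 (sqrt V) x) * indicator {x. u < \<bar>x\<bar>} x \<partial>lborel)"
    unfolding centred_gaussian_distr[OF X Vp] by (subst emeasure_density) auto
  also have "\<dots> \<le> (\<integral>\<^sup>+x. ennreal ?c * ennreal (normal_density 0 (sqrt (2 * V)) x) \<partial>lborel)"
  proof (intro nn_integral_mono)
    fix x :: real
    show "ennreal (normal_density 0 (sqrt V) x) * indicator {x. u < \<bar>x\<bar>} x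
        \<le> ennreal ?c * ennreal (normal_density 0 (sqrt (2 * V)) x)"
    proof (cases "u < \<bar>x\<bar>")
      case True
      then have "u\<^sup>2 \<le> x\<^sup>2" using u by (metis abs_le_square_iff abs_of_nonneg less_imp_le)
      then have "u\<^sup>2 / (4 * V) \<le> x\<^sup>2 / (4 * V)" using Vp by (simp add: divide_right_mono)
      moreover have "x\<^sup>2 / (2 * V) = x\<^sup>2 / (4 * V) + x\<^sup>2 / (4 * V)" using Vp by (simp add: field_simps)
      ultimately have "exp (- x\<^sup>2 / (2 * V)) \<le> exp (- u\<^sup>2 / (4 * V)) * exp (- x\<^sup>2 / (4 * V))"
        by (simp add: exp_add[symmetric])
      moreover have "normal_density 0 (sqrt V) x = exp (- x\<^sup>2 / (2 * V)) / sqrt (2 * pi * V)"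
        using Vp by (simp add: normal_density_def)
      moreover have "normal_density 0 (sqrt (2 * V)) x = exp (- x\<^sup>2 / (4 * V)) / (sqrt 2 * sqrt (2 * pi * V))"
        using Vp by (simp add: normal_density_def real_sqrt_mult[symmetric] mult_ac)
      ultimately have "normal_density 0 (sqrt V) x \<le> ?c * normal_density 0 (sqrt (2 * V)) x"
        using Vp by (simp add: divide_right_mono)
      then show ?thesis using True by (simp add: ennreal_mult[symmetric])
    qed simp
  qed
  also have "\<dots> = ennreal ?c"
    using Vp by (subst nn_integral_cmult) (auto simp: nn_integral_eq_integral)
  finally have "prob {\<omega> \<in> space M. u < \<bar>X \<omega>\<bar>} \<le> ?c"
    by (simp add: emeasure_eq_measure)
  also have "\<dots> \<le> sqrt 2 * exp (- u\<^sup>2 / (4 * \<delta>))"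
    using V Vp \<delta> by (simp add: frac_le)
  finally show ?thesis .
qed

lemma centred_gaussian_interval:
  assumes X: "centred_gaussian M X V" and V: "0 < V" and s: "0 \<le> s" and w: "0 \<le> w"
  shows "prob {\<omega> \<in> space M. \<bar>X \<omega> - z\<bar> \<le> s \<and> w \<le> \<bar>X \<omega>\<bar>} \<le> s / sqrt V * exp (- w\<^sup>2 / (2 * V))"
proof -
  have [measurable]: "X \<in> borel_measurable M" using X by (simp add: centred_gaussian_def)
  let ?c = "exp (- w\<^sup>2 / (2 * V)) / sqrt (2 * pi * V)"
  let ?S = "{x. \<bar>x - z\<bar> \<le> s \<and> w \<le> \<bar>x\<bar>}"
  have "emeasure M {\<omega> \<in> space M. \<bar>X \<omega> - z\<bar> \<le> s \<and> w \<le> \<bar>X \<omega>\<bar>} = emeasure (distr M borel X) ?S"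
    by (subst emeasure_distr) (auto intro!: arg_cong[where f="emeasure M"])
  also have "\<dots> = (\<integral>\<^sup>+x. ennreal (normal_density 0 (sqrt V) x) * indicator ?S x \<partial>lborel)"
    unfolding centred_gaussian_distr[OF X V] by (subst emeasure_density) auto
  also have "\<dots> \<le> (\<integral>\<^sup>+x. ennreal ?c * indicator {z - s..z + s} x \<partial>lborel)"
  proof (intro nn_integral_mono)
    fix x :: real
    show "ennreal (normal_density 0 (sqrt V) x) * indicator ?S x \<le> ennreal ?c * indicator {z - s..z + s} x"
    proof (cases "x \<in> ?S")
      case True
      then have "w\<^sup>2 \<le> x\<^sup>2" using w by (metis abs_le_square_iff abs_of_nonneg mem_Collect_eq)
      then have "normal_density 0 (sqrt V) x \<le> ?c"
        using V by (simp add: normal_density_def divide_right_mono)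
      then show ?thesis using True by (auto simp: indicator_def intro!: ennreal_leI)
    qed simp
  qed
  also have "\<dots> = ennreal (?c * (2 * s))"
    using s V by (subst nn_integral_cmult_indicator) (auto simp: ennreal_mult[symmetric] simp del: ennreal_numeral)
  finally have "prob {\<omega> \<in> space M. \<bar>X \<omega> - z\<bar> \<le> s \<and> w \<le> \<bar>X \<omega>\<bar>} \<le> ?c * (2 * s)"
    using s V by (simp add: emeasure_eq_measure)
  also have "\<dots> \<le> s / sqrt V * exp (- w\<^sup>2 / (2 * V))"
  proof -
    have "sqrt 4 \<le> sqrt (2 * pi)" using pi_ge_two by (intro real_sqrt_le_mono) simp
    then have "2 \<le> sqrt (2 * pi)" by simp
    then have "2 / sqrt (2 * pi) \<le> 1" by simp
    then have "2 / sqrt (2 * pi) * (s / sqrt V * exp (- w\<^sup>2 / (2 * V))) \<le> 1 * (s / sqrt V * exp (- w\<^sup>2 / (2 * V)))"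
      using s V by (intro mult_right_mono) auto
    then show ?thesis by (simp add: real_sqrt_mult mult_ac)
  qed
  finally show ?thesis .
qed

lemma centred_gaussian_bump:
  assumes X: "centred_gaussian M X V" and V: "0 < V" and s: "0 < s"
  shows "(\<integral>\<omega>. exp (- (X \<omega> - z)\<^sup>2 / (2 * s\<^sup>2)) \<partial>M) \<le> s / sqrt V"
proof -
  have [measurable]: "X \<in> borel_measurable M" using X by (simp add: centred_gaussian_def)
  have "ennreal (\<integral>\<omega>. exp (- (X \<omega> - z)\<^sup>2 / (2 * s\<^sup>2)) \<partial>M) = (\<integral>\<^sup>+\<omega>. exp (- (X \<omega> - z)\<^sup>2 / (2 * s\<^sup>2)) \<partial>M)"
    by (rule nn_integral_eq_integral[symmetric]) (auto intro!: integrable_const_bound[where B=1])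
  also have "\<dots> = (\<integral>\<^sup>+x. exp (- (x - z)\<^sup>2 / (2 * s\<^sup>2)) \<partial>distr M borel X)"
    by (subst nn_integral_distr) auto
  also have "\<dots> = (\<integral>\<^sup>+x. ennreal (normal_density 0 (sqrt V) x) * exp (- (x - z)\<^sup>2 / (2 * s\<^sup>2)) \<partial>lborel)"
    unfolding centred_gaussian_distr[OF X V] by (subst nn_integral_density) auto
  also have "\<dots> \<le> (\<integral>\<^sup>+x. ennreal (s / sqrt V) * ennreal (normal_density z s x) \<partial>lborel)"
  proof (intro nn_integral_mono)
    fix x :: real
    have "normal_density 0 (sqrt V) x \<le> 1 / sqrt (2 * pi * V)"
      using V by (simp add: normal_density_def divide_right_mono)
    then have "normal_density 0 (sqrt V) x * exp (- (x - z)\<^sup>2 / (2 * s\<^sup>2))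
        \<le> 1 / sqrt (2 * pi * V) * exp (- (x - z)\<^sup>2 / (2 * s\<^sup>2))"
      by (rule mult_right_mono) simp
    also have "\<dots> = s / sqrt V * normal_density z s x"
      using s V by (simp add: normal_density_def real_sqrt_mult)
    finally show "ennreal (normal_density 0 (sqrt V) x) * exp (- (x - z)\<^sup>2 / (2 * s\<^sup>2)) \<le> ennreal (s / sqrt V) * ennreal (normal_density z s x)"
      using s V by (simp add: ennreal_mult[symmetric])
  qed
  also have "\<dots> = ennreal (s / sqrt V)"
    using s by (subst nn_integral_cmult) (auto simp: nn_integral_eq_integral)
  finally show ?thesis using s V by simp
qed

text \<open>The bump is the average of $e^{i\xi(X-z)}$ over $\xi \sim N(0, s^{-2})$, so weighting by it
  does not change the characteristic function of \<open>N\<close>.\<close>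

lemma bump_independent:
  fixes z :: real
  assumes [measurable]: "X \<in> borel_measurable M" "N \<in> borel_measurable M"
    and fac: "\<And>\<xi> \<eta>. (\<integral>\<omega>. iexp (\<xi> * X \<omega> + \<eta> * N \<omega>) \<partial>M)
                   = (\<integral>\<omega>. iexp (\<xi> * X \<omega>) \<partial>M) * (\<integral>\<omega>. iexp (\<eta> * N \<omega>) \<partial>M)"
    and s: "0 < s" and B[measurable]: "B \<in> sets borel"
  defines "f \<equiv> \<lambda>\<omega>. exp (- (X \<omega> - z)\<^sup>2 / (2 * s\<^sup>2))"
  shows "(\<integral>\<omega>. f \<omega> * indicator B (N \<omega>) \<partial>M) = (\<integral>\<omega>. f \<omega> \<partial>M) * prob {\<omega> \<in> space M. N \<omega> \<in> B}"
proof -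
  let ?G = "density lborel (normal_density 0 (1 / s))"
  interpret G: real_distribution ?G using s by (intro real_distribution_normal_density) simp
  interpret MG: pair_prob_space M ?G ..
  have f_meas[measurable]: "f \<in> borel_measurable M" unfolding f_def by measurable
  have f_int: "integrable M f"
    by (rule integrable_const_bound[where B=1]) (auto simp: f_def)
  have f_char: "complex_of_real (f \<omega>) = (\<integral>\<xi>. iexp ((X \<omega> - z) * \<xi>) \<partial>?G)" for \<omega>
    using char_normal_density[of "1/s" "X \<omega> - z"] s
    by (simp add: f_def char_def power_divide)
  have bump_exp: "(\<integral>\<omega>. f \<omega> * iexp (\<eta> * N \<omega>) \<partial>M)
      = (\<integral>\<xi>. iexp (- z * \<xi>) * (\<integral>\<omega>. iexp (\<xi> * X \<omega> + \<eta> * N \<omega>) \<partial>M) \<partial>?G)" for \<eta>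
  proof -
    have "(\<integral>\<omega>. f \<omega> * iexp (\<eta> * N \<omega>) \<partial>M) = (\<integral>\<omega>. (\<integral>\<xi>. iexp ((X \<omega> - z) * \<xi>) * iexp (\<eta> * N \<omega>) \<partial>?G) \<partial>M)"
      unfolding f_char by (subst integral_mult_left_zero) simp
    also have "\<dots> = (\<integral>\<xi>. (\<integral>\<omega>. iexp ((X \<omega> - z) * \<xi>) * iexp (\<eta> * N \<omega>) \<partial>M) \<partial>?G)"
      by (rule MG.Fubini_integral[symmetric])
         (auto simp: split_beta' norm_mult intro!: MG.integrable_const_bound[where B=1])
    also have "\<dots> = (\<integral>\<xi>. (\<integral>\<omega>. iexp (- z * \<xi>) * iexp (\<xi> * X \<omega> + \<eta> * N \<omega>) \<partial>M) \<partial>?G)"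
      by (intro Bochner_Integration.integral_cong refl)
         (simp add: exp_add[symmetric] algebra_simps)
    also have "\<dots> = (\<integral>\<xi>. iexp (- z * \<xi>) * (\<integral>\<omega>. iexp (\<xi> * X \<omega> + \<eta> * N \<omega>) \<partial>M) \<partial>?G)"
      by (subst integral_mult_right_zero) simp
    finally show ?thesis .
  qed
  have split: "(\<integral>\<omega>. f \<omega> * iexp (\<eta> * N \<omega>) \<partial>M) = (\<integral>\<omega>. f \<omega> \<partial>M) * (\<integral>\<omega>. iexp (\<eta> * N \<omega>) \<partial>M)" for \<eta>
  proof -
    have "(\<integral>\<omega>. f \<omega> * iexp (\<eta> * N \<omega>) \<partial>M)
        = (\<integral>\<xi>. iexp (- z * \<xi>) * (\<integral>\<omega>. iexp (\<xi> * X \<omega>) \<partial>M) \<partial>?G) * (\<integral>\<omega>. iexp (\<eta> * N \<omega>) \<partial>M)"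
      unfolding bump_exp fac by (simp add: mult.assoc[symmetric])
    also have "(\<integral>\<xi>. iexp (- z * \<xi>) * (\<integral>\<omega>. iexp (\<xi> * X \<omega>) \<partial>M) \<partial>?G) = (\<integral>\<omega>. complex_of_real (f \<omega>) \<partial>M)"
      using bump_exp[of 0] by simp
    finally show ?thesis by simp
  qed
  define m where "m = (\<integral>\<omega>. f \<omega> \<partial>M)"
  have m: "0 < m"
  proof -
    have "0 \<le> m" unfolding m_def by (simp add: f_def)
    moreover have "m \<noteq> 0"
    proof
      assume "m = 0"
      then have "AE \<omega> in M. f \<omega> = 0"
        unfolding m_def using f_int by (subst (asm) integral_nonneg_eq_0_iff_AE) (auto simp: f_def)
      then show False by (simp add: f_def)
    qed
    ultimately show ?thesis by simp
  qed
  let ?D = "density M (\<lambda>\<omega>. ennreal (f \<omega> / m))"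
  have "prob_space ?D"
  proof
    have "emeasure ?D (space ?D) = (\<integral>\<^sup>+\<omega>. f \<omega> / m \<partial>M)"
      by (subst emeasure_density) (auto intro!: nn_integral_cong)
    also have "\<dots> = ennreal (\<integral>\<omega>. f \<omega> / m \<partial>M)"
      using m f_int by (intro nn_integral_eq_integral) (auto simp: f_def)
    also have "\<dots> = 1" using m by (simp add: m_def)
    finally show "emeasure ?D (space ?D) = 1" .
  qed
  then interpret D: prob_space ?D .
  have "distr ?D borel N = distr M borel N"
  proof (rule Levy_uniqueness)
    show "real_distribution (distr ?D borel N)" by (rule D.real_distribution_distr) simp
    show "real_distribution (distr M borel N)" by simp
    show "char (distr ?D borel N) = char (distr M borel N)"
    proof
      fix \<eta>
      have "char (distr ?D borel N) \<eta> = (\<integral>\<omega>. iexp (\<eta> * N \<omega>) \<partial>?D)"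
        by (rule D.char_distr) simp
      also have "\<dots> = (\<integral>\<omega>. (f \<omega> / m) *\<^sub>R iexp (\<eta> * N \<omega>) \<partial>M)"
        using m by (intro integral_density) (auto simp: f_def)
      also have "\<dots> = (\<integral>\<omega>. f \<omega> * iexp (\<eta> * N \<omega>) / m \<partial>M)"
        by (simp add: scaleR_conv_of_real)
      also have "\<dots> = (\<integral>\<omega>. f \<omega> * iexp (\<eta> * N \<omega>) \<partial>M) / m"
        by (rule integral_divide_zero)
      also have "\<dots> = char (distr M borel N) \<eta>"
        unfolding split m_def[symmetric] using m by (simp add: char_distr)
      finally show "char (distr ?D borel N) \<eta> = char (distr M borel N) \<eta>" .
    qed
  qed
  then have "measure (distr ?D borel N) B = measure (distr M borel N) B" by simp
  then have 1: "measure ?D {\<omega> \<in> space M. N \<omega> \<in> B} = prob {\<omega> \<in> space M. N \<omega> \<in> B}"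
    by (simp add: measure_distr vimage_def Int_def conj_commute)
  have "measure ?D {\<omega> \<in> space M. N \<omega> \<in> B} = (\<integral>\<omega>. indicator {\<omega> \<in> space M. N \<omega> \<in> B} \<omega> \<partial>?D)"
    by simp
  also have "\<dots> = (\<integral>\<omega>. (f \<omega> / m) *\<^sub>R indicator {\<omega> \<in> space M. N \<omega> \<in> B} \<omega> \<partial>M)"
    using m by (intro integral_density) (auto simp: f_def)
  also have "\<dots> = (\<integral>\<omega>. f \<omega> * indicator B (N \<omega>) / m \<partial>M)"
    by (intro Bochner_Integration.integral_cong refl) (auto simp: indicator_def)
  also have "\<dots> = (\<integral>\<omega>. f \<omega> * indicator B (N \<omega>) \<partial>M) / m"
    by (rule integral_divide_zero)
  finally show ?thesis using 1 m by (simp add: m_def field_simps)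
qed

text \<open>Write \<open>Y = \<rho> X + N\<close> with \<open>\<rho> = b / a\<close>, so that \<open>N\<close> is uncorrelated with, hence
  independent of, \<open>X\<close>. If \<open>\<bar>Y\<bar> > u\<close>, then \<open>\<bar>N\<bar> > u / 2\<close> or \<open>\<bar>X\<bar> > u * sqrt a / (2 * sqrt \<delta>)\<close>,
  because \<open>\<bar>\<rho>\<bar> \<le> sqrt (\<delta> / a)\<close>.\<close>

lemma gaussian_pair_bound:
  assumes [measurable]: "X \<in> borel_measurable M" "Y \<in> borel_measurable M"
    and ch: "\<And>\<xi> \<eta>. (\<integral>\<omega>. iexp (\<xi> * X \<omega> + \<eta> * Y \<omega>) \<partial>M)
             = complex_of_real (exp (- (\<xi>\<^sup>2 * a + 2 * \<xi> * \<eta> * b + \<eta>\<^sup>2 * c) / 2))"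
    and a: "0 < a" and c: "c \<le> \<delta>" and \<delta>: "0 < \<delta>" and s: "0 < s" and u: "0 \<le> u"
  shows "prob {\<omega> \<in> space M. \<bar>X \<omega> - z\<bar> \<le> s \<and> u < \<bar>Y \<omega>\<bar>}
    \<le> 4 * s / sqrt a * exp (- u\<^sup>2 / (16 * \<delta>))"
proof -
  define \<rho> where "\<rho> = b / a"
  define N where "N \<omega> = Y \<omega> - \<rho> * X \<omega>" for \<omega>
  have N_meas[measurable]: "N \<in> borel_measurable M" unfolding N_def by measurable
  \<comment> \<open>the exponent is nonnegative since characteristic functions are bounded by 1\<close>
  have nonneg: "0 \<le> \<xi>\<^sup>2 * a + 2 * \<xi> * \<eta> * b + \<eta>\<^sup>2 * c" for \<xi> \<eta>
  proof -
    have "norm (\<integral>\<omega>. iexp (\<xi> * X \<omega> + \<eta> * Y \<omega>) \<partial>M) \<le> (\<integral>\<omega>. norm (iexp (\<xi> * X \<omega> + \<eta> * Y \<omega>)) \<partial>M)"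
      by (rule integral_norm_bound)
    also have "\<dots> = 1" by (simp del: of_real_add of_real_mult add: prob_space)
    finally show ?thesis unfolding ch norm_of_real by simp
  qed
  have var_N: "c - b\<^sup>2 / a = \<rho>\<^sup>2 * a - 2 * \<rho> * b + c"
    using a by (simp add: \<rho>_def power2_eq_square)
  then have cN: "0 \<le> c - b\<^sup>2 / a" using nonneg[of "- \<rho>" 1] by simp
  have N_ch: "(\<integral>\<omega>. iexp (\<xi> * X \<omega> + \<eta> * N \<omega>) \<partial>M)
      = complex_of_real (exp (- (\<xi>\<^sup>2 * a) / 2)) * complex_of_real (exp (- (\<eta>\<^sup>2 * (c - b\<^sup>2 / a)) / 2))" for \<xi> \<eta>
  proof -
    have "(\<integral>\<omega>. iexp (\<xi> * X \<omega> + \<eta> * N \<omega>) \<partial>M) = (\<integral>\<omega>. iexp ((\<xi> - \<eta> * \<rho>) * X \<omega> + \<eta> * Y \<omega>) \<partial>M)"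
      by (simp add: N_def algebra_simps)
    also have "\<dots> = complex_of_real (exp (- ((\<xi> - \<eta> * \<rho>)\<^sup>2 * a + 2 * (\<xi> - \<eta> * \<rho>) * \<eta> * b + \<eta>\<^sup>2 * c) / 2))"
      by (rule ch)
    also have "(\<xi> - \<eta> * \<rho>)\<^sup>2 * a + 2 * (\<xi> - \<eta> * \<rho>) * \<eta> * b + \<eta>\<^sup>2 * c = \<xi>\<^sup>2 * a + \<eta>\<^sup>2 * (c - b\<^sup>2 / a)"
      using a by (simp add: \<rho>_def power2_eq_square field_simps)
    finally show ?thesis
      by (simp add: of_real_mult[symmetric] exp_add[symmetric] add_divide_distrib del: of_real_mult)
  qed
  have fac: "(\<integral>\<omega>. iexp (\<xi> * X \<omega> + \<eta> * N \<omega>) \<partial>M)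
      = (\<integral>\<omega>. iexp (\<xi> * X \<omega>) \<partial>M) * (\<integral>\<omega>. iexp (\<eta> * N \<omega>) \<partial>M)" for \<xi> \<eta>
    using N_ch[of \<xi> \<eta>] N_ch[of \<xi> 0] N_ch[of 0 \<eta>] by simp
  have X_g: "centred_gaussian M X a"
    using N_ch[of _ 0] a by (auto simp: centred_gaussian_def)
  have N_g: "centred_gaussian M N (c - b\<^sup>2 / a)"
    using N_ch[of 0] cN by (auto simp: centred_gaussian_def)
  have cc: "0 \<le> c" using nonneg[of 0 1] by simp
  have b2: "b\<^sup>2 \<le> a * c" using cN a by (simp add: field_simps)
  define f where "f \<omega> = exp (- (X \<omega> - z)\<^sup>2 / (2 * s\<^sup>2))" for \<omega>
  have f_meas[measurable]: "f \<in> borel_measurable M" unfolding f_def by measurable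
  have f1: "f \<omega> \<le> 1" "0 \<le> f \<omega>" for \<omega> by (auto simp: f_def)
  let ?A = "{\<omega> \<in> space M. \<bar>X \<omega> - z\<bar> \<le> s \<and> u / 2 < \<bar>N \<omega>\<bar>}"
  define w where "w = u * sqrt a / (2 * sqrt \<delta>)"
  let ?B = "{\<omega> \<in> space M. \<bar>X \<omega> - z\<bar> \<le> s \<and> w \<le> \<bar>X \<omega>\<bar>}"
  have sub: "{\<omega> \<in> space M. \<bar>X \<omega> - z\<bar> \<le> s \<and> u < \<bar>Y \<omega>\<bar>} \<subseteq> ?A \<union> ?B"
  proof safe
    fix \<omega> assume *: "u < \<bar>Y \<omega>\<bar>" "\<not> w \<le> \<bar>X \<omega>\<bar>"
    have "\<rho>\<^sup>2 \<le> \<delta> / a"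
    proof -
      have "b\<^sup>2 \<le> a * \<delta>" using b2 c a by (meson mult_left_mono less_imp_le order_trans)
      then show ?thesis using a by (simp add: \<rho>_def power_divide power2_eq_square field_simps)
    qed
    then have "\<bar>\<rho>\<bar> \<le> sqrt (\<delta> / a)" by (metis real_sqrt_abs real_sqrt_le_iff)
    then have "\<bar>\<rho> * X \<omega>\<bar> \<le> sqrt (\<delta> / a) * w"
      unfolding abs_mult using * a \<delta> by (intro mult_mono) auto
    also have "\<dots> = u / 2" using a \<delta> by (simp add: w_def real_sqrt_divide)
    finally have "\<bar>\<rho> * X \<omega>\<bar> \<le> u / 2" .
    then show "u / 2 < \<bar>N \<omega>\<bar>" using * unfolding N_def by linarith
  qed
  have B: "prob ?B \<le> s / sqrt a * exp (- u\<^sup>2 / (16 * \<delta>))"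
  proof -
    have "prob ?B \<le> s / sqrt a * exp (- w\<^sup>2 / (2 * a))"
      using X_g a s u \<delta> by (intro centred_gaussian_interval) (auto simp: w_def)
    also have "w\<^sup>2 / (2 * a) = u\<^sup>2 / (8 * \<delta>)"
      using a \<delta> by (simp add: w_def power_mult_distrib power_divide)
    then have "- w\<^sup>2 / (2 * a) = - u\<^sup>2 / (8 * \<delta>)" by simp
    also have "exp (- u\<^sup>2 / (8 * \<delta>)) \<le> exp (- u\<^sup>2 / (16 * \<delta>))"
      using \<delta> by (simp add: frac_le)
    finally show ?thesis using s a by (simp add: mult_left_mono divide_right_mono)
  qed
  have A: "prob ?A \<le> 3 * s / sqrt a * exp (- u\<^sup>2 / (16 * \<delta>))"
  proof -
    have "prob ?A = (\<integral>\<omega>. indicator ?A \<omega> \<partial>M)" by simp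
    \<comment> \<open>where \<open>X\<close> is within \<open>s\<close> of \<open>z\<close>, the bump is at least \<open>exp (- 1 / 2)\<close>\<close>
    also have "\<dots> \<le> (\<integral>\<omega>. exp (1 / 2) * (f \<omega> * indicator {x. u / 2 < \<bar>x\<bar>} (N \<omega>)) \<partial>M)"
    proof (rule integral_mono)
      show "integrable M (\<lambda>\<omega>. exp (1 / 2) * (f \<omega> * indicator {x. u / 2 < \<bar>x\<bar>} (N \<omega>)))"
        by (rule integrable_const_bound[where B="exp (1/2)"])
           (auto simp: f1 indicator_def)
      fix \<omega>
      show "indicator ?A \<omega> \<le> exp (1 / 2) * (f \<omega> * indicator {x. u / 2 < \<bar>x\<bar>} (N \<omega>))"
      proof (cases "\<omega> \<in> ?A")
        case True
        then have "(X \<omega> - z)\<^sup>2 \<le> s\<^sup>2" using s by (simp add: abs_le_square_iff[symmetric])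
        then have "(X \<omega> - z)\<^sup>2 / (2 * s\<^sup>2) \<le> 1 / 2" using s by (simp add: field_simps)
        then have "1 \<le> exp (1/2) * f \<omega>" by (simp add: f_def exp_add[symmetric])
        then show ?thesis using True by simp
      qed (simp add: f1)
      show "integrable M (indicator ?A :: 'a \<Rightarrow> real)"
        by (rule integrable_const_bound[where B=1]) (auto simp: indicator_def)
    qed
    also have "\<dots> = exp (1 / 2) * ((\<integral>\<omega>. f \<omega> \<partial>M) * prob {\<omega> \<in> space M. N \<omega> \<in> {x. u / 2 < \<bar>x\<bar>}})"
      unfolding integral_mult_right_zero f_def
      by (subst bump_independent[OF _ _ fac s]) auto
    also have "\<dots> \<le> exp (1 / 2) * (s / sqrt a * (sqrt 2 * exp (- (u / 2)\<^sup>2 / (4 * \<delta>))))"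
    proof (intro mult_left_mono mult_mono)
      show "(\<integral>\<omega>. f \<omega> \<partial>M) \<le> s / sqrt a"
        unfolding f_def using X_g a s by (rule centred_gaussian_bump)
      have "c - b\<^sup>2 / a \<le> \<delta>" using c a by (smt (verit) divide_nonneg_pos zero_le_power2)
      then show "prob {\<omega> \<in> space M. N \<omega> \<in> {x. u / 2 < \<bar>x\<bar>}} \<le> sqrt 2 * exp (- (u / 2)\<^sup>2 / (4 * \<delta>))"
        using centred_gaussian_tail[OF N_g, of \<delta> "u / 2"] \<delta> u by simp
    qed (use s a in auto)
    also have "\<dots> = (exp (1 / 2) * sqrt 2) * (s / sqrt a * exp (- u\<^sup>2 / (16 * \<delta>)))"
      by (simp add: power_divide)
    also have "\<dots> \<le> 3 * (s / sqrt a * exp (- u\<^sup>2 / (16 * \<delta>)))"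
    proof (intro mult_right_mono)
      have "(exp (1/2) * sqrt 2)\<^sup>2 = exp 1 * (2::real)"
        by (simp add: power_mult_distrib exp_of_nat_mult[symmetric])
      also have "\<dots> \<le> 3\<^sup>2" using exp_le by simp
      finally show "exp (1 / 2) * sqrt 2 \<le> (3::real)" by (rule power2_le_imp_le) simp
    qed (use s a in auto)
    finally show ?thesis by simp
  qed
  have "prob {\<omega> \<in> space M. \<bar>X \<omega> - z\<bar> \<le> s \<and> u < \<bar>Y \<omega>\<bar>} \<le> prob (?A \<union> ?B)"
    by (rule finite_measure_mono[OF sub]) measurable
  also have "\<dots> \<le> prob ?A + prob ?B"
    by (rule measure_Un_le) measurable
  also have "\<dots> \<le> 3 * s / sqrt a * exp (- u\<^sup>2 / (16 * \<delta>)) + s / sqrt a * exp (- u\<^sup>2 / (16 * \<delta>))"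
    using A B by (rule add_mono)
  also have "\<dots> = 4 * s / sqrt a * exp (- u\<^sup>2 / (16 * \<delta>))"
    by (simp add: field_simps)
  finally show ?thesis .
qed

end

section \<open>Plancherel's inequality\<close>

lemma norm_integral_le_nn_integral:
  fixes f :: "'a \<Rightarrow> 'b :: {banach, second_countable_topology}"
  shows "ennreal (norm (integral\<^sup>L M f)) \<le> (\<integral>\<^sup>+x. ennreal (norm (f x)) \<partial>M)"
proof (cases "integrable M f")
  case True
  then show ?thesis
    by (rule integral_norm_bound_ennreal)
qed (simp add: not_integrable_integral_eq)

lemma nn_integral_gaussian:
  fixes \<sigma> :: real
  assumes "0 < \<sigma>"
  shows "(\<integral>\<^sup>+m. ennreal (exp (- (\<sigma>\<^sup>2 * (l - m)\<^sup>2) / 2)) \<partial>lborel) = ennreal (sqrt (2 * pi) / \<sigma>)"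
proof -
  have "(\<integral>\<^sup>+m. ennreal (exp (- (\<sigma>\<^sup>2 * (l - m)\<^sup>2) / 2)) \<partial>lborel)
      = (\<integral>\<^sup>+m. ennreal (sqrt (2 * pi) / \<sigma>) * ennreal (normal_density l (1 / \<sigma>) m) \<partial>lborel)"
  proof (intro nn_integral_cong)
    fix m
    have "(l - m)\<^sup>2 = (m - l)\<^sup>2" by (simp add: power2_eq_square algebra_simps)
    then have "exp (- (\<sigma>\<^sup>2 * (l - m)\<^sup>2) / 2) = sqrt (2 * pi) / \<sigma> * normal_density l (1 / \<sigma>) m"
      using assms by (simp add: normal_density_def real_sqrt_divide power_divide mult.commute)
    then show "ennreal (exp (- (\<sigma>\<^sup>2 * (l - m)\<^sup>2) / 2)) = ennreal (sqrt (2 * pi) / \<sigma>) * ennreal (normal_density l (1 / \<sigma>) m)"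
      using assms by (simp only: ennreal_mult[symmetric] normal_density_nonneg) (simp add: ennreal_mult[symmetric])
  qed
  also have "\<dots> = ennreal (sqrt (2 * pi) / \<sigma>)"
    using assms by (subst nn_integral_cmult) (auto simp: nn_integral_eq_integral)
  finally show ?thesis .
qed

text \<open>Against a Gaussian weight, $\int |g|^2$ becomes a double integral of
  \<open>\<phi> l * cnj (\<phi> m)\<close> with a Gaussian kernel in \<open>l - m\<close>, which is bounded by
  \<open>\<bar>\<phi> l\<bar> * \<bar>\<phi> m\<bar> \<le> (\<bar>\<phi> l\<bar>\<^sup>2 + \<bar>\<phi> m\<bar>\<^sup>2) / 2\<close>.\<close>

lemma plancherel_le_gaussian:
  fixes \<phi> :: "real \<Rightarrow> complex"
  assumes \<phi>: "integrable lborel \<phi>" and \<sigma>: "0 < \<sigma>"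
  defines "g \<equiv> \<lambda>w. (\<integral>l. iexp (l * w) * \<phi> l \<partial>lborel)"
  shows "(\<integral>\<^sup>+w. ennreal ((norm (g w))\<^sup>2) * ennreal (normal_density 0 \<sigma> w) \<partial>lborel)
    \<le> ennreal (sqrt (2 * pi) / \<sigma>) * (\<integral>\<^sup>+l. ennreal ((norm (\<phi> l))\<^sup>2) \<partial>lborel)"
proof -
  let ?G = "density lborel (normal_density 0 \<sigma>)"
  interpret G: real_distribution ?G using \<sigma> by (rule real_distribution_normal_density)
  interpret GL: pair_sigma_finite ?G lborel ..
  have [measurable]: "cnj \<in> borel_measurable borel"
    by (intro borel_measurable_continuous_onI continuous_intros)
  have [measurable]: "\<phi> \<in> borel_measurable borel" using \<phi> by auto
  have g_meas[measurable]: "g \<in> borel_measurable borel" unfolding g_def by measurable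
  define C where "C = (\<integral>l. norm (\<phi> l) \<partial>lborel)"
  have C: "norm (g w) \<le> C" for w
  proof -
    have "norm (g w) \<le> (\<integral>l. norm (iexp (l * w) * \<phi> l) \<partial>lborel)"
      unfolding g_def by (rule integral_norm_bound)
    then show ?thesis by (simp add: norm_mult C_def del: of_real_mult)
  qed
  have int1: "integrable lborel (\<lambda>l. iexp (l * w) * \<phi> l * c)" for w c
    by (rule Bochner_Integration.integrable_bound[OF integrable_norm[OF integrable_mult_left[OF \<phi>, of c]]])
       (auto simp: norm_mult simp del: of_real_mult)
  define k where "k u = exp (- (\<sigma>\<^sup>2 * u\<^sup>2) / 2)" for u :: real
  have [measurable]: "k \<in> borel_measurable borel" unfolding k_def by measurable
  define K where "K l = (\<integral>w. iexp (l * w) * cnj (g w) \<partial>?G)" for l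
  have [measurable]: "K \<in> borel_measurable borel" unfolding K_def by measurable
  have K_eq: "K l = (\<integral>m. cnj (\<phi> m) * k (l - m) \<partial>lborel)" for l
  proof -
    have "K l = (\<integral>w. (\<integral>m. iexp (l * w) * cnj (iexp (m * w) * \<phi> m) \<partial>lborel) \<partial>?G)"
      unfolding K_def g_def by (subst integral_mult_right_zero) (simp del: complex_cnj_mult)
    also have "\<dots> = (\<integral>m. (\<integral>w. iexp (l * w) * cnj (iexp (m * w) * \<phi> m) \<partial>?G) \<partial>lborel)"
    proof (rule GL.Fubini_integral[symmetric], rule GL.Fubini_integrable)
      show "integrable ?G (\<lambda>w. \<integral>m. norm (case (w, m) of (w, m) \<Rightarrow> iexp (l * w) * cnj (iexp (m * w) * \<phi> m)) \<partial>lborel)"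
        by (simp add: norm_mult del: of_real_mult)
      have "integrable lborel (\<lambda>m. iexp (l * w) * cnj (iexp (m * w) * \<phi> m))" for w
        using int1[of w 1] by (intro integrable_mult_right integrable_cnj) (simp)
      then show "AE w in ?G. integrable lborel (\<lambda>m. case (w, m) of (w, m) \<Rightarrow> iexp (l * w) * cnj (iexp (m * w) * \<phi> m))"
        by simp
    qed measurable
    also have "\<dots> = (\<integral>m. (\<integral>w. cnj (\<phi> m) * iexp ((l - m) * w) \<partial>?G) \<partial>lborel)"
      by (intro Bochner_Integration.integral_cong refl)
         (simp add: exp_cnj exp_diff exp_minus field_simps)
    also have "\<dots> = (\<integral>m. cnj (\<phi> m) * char ?G (l - m) \<partial>lborel)"
      unfolding char_def by (subst integral_mult_right_zero) simp
    also have "\<dots> = (\<integral>m. cnj (\<phi> m) * k (l - m) \<partial>lborel)"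
      unfolding char_normal_density[OF \<sigma>] k_def ..
    finally show ?thesis .
  qed
  have "complex_of_real (\<integral>w. (norm (g w))\<^sup>2 \<partial>?G) = (\<integral>w. g w * cnj (g w) \<partial>?G)"
    unfolding integral_complex_of_real[symmetric] by (simp add: complex_norm_square del: of_real_power)
  also have "\<dots> = (\<integral>w. (\<integral>l. iexp (l * w) * \<phi> l * cnj (g w) \<partial>lborel) \<partial>?G)"
    by (subst integral_mult_left_zero) (simp add: g_def)
  also have "\<dots> = (\<integral>l. (\<integral>w. iexp (l * w) * \<phi> l * cnj (g w) \<partial>?G) \<partial>lborel)"
  proof (rule GL.Fubini_integral[symmetric], rule GL.Fubini_integrable)
    show "integrable ?G (\<lambda>w. \<integral>l. norm (case (w, l) of (w, l) \<Rightarrow> iexp (l * w) * \<phi> l * cnj (g w)) \<partial>lborel)"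
      using C by (auto simp: norm_mult simp del: of_real_mult intro!: G.integrable_const_bound[where B=C] integrable_mult_right)
    show "AE w in ?G. integrable lborel (\<lambda>l. case (w, l) of (w, l) \<Rightarrow> iexp (l * w) * \<phi> l * cnj (g w))"
      using int1 by simp
  qed measurable
  also have "\<dots> = (\<integral>l. \<phi> l * K l \<partial>lborel)"
    unfolding K_def by (subst integral_mult_right_zero[symmetric]) (simp add: mult_ac)
  finally have eq: "complex_of_real (\<integral>w. (norm (g w))\<^sup>2 \<partial>?G) = (\<integral>l. \<phi> l * K l \<partial>lborel)" .
  let ?S = "\<integral>\<^sup>+l. ennreal ((norm (\<phi> l))\<^sup>2) \<partial>lborel"
  have "(\<integral>\<^sup>+w. ennreal ((norm (g w))\<^sup>2) * ennreal (normal_density 0 \<sigma> w) \<partial>lborel) = (\<integral>\<^sup>+w. ennreal ((norm (g w))\<^sup>2) \<partial>?G)"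
    by (subst nn_integral_density) (auto simp: mult.commute)
  also have "\<dots> = ennreal (\<integral>w. (norm (g w))\<^sup>2 \<partial>?G)"
    using C by (intro nn_integral_eq_integral G.integrable_const_bound[where B="C\<^sup>2"]) (auto intro!: power_mono)
  also have "\<dots> = ennreal (norm (complex_of_real (\<integral>w. (norm (g w))\<^sup>2 \<partial>?G)))"
    by (simp only: norm_of_real) simp
  also have "\<dots> \<le> (\<integral>\<^sup>+l. ennreal (norm (\<phi> l * K l)) \<partial>lborel)"
    unfolding eq by (rule norm_integral_le_nn_integral)
  also have "\<dots> = (\<integral>\<^sup>+l. ennreal (norm (\<phi> l)) * ennreal (norm (K l)) \<partial>lborel)"
    by (simp add: norm_mult ennreal_mult)
  also have "\<dots> \<le> (\<integral>\<^sup>+l. ennreal (norm (\<phi> l)) * (\<integral>\<^sup>+m. ennreal (norm (cnj (\<phi> m) * k (l - m))) \<partial>lborel) \<partial>lborel)"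
    unfolding K_eq by (intro nn_integral_mono mult_left_mono norm_integral_le_nn_integral) simp
  also have "\<dots> = (\<integral>\<^sup>+l. (\<integral>\<^sup>+m. ennreal (norm (\<phi> l) * norm (\<phi> m) * k (l - m)) \<partial>lborel) \<partial>lborel)"
    by (subst nn_integral_cmult[symmetric])
       (auto simp: norm_mult ennreal_mult[symmetric] k_def mult.assoc intro!: nn_integral_cong)
  also have "\<dots> \<le> (\<integral>\<^sup>+l. (\<integral>\<^sup>+m. ennreal (1/2) * (ennreal ((norm (\<phi> l))\<^sup>2) * ennreal (k (l - m))
      + ennreal ((norm (\<phi> m))\<^sup>2) * ennreal (k (l - m))) \<partial>lborel) \<partial>lborel)"
  proof (intro nn_integral_mono)
    fix l m
    have "norm (\<phi> l) * norm (\<phi> m) \<le> 1/2 * ((norm (\<phi> l))\<^sup>2 + (norm (\<phi> m))\<^sup>2)"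
      using sum_squares_bound[of "norm (\<phi> l)" "norm (\<phi> m)"] by simp
    then have "norm (\<phi> l) * norm (\<phi> m) * k (l - m) \<le> 1/2 * ((norm (\<phi> l))\<^sup>2 + (norm (\<phi> m))\<^sup>2) * k (l - m)"
      by (rule mult_right_mono) (simp add: k_def)
    also have "\<dots> = 1/2 * ((norm (\<phi> l))\<^sup>2 * k (l - m) + (norm (\<phi> m))\<^sup>2 * k (l - m))"
      by (simp add: algebra_simps)
    finally have "ennreal (norm (\<phi> l) * norm (\<phi> m) * k (l - m)) \<le> ennreal (1/2 * ((norm (\<phi> l))\<^sup>2 * k (l - m) + (norm (\<phi> m))\<^sup>2 * k (l - m)))"
      by (rule ennreal_leI)
    also have "\<dots> = ennreal (1/2) * (ennreal ((norm (\<phi> l))\<^sup>2) * ennreal (k (l - m))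
      + ennreal ((norm (\<phi> m))\<^sup>2) * ennreal (k (l - m)))"
      by (subst ennreal_mult) (auto simp: k_def ennreal_mult)
    finally show "ennreal (norm (\<phi> l) * norm (\<phi> m) * k (l - m)) \<le> ennreal (1/2) * (ennreal ((norm (\<phi> l))\<^sup>2) * ennreal (k (l - m))
      + ennreal ((norm (\<phi> m))\<^sup>2) * ennreal (k (l - m)))" .
  qed
  also have "\<dots> = ennreal (1/2) * ((\<integral>\<^sup>+l. \<integral>\<^sup>+m. ennreal ((norm (\<phi> l))\<^sup>2) * ennreal (k (l - m)) \<partial>lborel \<partial>lborel)
      + (\<integral>\<^sup>+l. \<integral>\<^sup>+m. ennreal ((norm (\<phi> m))\<^sup>2) * ennreal (k (l - m)) \<partial>lborel \<partial>lborel))"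
    by (simp add: nn_integral_cmult nn_integral_add)
  also have "(\<integral>\<^sup>+l. \<integral>\<^sup>+m. ennreal ((norm (\<phi> m))\<^sup>2) * ennreal (k (l - m)) \<partial>lborel \<partial>lborel)
      = (\<integral>\<^sup>+m. \<integral>\<^sup>+l. ennreal ((norm (\<phi> m))\<^sup>2) * ennreal (k (l - m)) \<partial>lborel \<partial>lborel)"
    by (rule lborel_pair.Fubini') measurable
  also have "\<dots> = (\<integral>\<^sup>+m. \<integral>\<^sup>+l. ennreal ((norm (\<phi> m))\<^sup>2) * ennreal (k (m - l)) \<partial>lborel \<partial>lborel)"
    by (simp add: k_def power2_commute)
  also have "(\<integral>\<^sup>+l. \<integral>\<^sup>+m. ennreal ((norm (\<phi> l))\<^sup>2) * ennreal (k (l - m)) \<partial>lborel \<partial>lborel) = ?S * ennreal (sqrt (2 * pi) / \<sigma>)"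
  proof -
    have "(\<integral>\<^sup>+m. ennreal ((norm (\<phi> l))\<^sup>2) * ennreal (k (l - m)) \<partial>lborel)
        = ennreal ((norm (\<phi> l))\<^sup>2) * ennreal (sqrt (2 * pi) / \<sigma>)" for l
      using nn_integral_gaussian[OF \<sigma>, of l] by (subst nn_integral_cmult) (simp_all add: k_def)
    then show ?thesis by (simp add: nn_integral_multc)
  qed
  also have "ennreal (1/2) * (?S * ennreal (sqrt (2 * pi) / \<sigma>) + ?S * ennreal (sqrt (2 * pi) / \<sigma>)) = ennreal (sqrt (2 * pi) / \<sigma>) * ?S"
  proof -
    have half: "ennreal (1/2) * (c + c) = c" for c
    proof -
      have "ennreal (1/2) * (c + c) = (ennreal (1/2) + ennreal (1/2)) * c"
        by (simp only: distrib_left distrib_right)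
      also have "ennreal (1/2) + ennreal (1/2) = 1"
        by (subst ennreal_plus[symmetric]) auto
      finally show ?thesis by simp
    qed
    show ?thesis unfolding half by (rule mult.commute)
  qed
  finally show ?thesis .
qed

text \<open>Half of Plancherel's theorem: an upper bound for the $L^2$-norm of a Fourier transform.\<close>

lemma plancherel_le:
  fixes \<phi> :: "real \<Rightarrow> complex"
  assumes \<phi>: "integrable lborel \<phi>"
  defines "g \<equiv> \<lambda>w. (\<integral>l. iexp (l * w) * \<phi> l \<partial>lborel)"
  shows "(\<integral>\<^sup>+w. ennreal ((norm (g w))\<^sup>2) \<partial>lborel)
    \<le> ennreal (2 * pi) * (\<integral>\<^sup>+l. ennreal ((norm (\<phi> l))\<^sup>2) \<partial>lborel)"
proof -
  let ?S = "\<integral>\<^sup>+l. ennreal ((norm (\<phi> l))\<^sup>2) \<partial>lborel"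
  have [measurable]: "\<phi> \<in> borel_measurable borel" using \<phi> by auto
  have g_meas[measurable]: "g \<in> borel_measurable borel" unfolding g_def by measurable
  define F where "F n w = ennreal ((norm (g w))\<^sup>2) * ennreal (exp (- w\<^sup>2 / (2 * (real (Suc n))\<^sup>2)))" for n w
  have F_le: "(\<integral>\<^sup>+w. F n w \<partial>lborel) \<le> ennreal (2 * pi) * ?S" for n
  proof -
    define \<sigma> where "\<sigma> = real (Suc n)"
    have \<sigma>: "0 < \<sigma>" by (simp add: \<sigma>_def)
    have "(\<integral>\<^sup>+w. F n w \<partial>lborel)
      = (\<integral>\<^sup>+w. ennreal (sqrt (2 * pi) * \<sigma>) * (ennreal ((norm (g w))\<^sup>2) * ennreal (normal_density 0 \<sigma> w)) \<partial>lborel)"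
    proof (intro nn_integral_cong)
      fix w
      have "exp (- w\<^sup>2 / (2 * (real (Suc n))\<^sup>2)) = sqrt (2 * pi) * \<sigma> * normal_density 0 \<sigma> w"
        using \<sigma> by (simp add: normal_density_def real_sqrt_mult \<sigma>_def[symmetric] del: of_nat_Suc)
      then show "F n w = ennreal (sqrt (2 * pi) * \<sigma>) * (ennreal ((norm (g w))\<^sup>2) * ennreal (normal_density 0 \<sigma> w))"
        using \<sigma> by (simp add: F_def ennreal_mult mult_ac)
    qed
    also have "\<dots> = ennreal (sqrt (2 * pi) * \<sigma>) * (\<integral>\<^sup>+w. ennreal ((norm (g w))\<^sup>2) * ennreal (normal_density 0 \<sigma> w) \<partial>lborel)"
      by (rule nn_integral_cmult) measurable
    also have "\<dots> \<le> ennreal (sqrt (2 * pi) * \<sigma>) * (ennreal (sqrt (2 * pi) / \<sigma>) * ?S)"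
      unfolding g_def using \<phi> \<sigma> by (intro mult_left_mono plancherel_le_gaussian) auto
    also have "\<dots> = ennreal (sqrt (2 * pi) * \<sigma> * (sqrt (2 * pi) / \<sigma>)) * ?S"
      using \<sigma> by (subst ennreal_mult) (auto simp: mult.assoc)
    also have "sqrt (2 * pi) * \<sigma> * (sqrt (2 * pi) / \<sigma>) = 2 * pi"
      using \<sigma> by simp
    finally show ?thesis .
  qed
  have lim: "(\<lambda>n. F n w) \<longlonglongrightarrow> ennreal ((norm (g w))\<^sup>2)" for w
  proof -
    have "(\<lambda>n. exp (- w\<^sup>2 / (2 * (real (Suc n))\<^sup>2))) \<longlonglongrightarrow> exp 0"
      by (rule tendsto_exp) real_asymp
    then have "(\<lambda>n. (norm (g w))\<^sup>2 * exp (- w\<^sup>2 / (2 * (real (Suc n))\<^sup>2))) \<longlonglongrightarrow> (norm (g w))\<^sup>2 * exp 0"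
      by (rule tendsto_mult[OF tendsto_const])
    then show ?thesis
      unfolding F_def by (subst ennreal_mult[symmetric]) (auto intro!: tendsto_ennrealI simp del: of_nat_Suc)
  qed
  have "(\<integral>\<^sup>+w. ennreal ((norm (g w))\<^sup>2) \<partial>lborel) = (\<integral>\<^sup>+w. liminf (\<lambda>n. F n w) \<partial>lborel)"
    by (intro nn_integral_cong lim_imp_Liminf[symmetric] lim) simp
  also have "\<dots> \<le> liminf (\<lambda>n. \<integral>\<^sup>+w. F n w \<partial>lborel)"
    by (rule nn_integral_liminf) (simp add: F_def)
  also have "\<dots> \<le> ennreal (2 * pi) * ?S"
    by (rule Liminf_le) (auto simp: F_le)
  finally show ?thesis .
qed

section \<open>The Green kernel in $L^2$\<close>

subsection \<open>Power integrals\<close>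

lemma nn_integral_powr_tail:
  fixes \<alpha> c :: real
  assumes \<alpha>: "1 < \<alpha>" and c: "0 < c"
  shows "(\<integral>\<^sup>+x. ennreal (x powr - \<alpha>) * indicator {c..} x \<partial>lborel) = ennreal (c powr (1 - \<alpha>) / (\<alpha> - 1))"
proof -
  have "(\<integral>\<^sup>+x. ennreal (x powr - \<alpha>) * indicator {c..} x \<partial>lborel)
      = ennreal (0 - (- (c powr (1 - \<alpha>)) / (\<alpha> - 1)))"
  proof (rule nn_integral_FTC_atLeast)
    show "((\<lambda>x. - (x powr (1 - \<alpha>)) / (\<alpha> - 1)) \<longlongrightarrow> 0) at_top"
      using \<alpha> by real_asymp
    show "((\<lambda>x. - (x powr (1 - \<alpha>)) / (\<alpha> - 1)) has_real_derivative x powr - \<alpha>) (at x)" if "c \<le> x" for x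
    proof -
      have "((\<lambda>x. - (x powr (1 - \<alpha>)) / (\<alpha> - 1)) has_real_derivative
          - ((1 - \<alpha>) * x powr (1 - \<alpha> - 1)) / (\<alpha> - 1)) (at x)"
        using that c \<alpha> by (auto intro!: derivative_eq_intros)
      also have "- ((1 - \<alpha>) * x powr (1 - \<alpha> - 1)) / (\<alpha> - 1) = x powr - \<alpha>"
        using \<alpha> by (simp add: nonzero_divide_eq_eq algebra_simps)
      finally show ?thesis .
    qed
  qed auto
  then show ?thesis by simp
qed

text \<open>The upper bounds for the variances below reduce to this integral: split at
  $|x| = \delta^{-1/\alpha}$, where the two terms of the minimum agree.\<close>

lemma nn_integral_min_powr:
  fixes \<alpha> \<delta> :: real
  assumes \<alpha>: "1 < \<alpha>" and \<delta>: "0 \<le> \<delta>"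
  shows "(\<integral>\<^sup>+x. ennreal (min \<delta> (\<bar>x\<bar> powr - \<alpha>)) \<partial>lborel)
    \<le> ennreal ((2 + 2 / (\<alpha> - 1)) * \<delta> powr (1 - 1 / \<alpha>))"
proof (cases "\<delta> = 0")
  case True
  then show ?thesis by simp
next
  case False
  then have \<delta>: "0 < \<delta>" using \<delta> by simp
  define c where "c = \<delta> powr (- 1 / \<alpha>)"
  have c: "0 < c" using \<delta> by (simp add: c_def)
  have ca: "c powr (1 - \<alpha>) = \<delta> powr (1 - 1 / \<alpha>)" "\<delta> * c = \<delta> powr (1 - 1 / \<alpha>)"
  proof -
    show "c powr (1 - \<alpha>) = \<delta> powr (1 - 1 / \<alpha>)"
    proof -
      have "- 1 / \<alpha> * (1 - \<alpha>) = 1 - 1 / \<alpha>" using \<alpha> by (simp add: field_simps)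
      then show ?thesis unfolding c_def powr_powr by (rule arg_cong)
    qed
    show "\<delta> * c = \<delta> powr (1 - 1 / \<alpha>)"
      using \<delta> by (simp add: c_def powr_diff powr_minus divide_inverse)
  qed
  let ?t = "\<lambda>x::real. ennreal (x powr - \<alpha>) * indicator {c..} x"
  have "(\<integral>\<^sup>+x. ennreal (min \<delta> (\<bar>x\<bar> powr - \<alpha>)) \<partial>lborel)
      \<le> (\<integral>\<^sup>+x. ennreal \<delta> * indicator {-c..c} x + (?t x + ?t (0 + (-1) * x)) \<partial>lborel)"
  proof (intro nn_integral_mono)
    fix x :: real
    consider "\<bar>x\<bar> \<le> c" | "c < x" | "c < - x" by linarith
    then show "ennreal (min \<delta> (\<bar>x\<bar> powr - \<alpha>)) \<le> ennreal \<delta> * indicator {-c..c} x + (?t x + ?t (0 + (-1) * x))"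
    proof cases
      case 1
      then have "ennreal (min \<delta> (\<bar>x\<bar> powr - \<alpha>)) \<le> ennreal \<delta> * indicator {-c..c} x"
        by (auto simp: indicator_def abs_le_iff intro!: ennreal_leI)
      then show ?thesis by (rule order_trans) simp
    next
      case 2
      then show ?thesis using c by (auto simp: indicator_def intro!: ennreal_leI)
    next
      case 3
      then show ?thesis using c by (auto simp: indicator_def intro!: ennreal_leI)
    qed
  qed
  also have "\<dots> = (\<integral>\<^sup>+x. ennreal \<delta> * indicator {-c..c} x \<partial>lborel)
      + ((\<integral>\<^sup>+x. ?t x \<partial>lborel) + (\<integral>\<^sup>+x. ?t (0 + (-1) * x) \<partial>lborel))"
    by (simp add: nn_integral_add)
  also have "(\<integral>\<^sup>+x. ?t (0 + (-1) * x) \<partial>lborel) = (\<integral>\<^sup>+x. ?t x \<partial>lborel)"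
    by (subst nn_integral_real_affine[where c="-1" and t=0, of ?t]) auto
  also have "(\<integral>\<^sup>+x. ennreal \<delta> * indicator {-c..c} x \<partial>lborel) = ennreal (2 * \<delta> powr (1 - 1 / \<alpha>))"
    using c \<delta> ca by (subst nn_integral_cmult_indicator) (auto simp: ennreal_mult[symmetric] simp del: ennreal_numeral)
  also have "(\<integral>\<^sup>+x. ?t x \<partial>lborel) = ennreal (\<delta> powr (1 - 1 / \<alpha>) / (\<alpha> - 1))"
    using nn_integral_powr_tail[OF \<alpha> c] ca by simp
  also have "ennreal (2 * \<delta> powr (1 - 1 / \<alpha>)) + (ennreal (\<delta> powr (1 - 1 / \<alpha>) / (\<alpha> - 1)) + ennreal (\<delta> powr (1 - 1 / \<alpha>) / (\<alpha> - 1)))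
      = ennreal ((2 + 2 / (\<alpha> - 1)) * \<delta> powr (1 - 1 / \<alpha>))"
    using \<alpha> by (simp add: ennreal_plus[symmetric] distrib_right del: ennreal_plus)
  finally show ?thesis .
qed

lemma nn_integral_exp_past:
  fixes c s :: real
  assumes "0 < c"
  shows "(\<integral>\<^sup>+r. ennreal (exp (- c * (s - r))) * indicator {..s} r \<partial>lborel) = ennreal (1 / c)"
proof -
  have "(\<integral>\<^sup>+r. ennreal (exp (- c * (s - r))) * indicator {..s} r \<partial>lborel)
     = (\<integral>\<^sup>+r. ennreal (exp (- c * r)) * indicator {0..} r \<partial>lborel)"
    by (subst nn_integral_real_affine[where c="-1" and t=s])
       (auto simp: indicator_def intro!: nn_integral_cong)
  also have "\<dots> = ennreal (0 - (- exp (- c * 0) / c))"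
  proof (rule nn_integral_FTC_atLeast)
    show "((\<lambda>x. - exp (- c * x) / c) \<longlongrightarrow> 0) at_top"
      using assms by real_asymp
  qed (use assms in \<open>auto intro!: derivative_eq_intros\<close>)
  finally show ?thesis by simp
qed

lemma exp_minus_le_inverse:
  fixes y :: real
  assumes "0 < y"
  shows "exp (- y) \<le> 1 / y"
  using assms exp_ge_add_one_self[of y] by (simp add: exp_minus inverse_eq_divide divide_left_mono del: exp_ge_add_one_self)

lemma integrable_exp_powr:
  fixes \<alpha> s :: real
  assumes \<alpha>: "1 < \<alpha>" and s: "0 < s"
  shows "integrable lborel (\<lambda>l. exp (- (s * \<bar>l\<bar> powr \<alpha>)))"
proof (rule integrableI_bounded)
  have "(\<integral>\<^sup>+l. ennreal (norm (exp (- (s * \<bar>l\<bar> powr \<alpha>)))) \<partial>lborel)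
      \<le> (\<integral>\<^sup>+l. ennreal (1 / s) * ennreal (min s (\<bar>l\<bar> powr - \<alpha>)) \<partial>lborel)"
  proof (rule nn_integral_mono_AE)
    show "AE l in lborel. ennreal (norm (exp (- (s * \<bar>l\<bar> powr \<alpha>)))) \<le> ennreal (1 / s) * ennreal (min s (\<bar>l\<bar> powr - \<alpha>))"
      using AE_lborel_singleton[of "0::real"]
    proof eventually_elim
      case (elim l)
      have "0 < s * \<bar>l\<bar> powr \<alpha>" using s elim by simp
      then have "exp (- (s * \<bar>l\<bar> powr \<alpha>)) \<le> 1 / (s * \<bar>l\<bar> powr \<alpha>)" "exp (- (s * \<bar>l\<bar> powr \<alpha>)) \<le> 1"
        by (rule exp_minus_le_inverse) (use s in auto)
      then have "exp (- (s * \<bar>l\<bar> powr \<alpha>)) \<le> 1 / s * min s (\<bar>l\<bar> powr - \<alpha>)"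
        using s by (simp add: min_def powr_minus divide_inverse)
      then show ?case using s by (simp add: ennreal_mult[symmetric] ennreal_leI del: ennreal_le_iff)
    qed
  qed
  also have "\<dots> \<le> ennreal (1 / s) * ennreal ((2 + 2 / (\<alpha> - 1)) * s powr (1 - 1 / \<alpha>))"
    using \<alpha> s by (subst nn_integral_cmult) (auto intro!: mult_left_mono nn_integral_min_powr)
  also have "\<dots> < \<infinity>" by (simp add: ennreal_mult_less_top)
  finally show "(\<integral>\<^sup>+l. ennreal (norm (exp (- (s * \<bar>l\<bar> powr \<alpha>)))) \<partial>lborel) < \<infinity>" .
qed measurable

subsection \<open>Increments of the integrand\<close>

text \<open>The integrand of the stochastic convolution that gives the solution at \<open>(t, x)\<close>.\<close>

definition heat_integrand :: "real \<Rightarrow> real \<times> real \<Rightarrow> real \<times> real \<Rightarrow> real" where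
  "heat_integrand \<alpha> = (\<lambda>(t, x) (r, w). indicator {0..t} r * green_kernel \<alpha> (t - r) (x - w))"

text \<open>Its partial Fourier transform in the space variable. The interval of times is half-open because
  the formula is not integrable in \<open>l\<close> at \<open>r = t\<close>.\<close>

definition heat_spectrum :: "real \<Rightarrow> real \<times> real \<Rightarrow> real \<Rightarrow> real \<Rightarrow> complex" where
  "heat_spectrum \<alpha> = (\<lambda>(t, x) r l. indicator {0..<t} r *
     (complex_of_real (exp (- ((t - r) * \<bar>l\<bar> powr \<alpha>))) * iexp (- (l * x))))"

lemma measurable_green_kernel[measurable]:
  "(\<lambda>(t, x). green_kernel \<alpha> t x) \<in> borel_measurable borel"
proof -
  have "(\<lambda>(t, x). green_kernel \<alpha> t x) \<in> borel_measurable (borel \<Otimes>\<^sub>M borel)"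
    unfolding green_kernel_def by measurable
  then show ?thesis by (simp add: borel_prod)
qed

lemma measurable_heat_integrand[measurable]: "heat_integrand \<alpha> p \<in> borel_measurable borel"
proof (cases p)
  case (Pair t x)
  have "heat_integrand \<alpha> p = (\<lambda>q. indicator {0..t} (fst q) * (case (t - fst q, x - snd q) of (t, x) \<Rightarrow> green_kernel \<alpha> t x))"
    by (auto simp: Pair heat_integrand_def)
  also have "\<dots> \<in> borel_measurable borel"
  proof (intro borel_measurable_times)
    have [measurable]: "fst \<in> borel_measurable (borel :: (real \<times> real) measure)"
      "snd \<in> borel_measurable (borel :: (real \<times> real) measure)"
      by (auto intro!: borel_measurable_continuous_onI continuous_intros)
    show "(\<lambda>q. indicator {0..t} (fst q) :: real) \<in> borel_measurable (borel :: (real \<times> real) measure)"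
      by measurable
    show "(\<lambda>q. case (t - fst q, x - snd q) of (t, x) \<Rightarrow> green_kernel \<alpha> t x) \<in> borel_measurable borel"
      by (rule measurable_compose[OF _ measurable_green_kernel]) measurable
  qed
  finally show ?thesis .
qed

lemma measurable_heat_spectrum[measurable]:
  "(\<lambda>(r, l). heat_spectrum \<alpha> p r l) \<in> borel_measurable (borel \<Otimes>\<^sub>M borel)"
  by (cases p) (simp add: heat_spectrum_def)

lemma integrable_heat_spectrum:
  assumes "1 < \<alpha>"
  shows "integrable lborel (heat_spectrum \<alpha> (t, x) r)"
proof (cases "0 \<le> r \<and> r < t")
  case True
  then have "integrable lborel (\<lambda>l. exp (- ((t - r) * \<bar>l\<bar> powr \<alpha>)))"
    using assms by (intro integrable_exp_powr) auto
  then show ?thesis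
    by (rule Bochner_Integration.integrable_bound)
       (auto simp: heat_spectrum_def norm_mult indicator_def simp del: of_real_mult of_real_minus)
qed (auto simp: heat_spectrum_def indicator_def)

lemma heat_integrand_fourier:
  assumes "r \<noteq> t"
  shows "heat_integrand \<alpha> (t, x) (r, w)
    = Re (1 / (2 * of_real pi) * (\<integral>l. iexp (l * w) * heat_spectrum \<alpha> (t, x) r l \<partial>lborel))"
proof (cases "0 \<le> r \<and> r < t")
  case True
  have "(\<integral>l. exp (- (\<i> * of_real l * of_real (x - w)) - of_real ((t - r) * \<bar>l\<bar> powr \<alpha>)) \<partial>lborel)
      = (\<integral>l. iexp (l * w) * heat_spectrum \<alpha> (t, x) r l \<partial>lborel)"
    using True
    by (intro Bochner_Integration.integral_cong refl)
       (simp add: heat_spectrum_def exp_of_real[symmetric] exp_add[symmetric] algebra_simps)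
  then show ?thesis using True by (simp add: heat_integrand_def green_kernel_def)
next
  case False
  then have "\<not> (0 \<le> r \<and> r \<le> t)" using assms by auto
  then show ?thesis using False by (auto simp: heat_integrand_def heat_spectrum_def indicator_def)
qed

lemma norm_iexp_diff_le: "norm (iexp a - iexp b) \<le> \<bar>a - b\<bar>"
proof -
  have "iexp a - iexp b = iexp b * (iexp (a - b) - 1)"
    by (simp add: algebra_simps exp_add[symmetric])
  then have "norm (iexp a - iexp b) = norm (iexp (a - b) - 1)"
    by (simp add: norm_mult)
  also have "\<dots> \<le> \<bar>a - b\<bar>"
    using iexp_approx1[of "a - b" 0] by simp
  finally show ?thesis .
qed

lemma iexp_diff_le:
  assumes \<alpha>: "1 < \<alpha>" "\<alpha> \<le> 2"
  shows "(norm (iexp (- (l * x)) - iexp (- (l * y))))\<^sup>2 \<le> 4 * min 1 (\<bar>x - y\<bar> powr \<alpha> * \<bar>l\<bar> powr \<alpha>)"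
proof -
  let ?n = "norm (iexp (- (l * x)) - iexp (- (l * y)))"
  define d where "d = \<bar>l * (x - y)\<bar>"
  have n_d: "?n \<le> d"
    using norm_iexp_diff_le[of "- (l * x)" "- (l * y)"]
    by (simp add: d_def right_diff_distrib abs_minus_commute)
  have n_2: "?n \<le> 2"
    using norm_triangle_ineq4[of "iexp (- (l * x))" "iexp (- (l * y))"] by (simp del: of_real_mult of_real_minus)
  have d_powr: "\<bar>x - y\<bar> powr \<alpha> * \<bar>l\<bar> powr \<alpha> = d powr \<alpha>"
    by (simp add: d_def abs_mult powr_mult mult.commute)
  show ?thesis
  proof (cases "d \<le> 1")
    case True
    \<comment> \<open>here \<open>\<alpha> \<le> 2\<close> is needed\<close>
    have "?n\<^sup>2 \<le> d\<^sup>2" using n_d by (intro power_mono) auto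
    also have "d\<^sup>2 \<le> d powr \<alpha>"
    proof (cases "d = 0")
      case False
      then have "0 < d" by (simp add: d_def)
      then have "d\<^sup>2 = d powr 2" by (simp add: powr_numeral)
      also have "\<dots> \<le> d powr \<alpha>" using True \<open>0 < d\<close> \<alpha> by (intro powr_mono') auto
      finally show ?thesis .
    qed (use \<alpha> in simp)
    also have "d powr \<alpha> = min 1 (d powr \<alpha>)"
      using powr_le1[of \<alpha> d] True \<alpha> by (simp add: d_def)
    finally show ?thesis unfolding d_powr by (smt (verit) powr_ge_zero)
  next
    case False
    then have "1 \<le> d powr \<alpha>" using \<alpha> by (intro ge_one_powr_ge_zero) auto
    moreover have "?n\<^sup>2 \<le> 2\<^sup>2" using n_2 by (intro power_mono) auto
    ultimately show ?thesis unfolding d_powr by simp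
  qed
qed

text \<open>After integration over \<open>r\<close> the first term on the right describes the noise seen by both
  points, the second one the noise between times \<open>s\<close> and \<open>t\<close>.\<close>

lemma heat_spectrum_diff_le:
  assumes \<alpha>: "1 < \<alpha>" "\<alpha> \<le> 2" and st: "s \<le> t" and l: "l \<noteq> 0"
  defines "L \<equiv> \<bar>l\<bar> powr \<alpha>"
  shows "(norm (heat_spectrum \<alpha> (t, x) r l - heat_spectrum \<alpha> (s, y) r l))\<^sup>2
    \<le> 2 * (min 1 ((t - s) * L) + 4 * min 1 (\<bar>x - y\<bar> powr \<alpha> * L)) * (exp (- (2 * L) * (s - r)) * indicator {..s} r)
      + exp (- (2 * L) * (t - r)) * indicator {s..t} r"
    (is "?lhs \<le> 2 * ?m * ?e + ?f")
proof -
  have L: "0 < L" using l by (simp add: L_def)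
  have m: "0 \<le> ?m" using L st by simp
  consider "r < 0 \<or> t \<le> r" | "0 \<le> r" "s \<le> r" "r < t" | "0 \<le> r" "r < s" by linarith
  then show ?thesis
  proof cases
    case 1
    then have "?lhs = 0" using st by (auto simp: heat_spectrum_def indicator_def)
    then show ?thesis using m by (simp add: indicator_def)
  next
    case 2
    then have "?lhs = (exp (- ((t - r) * L)))\<^sup>2"
      by (simp add: heat_spectrum_def norm_mult L_def del: of_real_mult of_real_minus)
    also have "\<dots> = ?f" using 2 by (simp add: power2_eq_square exp_add[symmetric] algebra_simps)
    finally show ?thesis using m by (simp add: indicator_def)
  next
    case 3
    define E A B where "E = exp (- ((t - s) * L))" and "A = iexp (- (l * x))" and "B = iexp (- (l * y))"
    have E: "0 \<le> 1 - E" "1 - E \<le> 1" "1 - E \<le> (t - s) * L"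
      using st L exp_ge_add_one_self[of "- ((t - s) * L)"] by (auto simp: E_def)
    have nA: "norm A = 1" by (simp add: A_def del: of_real_mult of_real_minus)
    have "heat_spectrum \<alpha> (t, x) r l - heat_spectrum \<alpha> (s, y) r l = exp (- ((s - r) * L)) * (E * A - B)"
    proof -
      have "exp (- ((t - r) * L)) = exp (- ((s - r) * L)) * E"
        by (simp add: E_def exp_add[symmetric] algebra_simps)
      then show ?thesis using 3 st by (simp add: heat_spectrum_def L_def[symmetric] A_def B_def algebra_simps)
    qed
    then have "?lhs = (exp (- ((s - r) * L)))\<^sup>2 * (norm (E * A - B))\<^sup>2"
      by (simp add: norm_mult power_mult_distrib)
    also have "(exp (- ((s - r) * L)))\<^sup>2 = ?e"
      using 3 by (simp add: power2_eq_square exp_add[symmetric] algebra_simps)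
    also have "(norm (E * A - B))\<^sup>2 \<le> 2 * ?m"
    proof -
      have "norm (E * A - B) = norm ((A - B) - (1 - E) * A)" by (simp add: algebra_simps)
      also have "\<dots> \<le> norm (A - B) + norm (complex_of_real (1 - E) * A)"
        using norm_triangle_ineq4[of "A - B" "complex_of_real (1 - E) * A"] by simp
      also have "norm (complex_of_real (1 - E) * A) = 1 - E"
        unfolding norm_mult nA norm_of_real using E by simp
      finally have "(norm (E * A - B))\<^sup>2 \<le> (norm (A - B) + (1 - E))\<^sup>2" by (intro power_mono) auto
      also have "\<dots> \<le> 2 * ((norm (A - B))\<^sup>2 + (1 - E)\<^sup>2)"
        using sum_squares_bound[of "norm (A - B)" "1 - E"] by (simp add: power2_sum)
      also have "(1 - E)\<^sup>2 \<le> 1 - E" using E by (simp add: power2_eq_square mult_left_le)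
      also have "1 - E \<le> min 1 ((t - s) * L)" using E by simp
      also have "(norm (A - B))\<^sup>2 \<le> 4 * min 1 (\<bar>x - y\<bar> powr \<alpha> * L)"
        unfolding A_def B_def L_def by (rule iexp_diff_le[OF \<alpha>])
      finally show ?thesis by simp
    qed
    finally have "?lhs \<le> ?e * (2 * ?m)" using 3 by (simp add: mult_left_mono)
    moreover have "0 \<le> ?f" by simp
    ultimately show ?thesis unfolding mult.commute[of ?e] by linarith
  qed
qed

lemma nn_integral_exp_short:
  fixes c s t :: real
  assumes "0 < c" "s \<le> t"
  shows "(\<integral>\<^sup>+r. ennreal (exp (- c * (t - r)) * indicator {s..t} r) \<partial>lborel) \<le> ennreal (min (t - s) (1 / c))"
proof -
  have "(\<integral>\<^sup>+r. ennreal (exp (- c * (t - r)) * indicator {s..t} r) \<partial>lborel) \<le> (\<integral>\<^sup>+r. indicator {s..t} r \<partial>lborel)"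
    using assms by (intro nn_integral_mono) (auto simp: indicator_def)
  moreover have "(\<integral>\<^sup>+r. ennreal (exp (- c * (t - r)) * indicator {s..t} r) \<partial>lborel)
      \<le> (\<integral>\<^sup>+r. ennreal (exp (- c * (t - r))) * indicator {..t} r \<partial>lborel)"
    by (intro nn_integral_mono) (auto simp: indicator_def)
  ultimately show ?thesis
    using assms nn_integral_exp_past[of c t] by (simp add: min_def)
qed

lemma nn_integral_heat_spectrum_diff:
  assumes \<alpha>: "1 < \<alpha>" "\<alpha> \<le> 2" and st: "s \<le> t" and l: "l \<noteq> 0"
  shows "(\<integral>\<^sup>+r. ennreal ((norm (heat_spectrum \<alpha> (t, x) r l - heat_spectrum \<alpha> (s, y) r l))\<^sup>2) \<partial>lborel)
    \<le> ennreal (2 * min (t - s) (\<bar>l\<bar> powr - \<alpha>) + 4 * min (\<bar>x - y\<bar> powr \<alpha>) (\<bar>l\<bar> powr - \<alpha>))"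
proof -
  define L where "L = \<bar>l\<bar> powr \<alpha>"
  have L: "0 < L" using l by (simp add: L_def)
  define m where "m = min 1 ((t - s) * L) + 4 * min 1 (\<bar>x - y\<bar> powr \<alpha> * L)"
  have m: "0 \<le> m" using L st by (simp add: m_def)
  have "(\<integral>\<^sup>+r. ennreal ((norm (heat_spectrum \<alpha> (t, x) r l - heat_spectrum \<alpha> (s, y) r l))\<^sup>2) \<partial>lborel)
    \<le> (\<integral>\<^sup>+r. ennreal (2 * m) * (ennreal (exp (- (2 * L) * (s - r))) * indicator {..s} r)
      + ennreal (exp (- (2 * L) * (t - r)) * indicator {s..t} r) \<partial>lborel)"
  proof (intro nn_integral_mono)
    fix r
    have "ennreal ((norm (heat_spectrum \<alpha> (t, x) r l - heat_spectrum \<alpha> (s, y) r l))\<^sup>2)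
      \<le> ennreal (2 * m * (exp (- (2 * L) * (s - r)) * indicator {..s} r) + exp (- (2 * L) * (t - r)) * indicator {s..t} r)"
      unfolding L_def m_def by (intro ennreal_leI heat_spectrum_diff_le \<alpha> st l)
    also have "\<dots> = ennreal (2 * m) * (ennreal (exp (- (2 * L) * (s - r))) * indicator {..s} r)
      + ennreal (exp (- (2 * L) * (t - r)) * indicator {s..t} r)"
      using m by (subst ennreal_plus) (auto simp: ennreal_mult[symmetric] indicator_def)
    finally show "ennreal ((norm (heat_spectrum \<alpha> (t, x) r l - heat_spectrum \<alpha> (s, y) r l))\<^sup>2) \<le> \<dots>" .
  qed
  also have "\<dots> = ennreal (2 * m) * (\<integral>\<^sup>+r. ennreal (exp (- (2 * L) * (s - r))) * indicator {..s} r \<partial>lborel)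
      + (\<integral>\<^sup>+r. ennreal (exp (- (2 * L) * (t - r)) * indicator {s..t} r) \<partial>lborel)"
    by (subst nn_integral_add) (auto intro!: nn_integral_cmult)
  also have "\<dots> \<le> ennreal (2 * m) * ennreal (1 / (2 * L)) + ennreal (min (t - s) (1 / (2 * L)))"
    using L st nn_integral_exp_past[of "2 * L" s] by (intro add_mono nn_integral_exp_short mult_left_mono) auto
  also have "\<dots> = ennreal (m / L + min (t - s) (1 / (2 * L)))"
    using m L st by (simp add: ennreal_mult[symmetric] ennreal_plus[symmetric] del: ennreal_plus)
  also have "\<dots> \<le> ennreal (2 * min (t - s) (1 / L) + 4 * min (\<bar>x - y\<bar> powr \<alpha>) (1 / L))"
  proof (rule ennreal_leI)
    have "min 1 (u * L) / L = min u (1 / L)" for u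
      using L by (auto simp: min_def field_simps)
    then have "m / L = min (t - s) (1 / L) + 4 * min (\<bar>x - y\<bar> powr \<alpha>) (1 / L)"
      by (simp add: m_def add_divide_distrib del: times_divide_eq_right add: times_divide_eq_right[symmetric])
    moreover have "min (t - s) (1 / (2 * L)) \<le> min (t - s) (1 / L)"
      using L by (intro min.mono) (auto simp: field_simps)
    ultimately show "m / L + min (t - s) (1 / (2 * L)) \<le> 2 * min (t - s) (1 / L) + 4 * min (\<bar>x - y\<bar> powr \<alpha>) (1 / L)"
      by simp
  qed
  also have "1 / L = \<bar>l\<bar> powr - \<alpha>" by (simp add: L_def powr_minus divide_inverse)
  finally show ?thesis .
qed

lemma nn_integral_heat_integrand_diff_ordered:
  assumes \<alpha>: "1 < \<alpha>" "\<alpha> \<le> 2" and st: "s \<le> t"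
  shows "(\<integral>\<^sup>+q. ennreal ((heat_integrand \<alpha> (t, x) q - heat_integrand \<alpha> (s, y) q)\<^sup>2) \<partial>lborel)
    \<le> ennreal ((2 + 2 / (\<alpha> - 1)) * ((t - s) powr (1 - 1 / \<alpha>) + \<bar>x - y\<bar> powr (\<alpha> - 1)))"
proof -
  let ?\<psi> = "\<lambda>r l. heat_spectrum \<alpha> (t, x) r l - heat_spectrum \<alpha> (s, y) r l"
  let ?h = "\<lambda>q. heat_integrand \<alpha> (t, x) q - heat_integrand \<alpha> (s, y) q"
  define K where "K = 2 + 2 / (\<alpha> - 1)"
  have K: "0 < K" using \<alpha> by (simp add: K_def add_pos_nonneg)
  have meas: "(\<lambda>q. ennreal ((?h q)\<^sup>2)) \<in> borel_measurable (lborel \<Otimes>\<^sub>M lborel)"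
    unfolding lborel_prod by measurable
  have slice: "(\<integral>\<^sup>+w. ennreal ((?h (r, w))\<^sup>2) \<partial>lborel)
      \<le> ennreal (1 / (2 * pi)) * (\<integral>\<^sup>+l. ennreal ((norm (?\<psi> r l))\<^sup>2) \<partial>lborel)"
    if r: "r \<noteq> s" "r \<noteq> t" for r
  proof -
    have int: "integrable lborel (\<lambda>l. iexp (l * w) * heat_spectrum \<alpha> (t', x') r l)" for w t' x'
      by (rule Bochner_Integration.integrable_bound[OF integrable_norm[OF integrable_heat_spectrum[OF \<alpha>(1), of t' x' r]]])
         (auto simp: norm_mult simp del: of_real_mult intro!: borel_measurable_times borel_measurable_integrable[OF integrable_heat_spectrum[OF \<alpha>(1)], simplified])
    let ?g = "\<lambda>w. \<integral>l. iexp (l * w) * ?\<psi> r l \<partial>lborel"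
    have "(\<integral>\<^sup>+w. ennreal ((?h (r, w))\<^sup>2) \<partial>lborel) \<le> (\<integral>\<^sup>+w. ennreal (1 / (4 * pi\<^sup>2)) * ennreal ((norm (?g w))\<^sup>2) \<partial>lborel)"
    proof (intro nn_integral_mono)
      fix w
      have "?h (r, w) = Re (1 / (2 * of_real pi) * ?g w)"
        unfolding heat_integrand_fourier[OF r(2)] heat_integrand_fourier[OF r(1)]
        using int by (simp add: right_diff_distrib)
      then have "\<bar>?h (r, w)\<bar> \<le> norm (1 / (2 * of_real pi) * ?g w)"
        by (simp only: abs_Re_le_cmod)
      also have "\<dots> = 1 / (2 * pi) * norm (?g w)" by (simp add: norm_divide norm_mult)
      finally have "\<bar>?h (r, w)\<bar>\<^sup>2 \<le> (1 / (2 * pi) * norm (?g w))\<^sup>2" by (intro power_mono) auto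
      also have "\<dots> = 1 / (4 * pi\<^sup>2) * (norm (?g w))\<^sup>2"
        by (simp add: power_mult_distrib power_divide)
      finally show "ennreal ((?h (r, w))\<^sup>2) \<le> ennreal (1 / (4 * pi\<^sup>2)) * ennreal ((norm (?g w))\<^sup>2)"
        by (subst ennreal_mult[symmetric]) (auto intro!: ennreal_leI)
    qed
    also have "\<dots> \<le> ennreal (1 / (4 * pi\<^sup>2)) * (ennreal (2 * pi) * (\<integral>\<^sup>+l. ennreal ((norm (?\<psi> r l))\<^sup>2) \<partial>lborel))"
    proof -
      have "(\<integral>\<^sup>+w. ennreal ((norm (?g w))\<^sup>2) \<partial>lborel) \<le> ennreal (2 * pi) * (\<integral>\<^sup>+l. ennreal ((norm (?\<psi> r l))\<^sup>2) \<partial>lborel)"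
        by (intro plancherel_le Bochner_Integration.integrable_diff integrable_heat_spectrum \<alpha>)
      then show ?thesis by (subst nn_integral_cmult) (auto intro!: mult_left_mono)
    qed
    also have "\<dots> = ennreal (1 / (4 * pi\<^sup>2) * (2 * pi)) * (\<integral>\<^sup>+l. ennreal ((norm (?\<psi> r l))\<^sup>2) \<partial>lborel)"
      by (subst ennreal_mult) (auto simp: mult.assoc)
    also have "1 / (4 * pi\<^sup>2) * (2 * pi) = 1 / (2 * pi)"
      by (simp add: power2_eq_square)
    finally show ?thesis .
  qed
  have "(\<integral>\<^sup>+q. ennreal ((?h q)\<^sup>2) \<partial>lborel) = (\<integral>\<^sup>+r. \<integral>\<^sup>+w. ennreal ((?h (r, w))\<^sup>2) \<partial>lborel \<partial>lborel)"
    unfolding lborel.nn_integral_fst[OF meas] lborel_prod ..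
  also have "\<dots> \<le> (\<integral>\<^sup>+r. ennreal (1 / (2 * pi)) * (\<integral>\<^sup>+l. ennreal ((norm (?\<psi> r l))\<^sup>2) \<partial>lborel) \<partial>lborel)"
  proof (rule nn_integral_mono_AE)
    show "AE r in lborel. (\<integral>\<^sup>+w. ennreal ((?h (r, w))\<^sup>2) \<partial>lborel)
      \<le> ennreal (1 / (2 * pi)) * (\<integral>\<^sup>+l. ennreal ((norm (?\<psi> r l))\<^sup>2) \<partial>lborel)"
      using AE_lborel_singleton[of s] AE_lborel_singleton[of t]
      by eventually_elim (rule slice)
  qed
  also have "\<dots> = ennreal (1 / (2 * pi)) * (\<integral>\<^sup>+r. \<integral>\<^sup>+l. ennreal ((norm (?\<psi> r l))\<^sup>2) \<partial>lborel \<partial>lborel)"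
    by (rule nn_integral_cmult) measurable
  also have "(\<integral>\<^sup>+r. \<integral>\<^sup>+l. ennreal ((norm (?\<psi> r l))\<^sup>2) \<partial>lborel \<partial>lborel) = (\<integral>\<^sup>+l. \<integral>\<^sup>+r. ennreal ((norm (?\<psi> r l))\<^sup>2) \<partial>lborel \<partial>lborel)"
    by (rule lborel_pair.Fubini') measurable
  also have "\<dots> \<le> (\<integral>\<^sup>+l. ennreal 2 * ennreal (min (t - s) (\<bar>l\<bar> powr - \<alpha>)) + ennreal 4 * ennreal (min (\<bar>x - y\<bar> powr \<alpha>) (\<bar>l\<bar> powr - \<alpha>)) \<partial>lborel)"
  proof (rule nn_integral_mono_AE)
    show "AE l in lborel. (\<integral>\<^sup>+r. ennreal ((norm (?\<psi> r l))\<^sup>2) \<partial>lborel)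
       \<le> ennreal 2 * ennreal (min (t - s) (\<bar>l\<bar> powr - \<alpha>)) + ennreal 4 * ennreal (min (\<bar>x - y\<bar> powr \<alpha>) (\<bar>l\<bar> powr - \<alpha>))"
      using AE_lborel_singleton[of "0::real"]
    proof eventually_elim
      case (elim l)
      show ?case
        using nn_integral_heat_spectrum_diff[OF \<alpha> st elim, of x y] st
        by (simp add: ennreal_mult[symmetric] ennreal_plus[symmetric] del: ennreal_plus ennreal_numeral)
    qed
  qed
  also have "\<dots> = ennreal 2 * (\<integral>\<^sup>+l. ennreal (min (t - s) (\<bar>l\<bar> powr - \<alpha>)) \<partial>lborel)
      + ennreal 4 * (\<integral>\<^sup>+l. ennreal (min (\<bar>x - y\<bar> powr \<alpha>) (\<bar>l\<bar> powr - \<alpha>)) \<partial>lborel)"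
    by (simp add: nn_integral_add nn_integral_cmult)
  also have "\<dots> \<le> ennreal 2 * ennreal (K * (t - s) powr (1 - 1 / \<alpha>)) + ennreal 4 * ennreal (K * (\<bar>x - y\<bar> powr \<alpha>) powr (1 - 1 / \<alpha>))"
    unfolding K_def using \<alpha> st by (intro add_mono mult_left_mono nn_integral_min_powr) auto
  also have "(\<bar>x - y\<bar> powr \<alpha>) powr (1 - 1 / \<alpha>) = \<bar>x - y\<bar> powr (\<alpha> - 1)"
    using \<alpha> by (simp add: powr_powr right_diff_distrib)
  also have "ennreal (1 / (2 * pi)) * (ennreal 2 * ennreal (K * (t - s) powr (1 - 1 / \<alpha>)) + ennreal 4 * ennreal (K * \<bar>x - y\<bar> powr (\<alpha> - 1)))
      = ennreal (1 / (2 * pi) * (2 * (K * (t - s) powr (1 - 1 / \<alpha>)) + 4 * (K * \<bar>x - y\<bar> powr (\<alpha> - 1))))"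
    using K by (simp add: ennreal_mult[symmetric] ennreal_plus[symmetric] del: ennreal_plus ennreal_numeral)
  also have "\<dots> \<le> ennreal (K * ((t - s) powr (1 - 1 / \<alpha>) + \<bar>x - y\<bar> powr (\<alpha> - 1)))"
  proof (rule ennreal_leI)
    have "1 / (2 * pi) * (2 * (K * (t - s) powr (1 - 1 / \<alpha>)) + 4 * (K * \<bar>x - y\<bar> powr (\<alpha> - 1)))
        \<le> 1 / 4 * (4 * (K * (t - s) powr (1 - 1 / \<alpha>)) + 4 * (K * \<bar>x - y\<bar> powr (\<alpha> - 1)))"
      using K pi_ge_two by (intro mult_mono add_mono mult_right_mono frac_le) auto
    then show "1 / (2 * pi) * (2 * (K * (t - s) powr (1 - 1 / \<alpha>)) + 4 * (K * \<bar>x - y\<bar> powr (\<alpha> - 1)))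
        \<le> K * ((t - s) powr (1 - 1 / \<alpha>) + \<bar>x - y\<bar> powr (\<alpha> - 1))"
      by (simp add: distrib_left)
  qed
  finally show ?thesis unfolding K_def by (simp add: mult_left_mono)
qed

text \<open>The solution is Hoelder continuous in $L^2$, of orders $(\alpha-1)/(2\alpha)$ in time and
  $(\alpha-1)/2$ in space.\<close>

lemma nn_integral_heat_integrand_diff:
  assumes \<alpha>: "1 < \<alpha>" "\<alpha> \<le> 2"
  shows "(\<integral>\<^sup>+q. ennreal ((heat_integrand \<alpha> (t, x) q - heat_integrand \<alpha> (s, y) q)\<^sup>2) \<partial>lborel)
    \<le> ennreal ((2 + 2 / (\<alpha> - 1)) * (\<bar>t - s\<bar> powr (1 - 1 / \<alpha>) + \<bar>x - y\<bar> powr (\<alpha> - 1)))"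
proof (cases "s \<le> t")
  case True
  then show ?thesis using nn_integral_heat_integrand_diff_ordered[OF \<alpha>, of s t x y] by simp
next
  case False
  then show ?thesis using nn_integral_heat_integrand_diff_ordered[OF \<alpha>, of t s y x]
    by (simp add: power2_commute abs_minus_commute)
qed

subsection \<open>Non-degeneracy\<close>

lemma green_kernel_pos:
  assumes \<alpha>: "1 < \<alpha>" and s: "0 < s"
  shows "0 < green_kernel \<alpha> s 0"
proof -
  let ?f = "\<lambda>l. exp (- (s * \<bar>l\<bar> powr \<alpha>))"
  have int: "integrable lborel ?f" using assms by (rule integrable_exp_powr)
  have "(\<integral>l. ?f l \<partial>lborel) \<noteq> 0"
  proof
    assume "(\<integral>l. ?f l \<partial>lborel) = 0"
    then have "AE l in lborel :: real measure. ?f l = 0"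
      using integral_nonneg_eq_0_iff_AE[OF int] by simp
    then have "AE l in lborel :: real measure. False" by simp
    then have "emeasure lborel (UNIV :: real set) = 0"
      by (subst (asm) AE_iff_measurable[OF _ refl]) auto
    then show False by simp
  qed
  then have "0 < (\<integral>l. ?f l \<partial>lborel)"
    by (simp add: order.strict_iff_order integral_nonneg_AE)
  moreover have "green_kernel \<alpha> s 0 = 1 / (2 * pi) * (\<integral>l. ?f l \<partial>lborel)"
    unfolding green_kernel_def by (simp add: exp_of_real flip: of_real_minus of_real_mult)
  ultimately show ?thesis by simp
qed

lemma isCont_green_kernel:
  assumes \<alpha>: "1 < \<alpha>" and s: "0 < s"
  shows "isCont (green_kernel \<alpha> s) x"
  unfolding continuous_at_sequentially
proof safe
  fix X assume X: "X \<longlonglongrightarrow> x"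
  have int: "integrable lborel (\<lambda>l. exp (- (s * \<bar>l\<bar> powr \<alpha>)))" using assms by (rule integrable_exp_powr)
  show "(green_kernel \<alpha> s \<circ> X) \<longlonglongrightarrow> green_kernel \<alpha> s x"
    unfolding comp_def green_kernel_def
  proof (intro tendsto_Re tendsto_mult tendsto_const)
    show "(\<lambda>n. \<integral>l. exp (- (\<i> * of_real l * of_real (X n)) - of_real (s * \<bar>l\<bar> powr \<alpha>)) \<partial>lborel)
      \<longlonglongrightarrow> (\<integral>l. exp (- (\<i> * of_real l * of_real x) - of_real (s * \<bar>l\<bar> powr \<alpha>)) \<partial>lborel)"
      by (rule integral_dominated_convergence[OF _ _ int]) (auto intro!: tendsto_intros X)
  qed
qed

lemma nn_integral_heat_integrand_pos:
  assumes \<alpha>: "1 < \<alpha>" and a: "0 < a"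
  shows "0 < (\<integral>\<^sup>+q. ennreal ((heat_integrand \<alpha> (a, 0) q)\<^sup>2) \<partial>lborel)"
proof (rule ccontr)
  assume "\<not> ?thesis"
  then have 0: "(\<integral>\<^sup>+q. ennreal ((heat_integrand \<alpha> (a, 0) q)\<^sup>2) \<partial>lborel) = 0" by (simp add: not_less)
  have "AE q in lborel \<Otimes>\<^sub>M lborel. heat_integrand \<alpha> (a, 0) q = 0"
    using 0 unfolding lborel_prod by (subst (asm) nn_integral_0_iff_AE) auto
  then have AE_AE: "AE r in lborel. AE w in lborel. heat_integrand \<alpha> (a, 0) (r, w) = 0"
    by (rule lborel_pair.AE_pair)
  have not_AE: "\<not> (AE r in lborel. r \<notin> {0<..<a})"
  proof
    assume "AE r in lborel. r \<notin> {0<..<a}"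
    then have "emeasure lborel {r \<in> space lborel. \<not> r \<notin> {0<..<a}} = 0"
      by (subst (asm) AE_iff_measurable[OF _ refl]) auto
    also have "{r \<in> space lborel. \<not> r \<notin> {0<..<a}} = {0<..<a}" by auto
    finally have "emeasure lborel {0<..<a} = 0" .
    then show False using a by simp
  qed
  have "\<exists>r\<in>{0<..<a}. AE w in lborel. heat_integrand \<alpha> (a, 0) (r, w) = 0"
  proof (rule ccontr)
    assume none: "\<not> (\<exists>r\<in>{0<..<a}. AE w in lborel. heat_integrand \<alpha> (a, 0) (r, w) = 0)"
    have "AE r in lborel. r \<notin> {0<..<a}"
      using AE_AE by (rule eventually_mono) (use none in blast)
    then show False using not_AE by blast
  qed
  then obtain r where r: "0 < r" "r < a" and AE0: "AE w in lborel. heat_integrand \<alpha> (a, 0) (r, w) = 0"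
    by auto
  have cont: "isCont (\<lambda>w. green_kernel \<alpha> (a - r) (0 - w)) 0"
    using isCont_green_kernel[of \<alpha> "a - r" 0] \<alpha> r
    by (intro isCont_o2[where g="green_kernel \<alpha> (a - r)" and f="\<lambda>w. 0 - w"] continuous_intros) auto
  have "eventually (\<lambda>w. 0 < green_kernel \<alpha> (a - r) (0 - w)) (at 0)"
    using cont green_kernel_pos[of \<alpha> "a - r"] \<alpha> r
    by (intro order_tendstoD(1)[where y="green_kernel \<alpha> (a - r) (0 - 0)"]) (auto simp: isCont_def)
  then obtain d where d: "0 < d" "\<And>w. w \<noteq> 0 \<Longrightarrow> dist w 0 < d \<Longrightarrow> 0 < green_kernel \<alpha> (a - r) (0 - w)"
    unfolding eventually_at by auto
  have "AE w in lborel. w \<notin> {0<..<d}"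
    using AE0
  proof eventually_elim
    case (elim w)
    then show ?case using d(2)[of w] r by (auto simp: heat_integrand_def)
  qed
  then have "emeasure lborel {w \<in> space lborel. \<not> w \<notin> {0<..<d}} = 0"
    by (subst (asm) AE_iff_measurable[OF _ refl]) auto
  also have "{w \<in> space lborel. \<not> w \<notin> {0<..<d}} = {0<..<d}" by auto
  finally have "emeasure lborel {0<..<d} = 0" .
  then show False using d by simp
qed

text \<open>Translation by \<open>(t - a, x)\<close> maps the integrand for \<open>(t, x)\<close> to one that agrees with the
  integrand for \<open>(a, 0)\<close> wherever the latter is not zero.\<close>

lemma nn_integral_heat_integrand_ge:
  assumes a: "a \<le> t"
  shows "(\<integral>\<^sup>+q. ennreal ((heat_integrand \<alpha> (a, 0) q)\<^sup>2) \<partial>lborel)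
    \<le> (\<integral>\<^sup>+q. ennreal ((heat_integrand \<alpha> (t, x) q)\<^sup>2) \<partial>lborel)"
proof -
  have "(\<integral>\<^sup>+q. ennreal ((heat_integrand \<alpha> (t, x) q)\<^sup>2) \<partial>lborel)
      = (\<integral>\<^sup>+q. ennreal ((heat_integrand \<alpha> (t, x) q)\<^sup>2) \<partial>distr lborel borel ((+) (t - a, x)))"
    unfolding lborel_distr_plus ..
  also have "\<dots> = (\<integral>\<^sup>+q. ennreal ((heat_integrand \<alpha> (t, x) ((t - a, x) + q))\<^sup>2) \<partial>lborel)"
    by (subst nn_integral_distr) auto
  also have "\<dots> \<ge> (\<integral>\<^sup>+q. ennreal ((heat_integrand \<alpha> (a, 0) q)\<^sup>2) \<partial>lborel)"
    using a by (intro nn_integral_mono) (auto simp: heat_integrand_def indicator_def intro!: ennreal_leI)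
  finally show ?thesis .
qed

section \<open>Wiener integrals\<close>

subsection \<open>Convergence in $L^2$\<close>

lemma integrable_mult_of_squares:
  fixes f g :: "'a \<Rightarrow> real"
  assumes [measurable]: "f \<in> borel_measurable M" "g \<in> borel_measurable M"
    and "integrable M (\<lambda>x. (f x)\<^sup>2)" "integrable M (\<lambda>x. (g x)\<^sup>2)"
  shows "integrable M (\<lambda>x. f x * g x)"
proof (rule Bochner_Integration.integrable_bound[OF Bochner_Integration.integrable_add[OF assms(3,4)]])
  have "norm (f x * g x) \<le> norm ((f x)\<^sup>2 + (g x)\<^sup>2)" for x
  proof -
    have "2 * (\<bar>f x\<bar> * \<bar>g x\<bar>) \<le> (f x)\<^sup>2 + (g x)\<^sup>2"
      using sum_squares_bound[of "\<bar>f x\<bar>" "\<bar>g x\<bar>"] by simp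
    moreover have "0 \<le> \<bar>f x\<bar> * \<bar>g x\<bar>" by simp
    ultimately show ?thesis by (simp add: abs_mult del: mult_nonneg_nonneg)
  qed
  then show "AE x in M. norm (f x * g x) \<le> norm ((f x)\<^sup>2 + (g x)\<^sup>2)" by simp
qed simp

lemma integrable_sum_squared:
  fixes f :: "'i \<Rightarrow> 'a \<Rightarrow> real"
  assumes f: "\<And>i. i \<in> I \<Longrightarrow> f i \<in> borel_measurable M" "\<And>i. i \<in> I \<Longrightarrow> integrable M (\<lambda>x. (f i x)\<^sup>2)"
  shows "integrable M (\<lambda>x. (\<Sum>i\<in>I. c i * f i x)\<^sup>2)"
    and "(\<integral>x. (\<Sum>i\<in>I. c i * f i x)\<^sup>2 \<partial>M) = (\<Sum>i\<in>I. \<Sum>j\<in>I. c i * c j * (\<integral>x. f i x * f j x \<partial>M))"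
proof -
  have eq: "(\<Sum>i\<in>I. c i * f i x)\<^sup>2 = (\<Sum>i\<in>I. \<Sum>j\<in>I. c i * c j * (f i x * f j x))" for x
    by (simp add: power2_eq_square sum_product mult_ac)
  have int: "integrable M (\<lambda>x. c i * c j * (f i x * f j x))" if "i \<in> I" "j \<in> I" for i j
    using that f by (intro integrable_mult_right integrable_mult_of_squares)
  then show "integrable M (\<lambda>x. (\<Sum>i\<in>I. c i * f i x)\<^sup>2)" unfolding eq by (intro Bochner_Integration.integrable_sum)
  show "(\<integral>x. (\<Sum>i\<in>I. c i * f i x)\<^sup>2 \<partial>M) = (\<Sum>i\<in>I. \<Sum>j\<in>I. c i * c j * (\<integral>x. f i x * f j x \<partial>M))"
    unfolding eq using int by (subst Bochner_Integration.integral_sum; simp add: Bochner_Integration.integral_sum)+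
qed

lemma integrable_square_diff:
  fixes f g :: "'a \<Rightarrow> real"
  assumes [measurable]: "f \<in> borel_measurable M" "g \<in> borel_measurable M"
    and f: "integrable M (\<lambda>x. (f x)\<^sup>2)" and "integrable M (\<lambda>x. (g x)\<^sup>2)"
  shows "integrable M (\<lambda>x. (f x - g x)\<^sup>2)"
  unfolding power2_diff using assms integrable_mult_of_squares[OF assms]
  by (intro Bochner_Integration.integrable_diff Bochner_Integration.integrable_add) (simp_all add: mult.assoc)

lemma L2_limit_integrable:
  fixes f :: "'a \<Rightarrow> real" and u :: "nat \<Rightarrow> 'a \<Rightarrow> real"
  assumes f[measurable]: "f \<in> borel_measurable M" and u[measurable]: "\<And>n. u n \<in> borel_measurable M"
    and u2: "\<And>n. integrable M (\<lambda>x. (u n x)\<^sup>2)"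
    and lim: "(\<lambda>n. \<integral>\<^sup>+x. ennreal ((f x - u n x)\<^sup>2) \<partial>M) \<longlonglongrightarrow> 0"
  shows "integrable M (\<lambda>x. (f x)\<^sup>2)"
    and "(\<lambda>n. \<integral>x. (f x - u n x)\<^sup>2 \<partial>M) \<longlonglongrightarrow> 0"
    and "(\<lambda>n. \<integral>x. (u n x)\<^sup>2 \<partial>M) \<longlonglongrightarrow> (\<integral>x. (f x)\<^sup>2 \<partial>M)"
proof -
  have "eventually (\<lambda>n. (\<integral>\<^sup>+x. ennreal ((f x - u n x)\<^sup>2) \<partial>M) < 1) sequentially"
    using lim by (rule order_tendstoD) simp
  then obtain n where "(\<integral>\<^sup>+x. ennreal ((f x - u n x)\<^sup>2) \<partial>M) < 1"
    by (auto simp: eventually_sequentially)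
  then have "integrable M (\<lambda>x. (f x - u n x)\<^sup>2)"
    by (intro integrableI_bounded) (auto simp: less_top intro: order.strict_trans)
  then have "integrable M (\<lambda>x. ((f x - u n x) - (- u n x))\<^sup>2)"
    using u2 by (intro integrable_square_diff[of "\<lambda>x. f x - u n x" M "\<lambda>x. - u n x"]) auto
  then show f2: "integrable M (\<lambda>x. (f x)\<^sup>2)" by simp
  have fu: "integrable M (\<lambda>x. (f x - u n x)\<^sup>2)" for n
    using f2 u2 by (intro integrable_square_diff) auto
  have nn: "(\<integral>\<^sup>+x. ennreal ((f x - u n x)\<^sup>2) \<partial>M) = ennreal (\<integral>x. (f x - u n x)\<^sup>2 \<partial>M)" for n
    using fu by (intro nn_integral_eq_integral) auto
  show D: "(\<lambda>n. \<integral>x. (f x - u n x)\<^sup>2 \<partial>M) \<longlonglongrightarrow> 0"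
    using lim unfolding nn by (simp add: ennreal_0[symmetric] del: ennreal_0)
  define U where "U = (\<integral>x. (f x)\<^sup>2 \<partial>M)"
  have U: "0 \<le> U" by (simp add: U_def)
  show "(\<lambda>n. \<integral>x. (u n x)\<^sup>2 \<partial>M) \<longlonglongrightarrow> (\<integral>x. (f x)\<^sup>2 \<partial>M)"
  proof (rule LIMSEQ_I)
    fix e :: real assume e: "0 < e"
    \<comment> \<open>a weight that makes \<open>U / k\<close> small in
      \<open>\<bar>(u n x)\<^sup>2 - (f x)\<^sup>2\<bar> \<le> (1 + k) * (f x - u n x)\<^sup>2 + (f x)\<^sup>2 / k\<close>\<close>
    define k where "k = 2 * U / e + 1"
    have k: "0 < k" using U e by (simp add: k_def add_nonneg_pos)
    have Uk: "U / k < e / 2"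
      using U e k by (simp add: k_def field_simps)
    obtain N where N: "\<And>n. N \<le> n \<Longrightarrow> norm ((\<integral>x. (f x - u n x)\<^sup>2 \<partial>M) - 0) < e / (2 * (1 + k))"
      using LIMSEQ_D[OF D, of "e / (2 * (1 + k))"] e k by auto
    have "norm ((\<integral>x. (u n x)\<^sup>2 \<partial>M) - (\<integral>x. (f x)\<^sup>2 \<partial>M)) < e" if "N \<le> n" for n
    proof -
      have "norm ((\<integral>x. (u n x)\<^sup>2 \<partial>M) - (\<integral>x. (f x)\<^sup>2 \<partial>M)) = norm (\<integral>x. (u n x)\<^sup>2 - (f x)\<^sup>2 \<partial>M)"
        using f2 u2 by simp
      also have "\<dots> \<le> (\<integral>x. norm ((u n x)\<^sup>2 - (f x)\<^sup>2) \<partial>M)" by (rule integral_norm_bound)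
      also have "\<dots> \<le> (\<integral>x. (1 + k) * (f x - u n x)\<^sup>2 + (f x)\<^sup>2 / k \<partial>M)"
      proof (rule integral_mono)
        fix x
        define d where "d = u n x - f x"
        have *: "\<bar>2 * f x * d\<bar> \<le> (f x)\<^sup>2 / k + k * d\<^sup>2"
          using sum_squares_bound[of "\<bar>f x\<bar> / sqrt k" "sqrt k * \<bar>d\<bar>"] k
          by (simp add: power_divide power_mult_distrib abs_mult)
        have "(u n x)\<^sup>2 - (f x)\<^sup>2 = 2 * f x * d + d\<^sup>2"
          by (simp add: d_def power2_eq_square algebra_simps)
        then have "norm ((u n x)\<^sup>2 - (f x)\<^sup>2) \<le> \<bar>2 * f x * d\<bar> + d\<^sup>2"
          using abs_triangle_ineq[of "2 * f x * d" "d\<^sup>2"] by simp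
        also have "\<dots> \<le> (1 + k) * d\<^sup>2 + (f x)\<^sup>2 / k" using * by (simp add: algebra_simps)
        finally show "norm ((u n x)\<^sup>2 - (f x)\<^sup>2) \<le> (1 + k) * (f x - u n x)\<^sup>2 + (f x)\<^sup>2 / k"
          by (simp add: d_def power2_commute)
      qed (use f2 u2 fu in auto)
      also have "\<dots> = (1 + k) * (\<integral>x. (f x - u n x)\<^sup>2 \<partial>M) + U / k"
        using f2 fu by (simp add: U_def)
      also have "\<dots> < e / 2 + e / 2"
      proof -
        have "(1 + k) * (\<integral>x. (f x - u n x)\<^sup>2 \<partial>M) < (1 + k) * (e / (2 * (1 + k)))"
          using N[OF that] k by (intro mult_strict_left_mono) auto
        also have "(1 + k) * (e / (2 * (1 + k))) = e / 2"
          using k nonzero_mult_divide_mult_cancel_left[of "1 + k" e 2] by (simp only: times_divide_eq_right mult.commute[of 2])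
        finally show ?thesis using Uk by linarith
      qed
      finally show ?thesis by simp
    qed
    then show "\<exists>N. \<forall>n\<ge>N. norm ((\<integral>x. (u n x)\<^sup>2 \<partial>M) - (\<integral>x. (f x)\<^sup>2 \<partial>M)) < e" by blast
  qed
qed

lemma (in prob_space) L2_limit_L1:
  fixes f :: "'a \<Rightarrow> real" and u :: "nat \<Rightarrow> 'a \<Rightarrow> real"
  assumes f[measurable]: "f \<in> borel_measurable M" and u[measurable]: "\<And>n. u n \<in> borel_measurable M"
    and u2: "\<And>n. integrable M (\<lambda>x. (u n x)\<^sup>2)"
    and lim: "(\<lambda>n. \<integral>\<^sup>+x. ennreal ((f x - u n x)\<^sup>2) \<partial>M) \<longlonglongrightarrow> 0"
  shows "integrable M (\<lambda>x. u n x - f x)"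
    and "(\<lambda>n. \<integral>x. norm (u n x - f x) \<partial>M) \<longlonglongrightarrow> 0"
proof -
  note L2 = L2_limit_integrable[OF assms]
  have fu: "integrable M (\<lambda>x. (u n x - f x)\<^sup>2)" for n
    using L2(1) u2 by (intro integrable_square_diff) auto
  show int: "integrable M (\<lambda>x. u n x - f x)" for n
    by (rule square_integrable_imp_integrable[OF _ fu]) measurable
  show "(\<lambda>n. \<integral>x. norm (u n x - f x) \<partial>M) \<longlonglongrightarrow> 0"
  proof (rule tendsto_sandwich[OF _ _ tendsto_const])
    show "(\<lambda>n. sqrt (\<integral>x. (f x - u n x)\<^sup>2 \<partial>M)) \<longlonglongrightarrow> 0"
      using tendsto_real_sqrt[OF L2(2)] by simp
    show "eventually (\<lambda>n. (\<integral>x. norm (u n x - f x) \<partial>M) \<le> sqrt (\<integral>x. (f x - u n x)\<^sup>2 \<partial>M)) sequentially"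
    proof (intro always_eventually allI)
      fix n
      have "0 \<le> variance (\<lambda>x. \<bar>u n x - f x\<bar>)" by (rule variance_positive)
      also have "\<dots> = expectation (\<lambda>x. (u n x - f x)\<^sup>2) - (expectation (\<lambda>x. \<bar>u n x - f x\<bar>))\<^sup>2"
        using int fu by (subst variance_eq) auto
      finally have "(expectation (\<lambda>x. \<bar>u n x - f x\<bar>))\<^sup>2 \<le> expectation (\<lambda>x. (f x - u n x)\<^sup>2)"
        by (simp add: power2_commute)
      then show "(\<integral>x. norm (u n x - f x) \<partial>M) \<le> sqrt (\<integral>x. (f x - u n x)\<^sup>2 \<partial>M)"
        by (simp add: real_le_rsqrt)
    qed
  qed simp
qed

subsection \<open>Laws of Wiener integrals\<close>

text \<open>Lebesgue measure on the strip $[0,T] \times \mathbb{R}$ that carries the noise.\<close>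

definition strip :: "real \<Rightarrow> (real \<times> real) measure" where
  "strip T = density lborel (indicator ({0..T} \<times> UNIV))"

lemma sets_strip_set[measurable]: "{0..T :: real} \<times> (UNIV :: real set) \<in> sets borel"
  by (intro borel_closed closed_Times closed_atLeastAtMost closed_UNIV)

lemma sets_strip[simp, measurable_cong]: "sets (strip T) = sets borel"
  by (simp add: strip_def)

lemma space_strip[simp]: "space (strip T) = UNIV"
  by (simp add: strip_def)

lemma nn_integral_strip:
  "f \<in> borel_measurable borel \<Longrightarrow> (\<integral>\<^sup>+p. f p \<partial>strip T) = (\<integral>\<^sup>+p\<in>{0..T} \<times> UNIV. f p \<partial>lborel)"
  unfolding strip_def by (subst nn_integral_density) (auto simp: mult.commute)

lemma emeasure_strip:
  "A \<in> noise_sets T \<Longrightarrow> emeasure (strip T) (A \<inter> B) = emeasure lborel (A \<inter> B)" if "B \<in> sets borel"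
proof -
  assume A: "A \<in> noise_sets T"
  then have [measurable]: "A \<in> sets borel" and sub: "A \<subseteq> {0..T} \<times> UNIV" by (auto simp: noise_sets_def)
  note that[measurable]
  have "emeasure (strip T) (A \<inter> B) = (\<integral>\<^sup>+p. indicator (A \<inter> B) p \<partial>strip T)" by simp
  also have "\<dots> = (\<integral>\<^sup>+p. indicator (A \<inter> B) p * indicator ({0..T} \<times> UNIV) p \<partial>lborel)"
    by (rule nn_integral_strip) measurable
  also have "\<dots> = (\<integral>\<^sup>+p. indicator (A \<inter> B) p \<partial>lborel)"
    using sub by (intro nn_integral_cong) (auto simp: indicator_def)
  finally show ?thesis by simp
qed

lemma (in prob_space) gaussian_rv_integrable:
  assumes "gaussian_rv M X"
  shows "integrable M X" "integrable M (\<lambda>\<omega>. (X \<omega>)\<^sup>2)"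
proof -
  have [measurable]: "X \<in> borel_measurable M" using assms by (simp add: gaussian_rv_def)
  have "integrable M X \<and> integrable M (\<lambda>\<omega>. (X \<omega>)\<^sup>2)"
  proof (cases "\<exists>m. AE \<omega> in M. X \<omega> = m")
    case True
    then obtain m where m: "AE \<omega> in M. X \<omega> = m" by auto
    have "integrable M X \<longleftrightarrow> integrable M (\<lambda>_. m)" using m by (intro integrable_cong_AE) auto
    moreover have "integrable M (\<lambda>\<omega>. (X \<omega>)\<^sup>2) \<longleftrightarrow> integrable M (\<lambda>_. m\<^sup>2)" using m by (intro integrable_cong_AE) auto
    ultimately show ?thesis by simp
  next
    case False
    then obtain m s where s: "0 < s" and d: "distributed M lborel X (\<lambda>x. ennreal (normal_density m s x))"
      using assms by (auto simp: gaussian_rv_def)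
    have "integrable M X"
      using distributed_integrable[OF d, of "\<lambda>x. x"] integrable_normal_moment_nz_1[OF s, of m] by simp
    moreover have "integrable M (\<lambda>\<omega>. (X \<omega> - m)\<^sup>2)"
      using distributed_integrable[OF d, of "\<lambda>x. (x - m)\<^sup>2"] integrable_normal_moment[OF s, of m 2] by simp
    then have "integrable M (\<lambda>\<omega>. (X \<omega> - m - (- m))\<^sup>2)"
      by (intro integrable_square_diff[of "\<lambda>\<omega>. X \<omega> - m" M "\<lambda>_. - m"]) auto
    ultimately show ?thesis by simp
  qed
  then show "integrable M X" "integrable M (\<lambda>\<omega>. (X \<omega>)\<^sup>2)" by auto
qed

lemma (in prob_space) gaussian_rv_centred:
  assumes X: "gaussian_rv M X" and mean: "expectation X = 0"
  shows "centred_gaussian M X (expectation (\<lambda>\<omega>. (X \<omega>)\<^sup>2))"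
proof -
  have [measurable]: "X \<in> borel_measurable M" using X by (simp add: gaussian_rv_def)
  have "expectation (\<lambda>\<omega>. iexp (\<xi> * X \<omega>)) = complex_of_real (exp (- (\<xi>\<^sup>2 * expectation (\<lambda>\<omega>. (X \<omega>)\<^sup>2)) / 2))" for \<xi>
  proof (cases "\<exists>m. AE \<omega> in M. X \<omega> = m")
    case True
    then obtain m where m: "AE \<omega> in M. X \<omega> = m" by auto
    have "expectation X = expectation (\<lambda>_. m)" using m by (intro integral_cong_AE) auto
    then have "m = 0" using mean by (simp add: prob_space)
    then have 0: "AE \<omega> in M. X \<omega> = 0" using m by simp
    have "expectation (\<lambda>\<omega>. (X \<omega>)\<^sup>2) = expectation (\<lambda>_. 0)" using 0 by (intro integral_cong_AE) auto
    moreover have "expectation (\<lambda>\<omega>. iexp (\<xi> * X \<omega>)) = expectation (\<lambda>_. 1 :: complex)" using 0 by (intro integral_cong_AE) auto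
    ultimately show ?thesis by (simp add: prob_space)
  next
    case False
    then obtain m s where s: "0 < s" and d: "distributed M lborel X (\<lambda>x. ennreal (normal_density m s x))"
      using X by (auto simp: gaussian_rv_def)
    have m: "m = 0" using normal_distributed_expectation[OF s d] mean by simp
    have var: "expectation (\<lambda>\<omega>. (X \<omega>)\<^sup>2) = s\<^sup>2"
      using normal_distributed_variance[OF s d] mean by simp
    have "distr M borel X = density lborel (normal_density 0 s)"
      using d m by (simp add: distributed_def distr_cong[OF refl _ refl, of borel lborel])
    then have "char (distr M borel X) \<xi> = complex_of_real (exp (- (s\<^sup>2 * \<xi>\<^sup>2) / 2))"
      using char_normal_density[OF s] by simp
    then show ?thesis unfolding var by (simp add: char_distr mult.commute)
  qed
  then show ?thesis by (auto simp: centred_gaussian_def)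
qed

lemma integrable_simple_strip:
  assumes F: "finite F" "F \<subseteq> noise_sets T"
  shows "integrable (strip T) (\<lambda>p. (\<Sum>A\<in>F. c A * indicator A p)\<^sup>2)"
    and "(\<integral>p. (\<Sum>A\<in>F. c A * indicator A p)\<^sup>2 \<partial>strip T)
      = (\<Sum>A\<in>F. \<Sum>B\<in>F. c A * c B * measure lborel (A \<inter> B))"
proof -
  have A: "A \<in> sets borel" "emeasure (strip T) (A \<inter> B) = emeasure lborel (A \<inter> B)" "emeasure lborel A < \<infinity>"
    if "A \<in> F" "B \<in> sets borel" for A B
    using that F emeasure_strip[of B A T] by (auto simp: noise_sets_def)
  have meas: "(indicator A :: real \<times> real \<Rightarrow> real) \<in> borel_measurable (strip T)" if "A \<in> F" for A
    using A[OF that, of UNIV] by simp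
  have sq: "integrable (strip T) (\<lambda>p. (indicator A p :: real)\<^sup>2)" if "A \<in> F" for A
  proof -
    have "(\<lambda>p. (indicator A p :: real)\<^sup>2) = indicator A" by (auto simp: indicator_def)
    then show ?thesis using A[OF that, of UNIV] by (simp add: integrable_indicator_iff)
  qed
  show "integrable (strip T) (\<lambda>p. (\<Sum>A\<in>F. c A * indicator A p)\<^sup>2)"
    using meas sq by (rule integrable_sum_squared)
  have "(\<integral>p. (\<Sum>A\<in>F. c A * indicator A p)\<^sup>2 \<partial>strip T)
     = (\<Sum>A\<in>F. \<Sum>B\<in>F. c A * c B * (\<integral>p. indicator A p * indicator B p \<partial>strip T))"
    using meas sq by (rule integrable_sum_squared)
  also have "\<dots> = (\<Sum>A\<in>F. \<Sum>B\<in>F. c A * c B * measure lborel (A \<inter> B))"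
  proof (intro sum.cong refl arg_cong2[where f="(*)"])
    fix A B assume "A \<in> F" "B \<in> F"
    have "(\<integral>p. indicator A p * indicator B p \<partial>strip T) = (\<integral>p. (indicator (A \<inter> B) p :: real) \<partial>strip T)"
      by (simp add: indicator_inter_arith)
    also have "\<dots> = measure lborel (A \<inter> B)"
      using A[OF \<open>A \<in> F\<close>, of B] A[OF \<open>B \<in> F\<close>, of UNIV] by (simp add: measure_def)
    finally show "(\<integral>p. indicator A p * indicator B p \<partial>strip T) = measure lborel (A \<inter> B)" .
  qed
  finally show "(\<integral>p. (\<Sum>A\<in>F. c A * indicator A p)\<^sup>2 \<partial>strip T)
      = (\<Sum>A\<in>F. \<Sum>B\<in>F. c A * c B * measure lborel (A \<inter> B))" .
qed

lemma (in prob_space) simple_wiener_integral: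
  fixes c :: "(real \<times> real) set \<Rightarrow> real"
  assumes W: "white_noise T M W" and F: "finite F" "F \<subseteq> noise_sets T"
  defines "S \<equiv> \<lambda>\<omega>. \<Sum>A\<in>F. c A * W A \<omega>"
  shows "centred_gaussian M S (\<integral>p. (\<Sum>A\<in>F. c A * indicator A p)\<^sup>2 \<partial>strip T)"
    and "integrable M (\<lambda>\<omega>. (S \<omega>)\<^sup>2)"
proof -
  have gp: "gaussian_rv M (\<lambda>\<omega>. \<Sum>A\<in>F'. c' A * W A \<omega>)" if "finite F'" "F' \<subseteq> noise_sets T" for F' c'
    using W that by (auto simp: white_noise_def gaussian_process_def)
  have WA: "gaussian_rv M (W A)" if "A \<in> F" for A
    using gp[of "{A}" "\<lambda>_. 1"] that F by auto
  have S: "gaussian_rv M S" unfolding S_def by (rule gp[OF F])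
  then show "integrable M (\<lambda>\<omega>. (S \<omega>)\<^sup>2)" by (rule gaussian_rv_integrable)
  have "expectation S = (\<Sum>A\<in>F. c A * expectation (W A))"
    unfolding S_def using gaussian_rv_integrable(1)[OF WA] by (subst Bochner_Integration.integral_sum) auto
  also have "\<dots> = 0" using W F by (intro sum.neutral) (auto simp: white_noise_def)
  finally have "centred_gaussian M S (expectation (\<lambda>\<omega>. (S \<omega>)\<^sup>2))" using S by (intro gaussian_rv_centred)
  also have "expectation (\<lambda>\<omega>. (S \<omega>)\<^sup>2) = (\<Sum>A\<in>F. \<Sum>B\<in>F. c A * c B * expectation (\<lambda>\<omega>. W A \<omega> * W B \<omega>))"
    unfolding S_def using WA gaussian_rv_integrable(2)[OF WA] by (intro integrable_sum_squared) (auto simp: gaussian_rv_def)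
  also have "\<dots> = (\<integral>p. (\<Sum>A\<in>F. c A * indicator A p)\<^sup>2 \<partial>strip T)"
    unfolding integrable_simple_strip(2)[OF F]
    using W F by (intro sum.cong refl arg_cong2[where f="(*)"]) (auto simp: white_noise_def)
  finally show "centred_gaussian M S (\<integral>p. (\<Sum>A\<in>F. c A * indicator A p)\<^sup>2 \<partial>strip T)" .
qed

text \<open>The law of a Wiener integral, with its variance given by the Wiener isometry. Both sides pass
  to the limit from simple integrands.\<close>

lemma (in prob_space) wiener_integral_gaussian:
  assumes W: "white_noise T M W" and X: "has_wiener_integral T M W h X"
  shows "centred_gaussian M X (\<integral>p. (h p)\<^sup>2 \<partial>strip T)" and "integrable (strip T) (\<lambda>p. (h p)\<^sup>2)"
proof -
  have [measurable]: "h \<in> borel_measurable borel" "X \<in> borel_measurable M"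
    using X by (auto simp: has_wiener_integral_def)
  obtain F c where F: "\<And>n::nat. finite (F n)" "\<And>n. F n \<subseteq> noise_sets T"
    and lim_h: "(\<lambda>n. \<integral>\<^sup>+p\<in>{0..T} \<times> UNIV. ennreal ((h p - (\<Sum>A\<in>F n. c n A * indicator A p))\<^sup>2) \<partial>lborel) \<longlonglongrightarrow> 0"
    and lim_X: "(\<lambda>n. \<integral>\<^sup>+\<omega>. ennreal ((X \<omega> - (\<Sum>A\<in>F n. c n A * W A \<omega>))\<^sup>2) \<partial>M) \<longlonglongrightarrow> 0"
    using X unfolding has_wiener_integral_def by blast
  define s S where "s n p = (\<Sum>A\<in>F n. c n A * indicator A p)" and "S n \<omega> = (\<Sum>A\<in>F n. c n A * W A \<omega>)" for n p \<omega>
  have s_meas[measurable]: "s n \<in> borel_measurable borel" for n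
    unfolding s_def using F[of n] by (intro borel_measurable_sum borel_measurable_times) (auto simp: noise_sets_def)
  have S: "centred_gaussian M (S n) (\<integral>p. (s n p)\<^sup>2 \<partial>strip T)" "integrable M (\<lambda>\<omega>. (S n \<omega>)\<^sup>2)" for n
    unfolding S_def s_def using simple_wiener_integral[OF W F(1,2)] by auto
  have S_meas[measurable]: "S n \<in> borel_measurable M" for n using S(1) by (simp add: centred_gaussian_def)
  have lim_h': "(\<lambda>n. \<integral>\<^sup>+p. ennreal ((h p - s n p)\<^sup>2) \<partial>strip T) \<longlonglongrightarrow> 0"
    using lim_h unfolding s_def[symmetric] by (subst nn_integral_strip) auto
  have s2: "integrable (strip T) (\<lambda>p. (s n p)\<^sup>2)" for n
    unfolding s_def using F by (rule integrable_simple_strip)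
  have h_meas: "h \<in> borel_measurable (strip T)" "\<And>n. s n \<in> borel_measurable (strip T)" by measurable
  note L2 = L2_limit_integrable[OF h_meas s2 lim_h']
  show "integrable (strip T) (\<lambda>p. (h p)\<^sup>2)" by (rule L2)
  have lim_X': "(\<lambda>n. \<integral>\<^sup>+\<omega>. ennreal ((X \<omega> - S n \<omega>)\<^sup>2) \<partial>M) \<longlonglongrightarrow> 0"
    using lim_X by (simp add: S_def)
  note L1 = L2_limit_L1[OF _ _ S(2) lim_X']
  have "expectation (\<lambda>\<omega>. iexp (\<xi> * X \<omega>)) = complex_of_real (exp (- (\<xi>\<^sup>2 * (\<integral>p. (h p)\<^sup>2 \<partial>strip T)) / 2))" for \<xi>
  proof (rule LIMSEQ_unique)
    show "(\<lambda>n. expectation (\<lambda>\<omega>. iexp (\<xi> * S n \<omega>))) \<longlonglongrightarrow> complex_of_real (exp (- (\<xi>\<^sup>2 * (\<integral>p. (h p)\<^sup>2 \<partial>strip T)) / 2))"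
    proof -
      have "(\<lambda>n. complex_of_real (exp (- (\<xi>\<^sup>2 * (\<integral>p. (s n p)\<^sup>2 \<partial>strip T)) / 2))) \<longlonglongrightarrow> complex_of_real (exp (- (\<xi>\<^sup>2 * (\<integral>p. (h p)\<^sup>2 \<partial>strip T)) / 2))"
        by (intro tendsto_of_real tendsto_exp tendsto_divide tendsto_minus tendsto_mult tendsto_const L2(3)) simp
      moreover have "expectation (\<lambda>\<omega>. iexp (\<xi> * S n \<omega>)) = complex_of_real (exp (- (\<xi>\<^sup>2 * (\<integral>p. (s n p)\<^sup>2 \<partial>strip T)) / 2))" for n
        using S(1)[of n] unfolding centred_gaussian_def by blast
      ultimately show ?thesis by simp
    qed
    have int: "integrable M (\<lambda>\<omega>. iexp (\<xi> * Y \<omega>))" if [measurable]: "Y \<in> borel_measurable M" for Y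
      by (rule integrable_const_bound[where B=1]) (auto simp del: of_real_mult)
    show "(\<lambda>n. expectation (\<lambda>\<omega>. iexp (\<xi> * S n \<omega>))) \<longlonglongrightarrow> expectation (\<lambda>\<omega>. iexp (\<xi> * X \<omega>))"
    proof (rule metric_tendsto_imp_tendsto)
      show "(\<lambda>n. \<bar>\<xi>\<bar> * expectation (\<lambda>\<omega>. norm (S n \<omega> - X \<omega>))) \<longlonglongrightarrow> 0"
        using tendsto_mult[OF tendsto_const L1(2), of "\<bar>\<xi>\<bar>"] by simp
      show "eventually (\<lambda>n. dist (expectation (\<lambda>\<omega>. iexp (\<xi> * S n \<omega>))) (expectation (\<lambda>\<omega>. iexp (\<xi> * X \<omega>)))
          \<le> dist (\<bar>\<xi>\<bar> * expectation (\<lambda>\<omega>. norm (S n \<omega> - X \<omega>))) 0) sequentially"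
      proof (intro always_eventually allI)
        fix n
        have "dist (expectation (\<lambda>\<omega>. iexp (\<xi> * S n \<omega>))) (expectation (\<lambda>\<omega>. iexp (\<xi> * X \<omega>)))
          = norm (expectation (\<lambda>\<omega>. iexp (\<xi> * S n \<omega>) - iexp (\<xi> * X \<omega>)))"
          using int[of X] int[of "S n"] by (simp add: dist_norm)
        also have "\<dots> \<le> expectation (\<lambda>\<omega>. norm (iexp (\<xi> * S n \<omega>) - iexp (\<xi> * X \<omega>)))"
          by (rule integral_norm_bound)
        also have "\<dots> \<le> expectation (\<lambda>\<omega>. \<bar>\<xi>\<bar> * norm (S n \<omega> - X \<omega>))"
        proof (rule integral_mono)
          show "integrable M (\<lambda>\<omega>. norm (iexp (\<xi> * S n \<omega>) - iexp (\<xi> * X \<omega>)))"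
            by (intro integrable_norm Bochner_Integration.integrable_diff int) measurable
          show "integrable M (\<lambda>\<omega>. \<bar>\<xi>\<bar> * norm (S n \<omega> - X \<omega>))"
            using L1(1) by simp
          fix \<omega>
          show "norm (iexp (\<xi> * S n \<omega>) - iexp (\<xi> * X \<omega>)) \<le> \<bar>\<xi>\<bar> * norm (S n \<omega> - X \<omega>)"
            using norm_iexp_diff_le[of "\<xi> * S n \<omega>" "\<xi> * X \<omega>"]
            by (simp add: abs_mult[symmetric] right_diff_distrib)
        qed
        also have "\<dots> = \<bar>\<xi>\<bar> * expectation (\<lambda>\<omega>. norm (S n \<omega> - X \<omega>))" by simp
        finally show "dist (expectation (\<lambda>\<omega>. iexp (\<xi> * S n \<omega>))) (expectation (\<lambda>\<omega>. iexp (\<xi> * X \<omega>)))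
          \<le> dist (\<bar>\<xi>\<bar> * expectation (\<lambda>\<omega>. norm (S n \<omega> - X \<omega>))) 0"
          by (simp add: dist_norm)
      qed
    qed
  qed
  then show "centred_gaussian M X (\<integral>p. (h p)\<^sup>2 \<partial>strip T)"
    by (auto simp: centred_gaussian_def)
qed

lemma has_wiener_integral_lincomb:
  assumes W: "white_noise T M W"
    and X: "has_wiener_integral T M W h X" and Y: "has_wiener_integral T M W g Y"
  shows "has_wiener_integral T M W (\<lambda>p. a * h p + b * g p) (\<lambda>\<omega>. a * X \<omega> + b * Y \<omega>)"
proof -
  have [measurable]: "h \<in> borel_measurable borel" "X \<in> borel_measurable M" "g \<in> borel_measurable borel" "Y \<in> borel_measurable M"
    using X Y by (auto simp: has_wiener_integral_def)
  have W_meas: "W A \<in> borel_measurable M" if "A \<in> noise_sets T" for A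
  proof -
    have "gaussian_rv M (\<lambda>\<omega>. \<Sum>B\<in>{A}. 1 * W B \<omega>)"
      using W that unfolding white_noise_def gaussian_process_def
      by (elim conjE allE[of _ "{A}"] allE[of _ "\<lambda>_. 1"]) simp
    then show ?thesis by (simp add: gaussian_rv_def)
  qed
  obtain F c where F: "\<And>n::nat. finite (F n)" "\<And>n. F n \<subseteq> noise_sets T"
    and F_h: "(\<lambda>n. \<integral>\<^sup>+p\<in>{0..T} \<times> UNIV. ennreal ((h p - (\<Sum>A\<in>F n. c n A * indicator A p))\<^sup>2) \<partial>lborel) \<longlonglongrightarrow> 0"
    and F_X: "(\<lambda>n. \<integral>\<^sup>+\<omega>. ennreal ((X \<omega> - (\<Sum>A\<in>F n. c n A * W A \<omega>))\<^sup>2) \<partial>M) \<longlonglongrightarrow> 0"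
    using X unfolding has_wiener_integral_def by blast
  obtain G d where G: "\<And>n::nat. finite (G n)" "\<And>n. G n \<subseteq> noise_sets T"
    and G_h: "(\<lambda>n. \<integral>\<^sup>+p\<in>{0..T} \<times> UNIV. ennreal ((g p - (\<Sum>A\<in>G n. d n A * indicator A p))\<^sup>2) \<partial>lborel) \<longlonglongrightarrow> 0"
    and G_X: "(\<lambda>n. \<integral>\<^sup>+\<omega>. ennreal ((Y \<omega> - (\<Sum>A\<in>G n. d n A * W A \<omega>))\<^sup>2) \<partial>M) \<longlonglongrightarrow> 0"
    using Y unfolding has_wiener_integral_def by blast
  define e where "e n A = (if A \<in> F n then a * c n A else 0) + (if A \<in> G n then b * d n A else 0)" for n A
  have e: "(\<Sum>A\<in>F n \<union> G n. e n A * f A) = a * (\<Sum>A\<in>F n. c n A * f A) + b * (\<Sum>A\<in>G n. d n A * f A)" for n and f :: "_ \<Rightarrow> real"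
  proof -
    have "(\<Sum>A\<in>F n \<union> G n. e n A * f A) = (\<Sum>A\<in>F n \<union> G n. if A \<in> F n then a * c n A * f A else 0)
        + (\<Sum>A\<in>F n \<union> G n. if A \<in> G n then b * d n A * f A else 0)"
      unfolding sum.distrib[symmetric] by (intro sum.cong) (auto simp: e_def distrib_right)
    also have "(\<Sum>A\<in>F n \<union> G n. if A \<in> F n then a * c n A * f A else 0) = (\<Sum>A\<in>F n. a * c n A * f A)"
      using F G by (intro sum.mono_neutral_cong_right) auto
    also have "(\<Sum>A\<in>F n \<union> G n. if A \<in> G n then b * d n A * f A else 0) = (\<Sum>A\<in>G n. b * d n A * f A)"
      using F G by (intro sum.mono_neutral_cong_right) auto
    finally show ?thesis by (simp add: sum_distrib_left mult.assoc)
  qed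
  have comb: "(\<lambda>n. \<integral>\<^sup>+x. ennreal ((a * u x + b * v x - (a * u' n x + b * v' n x))\<^sup>2) \<partial>N) \<longlonglongrightarrow> 0"
    if [measurable]: "u \<in> borel_measurable N" "v \<in> borel_measurable N" "\<And>n. u' n \<in> borel_measurable N" "\<And>n. v' n \<in> borel_measurable N"
      and u: "(\<lambda>n. \<integral>\<^sup>+x. ennreal ((u x - u' n x)\<^sup>2) \<partial>N) \<longlonglongrightarrow> 0"
      and v: "(\<lambda>n. \<integral>\<^sup>+x. ennreal ((v x - v' n x)\<^sup>2) \<partial>N) \<longlonglongrightarrow> 0"
    for u v :: "'z \<Rightarrow> real" and u' v' and N :: "'z measure"
  proof (rule tendsto_sandwich[OF _ _ tendsto_const])
    let ?R = "\<lambda>n. ennreal (2 * a\<^sup>2) * (\<integral>\<^sup>+x. ennreal ((u x - u' n x)\<^sup>2) \<partial>N) + ennreal (2 * b\<^sup>2) * (\<integral>\<^sup>+x. ennreal ((v x - v' n x)\<^sup>2) \<partial>N)"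
    show "?R \<longlonglongrightarrow> 0"
      using tendsto_add[OF ennreal_tendsto_cmult[OF _ u, of "ennreal (2 * a\<^sup>2)"] ennreal_tendsto_cmult[OF _ v, of "ennreal (2 * b\<^sup>2)"]] by simp
    show "eventually (\<lambda>n. (\<integral>\<^sup>+x. ennreal ((a * u x + b * v x - (a * u' n x + b * v' n x))\<^sup>2) \<partial>N) \<le> ?R n) sequentially"
    proof (intro always_eventually allI)
      fix n
      have "(\<integral>\<^sup>+x. ennreal ((a * u x + b * v x - (a * u' n x + b * v' n x))\<^sup>2) \<partial>N)
        \<le> (\<integral>\<^sup>+x. ennreal (2 * a\<^sup>2) * ennreal ((u x - u' n x)\<^sup>2) + ennreal (2 * b\<^sup>2) * ennreal ((v x - v' n x)\<^sup>2) \<partial>N)"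
      proof (intro nn_integral_mono)
        fix x
        have "(a * u x + b * v x - (a * u' n x + b * v' n x))\<^sup>2 = (a * (u x - u' n x) + b * (v x - v' n x))\<^sup>2"
          by (simp add: algebra_simps)
        also have "\<dots> \<le> 2 * (a * (u x - u' n x))\<^sup>2 + 2 * (b * (v x - v' n x))\<^sup>2"
          using sum_squares_bound[of "a * (u x - u' n x)" "b * (v x - v' n x)"] by (simp add: power2_sum)
        also have "\<dots> = 2 * a\<^sup>2 * (u x - u' n x)\<^sup>2 + 2 * b\<^sup>2 * (v x - v' n x)\<^sup>2"
          by (simp add: power_mult_distrib)
        finally have "ennreal ((a * u x + b * v x - (a * u' n x + b * v' n x))\<^sup>2) \<le> ennreal (2 * a\<^sup>2 * (u x - u' n x)\<^sup>2 + 2 * b\<^sup>2 * (v x - v' n x)\<^sup>2)"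
          by (rule ennreal_leI)
        then show "ennreal ((a * u x + b * v x - (a * u' n x + b * v' n x))\<^sup>2) \<le> ennreal (2 * a\<^sup>2) * ennreal ((u x - u' n x)\<^sup>2) + ennreal (2 * b\<^sup>2) * ennreal ((v x - v' n x)\<^sup>2)"
          by (subst (asm) ennreal_plus) (simp_all add: ennreal_mult)
      qed
      also have "\<dots> = ?R n" by (simp add: nn_integral_add nn_integral_cmult)
      finally show "(\<integral>\<^sup>+x. ennreal ((a * u x + b * v x - (a * u' n x + b * v' n x))\<^sup>2) \<partial>N) \<le> ?R n" .
    qed
  qed auto
  have sm: "(\<lambda>p. \<Sum>A\<in>H. k A * indicator A p :: real) \<in> borel_measurable borel" if "H \<subseteq> noise_sets T" for H k
    using that by (intro borel_measurable_sum borel_measurable_times) (auto simp: noise_sets_def)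
  have Sm: "(\<lambda>\<omega>. \<Sum>A\<in>H. k A * W A \<omega>) \<in> borel_measurable M" if "H \<subseteq> noise_sets T" for H k
    using that W_meas by (intro borel_measurable_sum borel_measurable_times) auto
  have "(\<lambda>n. \<integral>\<^sup>+p\<in>{0..T} \<times> UNIV. ennreal ((a * h p + b * g p - (\<Sum>A\<in>F n \<union> G n. e n A * indicator A p))\<^sup>2) \<partial>lborel) \<longlonglongrightarrow> 0"
    unfolding e using sm[OF F(2)] sm[OF G(2)] F_h G_h comb[of h "strip T" g "\<lambda>n p. \<Sum>A\<in>F n. c n A * indicator A p" "\<lambda>n p. \<Sum>A\<in>G n. d n A * indicator A p"]
    by (simp add: nn_integral_strip)
  moreover have "(\<lambda>n. \<integral>\<^sup>+\<omega>. ennreal ((a * X \<omega> + b * Y \<omega> - (\<Sum>A\<in>F n \<union> G n. e n A * W A \<omega>))\<^sup>2) \<partial>M) \<longlonglongrightarrow> 0"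
    unfolding e using Sm[OF F(2)] Sm[OF G(2)] F_X G_X by (intro comb) auto
  moreover have "\<forall>n. finite (F n \<union> G n) \<and> F n \<union> G n \<subseteq> noise_sets T" using F G by auto
  ultimately show ?thesis unfolding has_wiener_integral_def
    by (intro conjI exI[of _ "\<lambda>n. F n \<union> G n"] exI[of _ e]) auto
qed

text \<open>Almost surely, a Wiener integral is a measurable function of the noise: pass to an almost
  surely convergent subsequence of the simple integrals.\<close>

lemma (in prob_space) wiener_integral_functional:
  assumes W: "white_noise T M W" and X: "has_wiener_integral T M W h X"
  shows "\<exists>\<Phi> \<in> borel_measurable (Pi\<^sub>M (noise_sets T) (\<lambda>_. borel)). AE \<omega> in M. X \<omega> = \<Phi> (\<lambda>A\<in>noise_sets T. W A \<omega>)"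
proof -
  have X_meas[measurable]: "X \<in> borel_measurable M"
    using X by (auto simp: has_wiener_integral_def)
  obtain F c where F: "\<And>n::nat. finite (F n)" "\<And>n. F n \<subseteq> noise_sets T"
    and lim_X: "(\<lambda>n. \<integral>\<^sup>+\<omega>. ennreal ((X \<omega> - (\<Sum>A\<in>F n. c n A * W A \<omega>))\<^sup>2) \<partial>M) \<longlonglongrightarrow> 0"
    using X unfolding has_wiener_integral_def by blast
  define S where "S n \<omega> = (\<Sum>A\<in>F n. c n A * W A \<omega>)" for n \<omega>
  have S: "integrable M (\<lambda>\<omega>. (S n \<omega>)\<^sup>2)" "S n \<in> borel_measurable M" for n
    unfolding S_def using simple_wiener_integral[OF W F(1)[of n] F(2)[of n], of "c n"] by (auto simp: centred_gaussian_def)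
  have lim_X': "(\<lambda>n. \<integral>\<^sup>+\<omega>. ennreal ((X \<omega> - S n \<omega>)\<^sup>2) \<partial>M) \<longlonglongrightarrow> 0"
    using lim_X by (simp add: S_def)
  note L1 = L2_limit_L1[OF X_meas S(2) S(1) lim_X']
  obtain r :: "nat \<Rightarrow> nat" where r: "AE \<omega> in M. (\<lambda>n. S (r n) \<omega> - X \<omega>) \<longlonglongrightarrow> 0"
    using tendsto_L1_AE_subseq[OF L1(1) L1(2)] by blast
  define \<Phi> where "\<Phi> y = lim (\<lambda>n. \<Sum>A\<in>F (r n). c (r n) A * y A)" for y :: "(real \<times> real) set \<Rightarrow> real"
  have "\<Phi> \<in> borel_measurable (Pi\<^sub>M (noise_sets T) (\<lambda>_. borel))"
    unfolding \<Phi>_def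
  proof (intro borel_measurable_lim_metric borel_measurable_sum borel_measurable_times borel_measurable_const)
    fix n A assume "A \<in> F (r n)"
    then show "(\<lambda>y. y A) \<in> borel_measurable (Pi\<^sub>M (noise_sets T) (\<lambda>_. borel))"
      using F(2)[of "r n"] by (intro measurable_component_singleton) auto
  qed
  moreover have "AE \<omega> in M. X \<omega> = \<Phi> (\<lambda>A\<in>noise_sets T. W A \<omega>)"
    using r
  proof eventually_elim
    case (elim \<omega>)
    then have "(\<lambda>n. S (r n) \<omega>) \<longlonglongrightarrow> X \<omega>" by (rule LIM_zero_cancel)
    moreover have "S (r n) \<omega> = (\<Sum>A\<in>F (r n). c (r n) A * (\<lambda>A\<in>noise_sets T. W A \<omega>) A)" for n
      unfolding S_def using F(2)[of "r n"] by (intro sum.cong) auto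
    ultimately show ?case unfolding \<Phi>_def by (simp add: limI)
  qed
  ultimately show ?thesis by blast
qed

subsection \<open>Pairs and independent copies\<close>

context prob_space
begin

lemma wiener_integral_pair_char:
  assumes W: "white_noise T M W"
    and X: "has_wiener_integral T M W h X" and Y: "has_wiener_integral T M W g Y"
  shows "(\<integral>\<omega>. iexp (\<xi> * X \<omega> + \<eta> * Y \<omega>) \<partial>M) = complex_of_real (exp (- (\<xi>\<^sup>2 * (\<integral>p. (h p)\<^sup>2 \<partial>strip T)
    + 2 * \<xi> * \<eta> * (\<integral>p. h p * g p \<partial>strip T) + \<eta>\<^sup>2 * (\<integral>p. (g p)\<^sup>2 \<partial>strip T)) / 2))"
proof -
  have [measurable]: "h \<in> borel_measurable borel" "g \<in> borel_measurable borel"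
    using X Y by (auto simp: has_wiener_integral_def)
  have h2: "integrable (strip T) (\<lambda>p. (h p)\<^sup>2)" and g2: "integrable (strip T) (\<lambda>p. (g p)\<^sup>2)"
    using wiener_integral_gaussian(2)[OF W X] wiener_integral_gaussian(2)[OF W Y] by auto
  have hg: "integrable (strip T) (\<lambda>p. h p * g p)"
    by (rule integrable_mult_of_squares[OF _ _ h2 g2]) measurable
  have "centred_gaussian M (\<lambda>\<omega>. \<xi> * X \<omega> + \<eta> * Y \<omega>) (\<integral>p. (\<xi> * h p + \<eta> * g p)\<^sup>2 \<partial>strip T)"
    by (rule wiener_integral_gaussian(1)[OF W has_wiener_integral_lincomb[OF W X Y]])
  then have "(\<integral>\<omega>. iexp (1 * (\<xi> * X \<omega> + \<eta> * Y \<omega>)) \<partial>M) = complex_of_real (exp (- (1\<^sup>2 * (\<integral>p. (\<xi> * h p + \<eta> * g p)\<^sup>2 \<partial>strip T)) / 2))"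
    unfolding centred_gaussian_def by blast
  moreover have "(\<integral>p. (\<xi> * h p + \<eta> * g p)\<^sup>2 \<partial>strip T)
      = (\<integral>p. \<xi>\<^sup>2 * (h p)\<^sup>2 + 2 * \<xi> * \<eta> * (h p * g p) + \<eta>\<^sup>2 * (g p)\<^sup>2 \<partial>strip T)"
    by (intro Bochner_Integration.integral_cong refl) (simp add: power2_eq_square algebra_simps)
  moreover have "\<dots> = \<xi>\<^sup>2 * (\<integral>p. (h p)\<^sup>2 \<partial>strip T)
    + 2 * \<xi> * \<eta> * (\<integral>p. h p * g p \<partial>strip T) + \<eta>\<^sup>2 * (\<integral>p. (g p)\<^sup>2 \<partial>strip T)"
    using h2 g2 hg by simp
  ultimately show ?thesis by simp
qed

lemma wiener_integral_pair_bound: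
  assumes W: "white_noise T M W"
    and X: "has_wiener_integral T M W h X" and Y: "has_wiener_integral T M W g Y"
    and a: "0 < a" "a \<le> (\<integral>p. (h p)\<^sup>2 \<partial>strip T)"
    and c: "(\<integral>p. (g p)\<^sup>2 \<partial>strip T) \<le> \<delta>" and \<delta>: "0 < \<delta>" and s: "0 < s" and u: "0 \<le> u"
  shows "prob {\<omega> \<in> space M. \<bar>X \<omega> - z\<bar> \<le> s \<and> u < \<bar>Y \<omega>\<bar>} \<le> 4 * s / sqrt a * exp (- u\<^sup>2 / (16 * \<delta>))"
proof -
  have "X \<in> borel_measurable M" "Y \<in> borel_measurable M"
    using X Y by (auto simp: has_wiener_integral_def)
  then have "prob {\<omega> \<in> space M. \<bar>X \<omega> - z\<bar> \<le> s \<and> u < \<bar>Y \<omega>\<bar>}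
      \<le> 4 * s / sqrt (\<integral>p. (h p)\<^sup>2 \<partial>strip T) * exp (- u\<^sup>2 / (16 * \<delta>))"
    using a by (intro gaussian_pair_bound[OF _ _ wiener_integral_pair_char[OF W X Y] _ c \<delta> s u]) auto
  also have "\<dots> \<le> 4 * s / sqrt a * exp (- u\<^sup>2 / (16 * \<delta>))"
    using a s by (intro mult_right_mono divide_left_mono) (auto intro!: mult_pos_pos)
  finally show ?thesis .
qed

lemma wiener_integral_bound:
  assumes W: "white_noise T M W" and X: "has_wiener_integral T M W h X"
    and a: "0 < a" "a \<le> (\<integral>p. (h p)\<^sup>2 \<partial>strip T)" and s: "0 \<le> s"
  shows "prob {\<omega> \<in> space M. \<bar>X \<omega> - z\<bar> \<le> s} \<le> s / sqrt a"
proof -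
  have "prob {\<omega> \<in> space M. \<bar>X \<omega> - z\<bar> \<le> s} \<le> s / sqrt (\<integral>p. (h p)\<^sup>2 \<partial>strip T)"
    using centred_gaussian_interval[OF wiener_integral_gaussian(1)[OF W X], of s 0 z] a s by simp
  also have "\<dots> \<le> s / sqrt a"
    using a s by (intro divide_left_mono) (auto intro!: mult_pos_pos)
  finally show ?thesis .
qed

lemma indep_wiener_integrals:
  fixes W :: "'d :: finite \<Rightarrow> (real \<times> real) set \<Rightarrow> 'a \<Rightarrow> real"
  assumes W: "indep_white_noises T M W"
    and X: "\<And>i. has_wiener_integral T M (W i) (h i) (X i)"
    and Y: "\<And>i. has_wiener_integral T M (W i) (g i) (Y i)"
    and B: "\<And>i. B i \<in> sets (borel \<Otimes>\<^sub>M borel)"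
  shows "prob {\<omega> \<in> space M. \<forall>i. (X i \<omega>, Y i \<omega>) \<in> B i} = (\<Prod>i\<in>UNIV. prob {\<omega> \<in> space M. (X i \<omega>, Y i \<omega>) \<in> B i})"
proof -
  let ?P = "Pi\<^sub>M (noise_sets T) (\<lambda>_. borel :: real measure)"
  define N where "N i \<omega> = (\<lambda>A\<in>noise_sets T. W i A \<omega>)" for i \<omega>
  have Wi: "white_noise T M (W i)" for i using W by (simp add: indep_white_noises_def)
  have ind: "indep_vars (\<lambda>_. ?P) N UNIV"
    using W unfolding indep_white_noises_def N_def by blast
  have [measurable]: "X i \<in> borel_measurable M" "Y i \<in> borel_measurable M" for i
    using X[of i] Y[of i] by (auto simp: has_wiener_integral_def)
  note B[measurable]
  obtain \<Phi> where \<Phi>[measurable]: "\<And>i. \<Phi> i \<in> borel_measurable ?P" and X_eq: "\<And>i. AE \<omega> in M. X i \<omega> = \<Phi> i (N i \<omega>)"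
  proof -
    have "\<forall>i. \<exists>\<Phi>. \<Phi> \<in> borel_measurable ?P \<and> (AE \<omega> in M. X i \<omega> = \<Phi> (N i \<omega>))"
      using wiener_integral_functional[OF Wi X] unfolding N_def by blast
    then show ?thesis using that by (auto dest!: choice)
  qed
  obtain \<Psi> where \<Psi>[measurable]: "\<And>i. \<Psi> i \<in> borel_measurable ?P" and Y_eq: "\<And>i. AE \<omega> in M. Y i \<omega> = \<Psi> i (N i \<omega>)"
  proof -
    have "\<forall>i. \<exists>\<Psi>. \<Psi> \<in> borel_measurable ?P \<and> (AE \<omega> in M. Y i \<omega> = \<Psi> (N i \<omega>))"
      using wiener_integral_functional[OF Wi Y] unfolding N_def by blast
    then show ?thesis using that by (auto dest!: choice)
  qed
  have N_meas[measurable]: "N i \<in> measurable M ?P" for i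
    using ind by (auto simp: indep_vars_def)
  have ind': "indep_vars (\<lambda>_. borel \<Otimes>\<^sub>M borel) (\<lambda>i \<omega>. (\<Phi> i (N i \<omega>), \<Psi> i (N i \<omega>))) UNIV"
    by (rule indep_vars_compose2[OF ind, where Y="\<lambda>i y. (\<Phi> i y, \<Psi> i y)"]) measurable
  have XY: "AE \<omega> in M. \<forall>i. X i \<omega> = \<Phi> i (N i \<omega>) \<and> Y i \<omega> = \<Psi> i (N i \<omega>)"
  proof -
    have "AE \<omega> in M. \<forall>i\<in>UNIV. X i \<omega> = \<Phi> i (N i \<omega>) \<and> Y i \<omega> = \<Psi> i (N i \<omega>)"
      using X_eq Y_eq by (intro AE_finite_allI) auto
    then show ?thesis by simp
  qed
  have "prob {\<omega> \<in> space M. \<forall>i. (X i \<omega>, Y i \<omega>) \<in> B i} = prob {\<omega> \<in> space M. \<forall>i. (\<Phi> i (N i \<omega>), \<Psi> i (N i \<omega>)) \<in> B i}"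
  proof (rule finite_measure_eq_AE)
    show "AE \<omega> in M. (\<omega> \<in> {\<omega> \<in> space M. \<forall>i. (X i \<omega>, Y i \<omega>) \<in> B i}) = (\<omega> \<in> {\<omega> \<in> space M. \<forall>i. (\<Phi> i (N i \<omega>), \<Psi> i (N i \<omega>)) \<in> B i})"
      using XY by eventually_elim auto
  qed measurable
  also have "{\<omega> \<in> space M. \<forall>i. (\<Phi> i (N i \<omega>), \<Psi> i (N i \<omega>)) \<in> B i}
      = (\<Inter>i\<in>UNIV. (\<lambda>\<omega>. (\<Phi> i (N i \<omega>), \<Psi> i (N i \<omega>))) -` B i \<inter> space M)"
    by auto
  also have "prob \<dots> = (\<Prod>i\<in>UNIV. prob ((\<lambda>\<omega>. (\<Phi> i (N i \<omega>), \<Psi> i (N i \<omega>))) -` B i \<inter> space M))"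
    using B by (intro indep_varsD_finite[OF ind']) auto
  also have "\<dots> = (\<Prod>i\<in>UNIV. prob {\<omega> \<in> space M. (X i \<omega>, Y i \<omega>) \<in> B i})"
  proof (intro prod.cong refl)
    fix i
    show "prob ((\<lambda>\<omega>. (\<Phi> i (N i \<omega>), \<Psi> i (N i \<omega>))) -` B i \<inter> space M) = prob {\<omega> \<in> space M. (X i \<omega>, Y i \<omega>) \<in> B i}"
    proof (rule finite_measure_eq_AE)
      show "AE \<omega> in M. (\<omega> \<in> (\<lambda>\<omega>. (\<Phi> i (N i \<omega>), \<Psi> i (N i \<omega>))) -` B i \<inter> space M) = (\<omega> \<in> {\<omega> \<in> space M. (X i \<omega>, Y i \<omega>) \<in> B i})"
        using XY by eventually_elim auto
    qed measurable
  qed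
  finally show ?thesis .
qed

lemma wiener_vector_bound:
  fixes W :: "'d :: finite \<Rightarrow> (real \<times> real) set \<Rightarrow> 'a \<Rightarrow> real"
  assumes W: "indep_white_noises T M W"
    and X: "\<And>i. has_wiener_integral T M (W i) h (X i)"
    and a: "0 < a" "a \<le> (\<integral>p. (h p)\<^sup>2 \<partial>strip T)" and s: "0 \<le> s"
  shows "prob {\<omega> \<in> space M. \<forall>i. \<bar>X i \<omega> - z i\<bar> \<le> s} \<le> (s / sqrt a) ^ CARD('d)"
proof -
  let ?B = "\<lambda>i. {x :: real \<times> real. \<bar>fst x - z i\<bar> \<le> s}"
  have Wi: "white_noise T M (W i)" for i using W by (simp add: indep_white_noises_def)
  have "{x :: real \<times> real. x \<in> space (borel \<Otimes>\<^sub>M borel) \<and> \<bar>fst x - z i\<bar> \<le> s} \<in> sets (borel \<Otimes>\<^sub>M borel)" for i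
    by measurable
  then have "prob {\<omega> \<in> space M. \<forall>i. (X i \<omega>, X i \<omega>) \<in> ?B i} = (\<Prod>i\<in>UNIV. prob {\<omega> \<in> space M. (X i \<omega>, X i \<omega>) \<in> ?B i})"
    by (intro indep_wiener_integrals[OF W X X]) (simp add: space_pair_measure)
  also have "\<dots> \<le> (\<Prod>i\<in>(UNIV :: 'd set). s / sqrt a)"
    using wiener_integral_bound[OF Wi X a s] by (intro prod_mono) auto
  finally show ?thesis by simp
qed

text \<open>By independence of the components, all of \<open>X\<close> being close to \<open>z\<close> costs a factor
  \<open>s / sqrt a\<close> per component, and only the component \<open>j\<close> also has to account for the increment.\<close>

lemma wiener_vector_pair_bound:
  fixes W :: "'d :: finite \<Rightarrow> (real \<times> real) set \<Rightarrow> 'a \<Rightarrow> real"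
  assumes W: "indep_white_noises T M W"
    and X: "\<And>i. has_wiener_integral T M (W i) h (X i)"
    and Y: "\<And>i. has_wiener_integral T M (W i) g (Y i)"
    and a: "0 < a" "a \<le> (\<integral>p. (h p)\<^sup>2 \<partial>strip T)"
    and c: "(\<integral>p. (g p)\<^sup>2 \<partial>strip T) \<le> \<delta>" and \<delta>: "0 < \<delta>" and s: "0 < s" and u: "0 \<le> u"
  shows "prob {\<omega> \<in> space M. (\<forall>i. \<bar>X i \<omega> - z i\<bar> \<le> s) \<and> u < \<bar>Y j \<omega>\<bar>}
    \<le> 4 * (s / sqrt a) ^ CARD('d) * exp (- u\<^sup>2 / (16 * \<delta>))"
proof -
  let ?B = "\<lambda>i. {x :: real \<times> real. \<bar>fst x - z i\<bar> \<le> s \<and> (i = j \<longrightarrow> u < \<bar>snd x\<bar>)}"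
  have Wi: "white_noise T M (W i)" for i using W by (simp add: indep_white_noises_def)
  have "{x :: real \<times> real. x \<in> space (borel \<Otimes>\<^sub>M borel) \<and> (\<bar>fst x - z i\<bar> \<le> s \<and> (i = j \<longrightarrow> u < \<bar>snd x\<bar>))} \<in> sets (borel \<Otimes>\<^sub>M borel)" for i
    by measurable
  then have "prob {\<omega> \<in> space M. \<forall>i. (X i \<omega>, Y i \<omega>) \<in> ?B i} = (\<Prod>i\<in>UNIV. prob {\<omega> \<in> space M. (X i \<omega>, Y i \<omega>) \<in> ?B i})"
    by (intro indep_wiener_integrals[OF W X Y]) (simp add: space_pair_measure)
  also have "\<dots> \<le> (\<Prod>i\<in>(UNIV :: 'd set). s / sqrt a * (if i = j then 4 * exp (- u\<^sup>2 / (16 * \<delta>)) else 1))"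
  proof (intro prod_mono conjI)
    fix i
    show "prob {\<omega> \<in> space M. (X i \<omega>, Y i \<omega>) \<in> ?B i} \<le> s / sqrt a * (if i = j then 4 * exp (- u\<^sup>2 / (16 * \<delta>)) else 1)"
    proof (cases "i = j")
      case True
      then show ?thesis
        using wiener_integral_pair_bound[OF Wi X Y a c \<delta> s u, of i "z i"] by (simp add: mult_ac)
    next
      case False
      then show ?thesis using wiener_integral_bound[OF Wi X a, of s i "z i"] s by simp
    qed
  qed simp
  also have "\<dots> = (s / sqrt a) ^ CARD('d) * (\<Prod>i\<in>UNIV. if i = j then 4 * exp (- u\<^sup>2 / (16 * \<delta>)) else 1)"
    unfolding prod.distrib by simp
  also have "(\<Prod>i\<in>UNIV. if i = j then 4 * exp (- u\<^sup>2 / (16 * \<delta>)) else 1) = 4 * exp (- u\<^sup>2 / (16 * \<delta>))"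
    by (simp add: prod.delta)
  also have "{\<omega> \<in> space M. \<forall>i. (X i \<omega>, Y i \<omega>) \<in> ?B i} = {\<omega> \<in> space M. (\<forall>i. \<bar>X i \<omega> - z i\<bar> \<le> s) \<and> u < \<bar>Y j \<omega>\<bar>}"
    by auto
  finally show ?thesis by (simp add: mult_ac)
qed

end

section \<open>Chaining\<close>

lemma summable_chain_level:
  fixes c :: real
  assumes "0 < c"
  shows "summable (\<lambda>k::nat. (real k + 3) ^ d * exp (- c * (real k + 1)))"
proof (rule summable_comparison_test_bigo)
  show "summable (\<lambda>n. norm (exp (- c / 2) ^ n))" using assms by (simp add: summable_geometric)
  have "(\<lambda>k::nat. (real k + 3) ^ d * exp (- c * (real k + 1))) \<in> O(\<lambda>k. exp (- c / 2 * real k))"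
    using assms by real_asymp
  then show "(\<lambda>k::nat. (real k + 3) ^ d * exp (- c * (real k + 1))) \<in> O(\<lambda>k. exp (- c / 2) ^ k)"
    by (simp add: exp_of_nat_mult[symmetric] mult.commute)
qed

lemma summable_chain_edges:
  fixes c \<gamma> :: real
  assumes "0 < c" "1 < \<gamma>"
  shows "summable (\<lambda>n::nat. 16 ^ n * exp (- c * \<gamma> ^ n))"
proof (rule summable_comparison_test_bigo)
  show "summable (\<lambda>n. norm ((1/2 :: real) ^ n))" by (simp add: summable_geometric)
  have "(\<lambda>n::nat. 16 ^ n * exp (- c * \<gamma> ^ n)) \<in> O(\<lambda>n. (1/2 :: real) ^ n)"
    using assms by real_asymp
  then show "(\<lambda>n::nat. 16 ^ n * exp (- c * \<gamma> ^ n)) \<in> O(\<lambda>n. (1/2 :: real) ^ n)" .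
qed

text \<open>The rectangle with lower left corner \<open>p\<close> and side lengths \<open>b\<close>; sides of length 0 are
  allowed.\<close>

definition cell :: "real \<times> real \<Rightarrow> real \<times> real \<Rightarrow> (real \<times> real) set" where
  "cell p b = {fst p..fst p + fst b} \<times> {snd p..snd p + snd b}"

text \<open>The points of level \<open>n\<close> of the dyadic subdivision of \<open>cell p b\<close>; those of level 0 are its
  corners.\<close>

definition dyadic :: "real \<times> real \<Rightarrow> real \<times> real \<Rightarrow> nat \<Rightarrow> (real \<times> real) set" where
  "dyadic p b n = (\<lambda>(k, l). (fst p + fst b * (real k / 2 ^ n), snd p + snd b * (real l / 2 ^ n))) ` ({..2 ^ n} \<times> {..2 ^ n})"

text \<open>The pairs of dyadic points of levels \<open>n\<close> and \<open>Suc n\<close> that can approximate the same point of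
  the cell.\<close>

definition links :: "real \<times> real \<Rightarrow> real \<times> real \<Rightarrow> nat \<Rightarrow> ((real \<times> real) \<times> (real \<times> real)) set" where
  "links p b n = {(q, q') \<in> dyadic p b n \<times> dyadic p b (Suc n).
     \<bar>fst q - fst q'\<bar> \<le> fst b / 2 ^ n \<and> \<bar>snd q - snd q'\<bar> \<le> snd b / 2 ^ n}"

lemma finite_dyadic: "finite (dyadic p b n)"
  by (simp add: dyadic_def)

lemma card_dyadic: "card (dyadic p b n) \<le> (2 ^ n + 1) ^ 2"
proof -
  have "card (dyadic p b n) \<le> card ({..2 ^ n :: nat} \<times> {..2 ^ n :: nat})"
    unfolding dyadic_def by (rule card_image_le) simp
  then show ?thesis by (simp add: power2_eq_square)
qed

lemma finite_links: "finite (links p b n)"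
  by (rule finite_subset[of _ "dyadic p b n \<times> dyadic p b (Suc n)"]) (auto simp: links_def finite_dyadic)

lemma card_links: "card (links p b n) \<le> 64 * 16 ^ n"
proof -
  have "card (links p b n) \<le> card (dyadic p b n \<times> dyadic p b (Suc n))"
    by (rule card_mono) (auto simp: links_def finite_dyadic)
  also have "\<dots> \<le> (2 ^ n + 1)\<^sup>2 * (2 ^ Suc n + 1)\<^sup>2"
    unfolding card_cartesian_product by (intro mult_mono card_dyadic) auto
  also have "\<dots> \<le> (2 * 2 ^ n)\<^sup>2 * (4 * 2 ^ n)\<^sup>2"
  proof (intro mult_mono power_mono)
    have "(1 :: nat) \<le> 2 ^ n" by simp
    then show "(2 :: nat) ^ n + 1 \<le> 2 * 2 ^ n" "(2 :: nat) ^ Suc n + 1 \<le> 4 * 2 ^ n" by auto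
  qed auto
  also have "\<dots> = 64 * ((2 ^ n)\<^sup>2 * (2 ^ n)\<^sup>2)" by (simp add: power_mult_distrib)
  also have "((2 :: nat) ^ n)\<^sup>2 * (2 ^ n)\<^sup>2 = 16 ^ n"
    unfolding power_mult_distrib[symmetric] by (simp add: power2_eq_square power_mult_distrib[symmetric])
  finally show ?thesis .
qed

lemma dyadic_subset_cell:
  assumes "0 \<le> fst b" "0 \<le> snd b"
  shows "dyadic p b n \<subseteq> cell p b"
proof -
  have "c * (real k / 2 ^ n) \<le> c" if "0 \<le> c" "k \<le> 2 ^ n" for c :: real and k
  proof -
    have "real k \<le> 2 ^ n" using that(2) by (metis of_nat_le_iff of_nat_numeral of_nat_power)
    then have "c * (real k / 2 ^ n) \<le> c * 1" using that(1) by (intro mult_left_mono) auto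
    then show ?thesis by simp
  qed
  then show ?thesis using assms by (auto simp: dyadic_def cell_def)
qed

text \<open>Every point of a cell is the limit of a chain of linked dyadic points.\<close>

lemma dyadic_chain:
  assumes b: "0 \<le> fst b" "0 \<le> snd b" and q: "q \<in> cell p b"
  obtains f where "\<And>n. f n \<in> dyadic p b n" "\<And>n. (f n, f (Suc n)) \<in> links p b n" "f \<longlonglongrightarrow> q"
proof -
  \<comment> \<open>on a degenerate side the quotient is 0, which is the right coordinate\<close>
  define u w where "u = (fst q - fst p) / fst b" and "w = (snd q - snd p) / snd b"
  have u: "0 \<le> u" "u \<le> 1" "fst q = fst p + fst b * u"
    using q b by (auto simp: u_def cell_def divide_le_eq)
  have w: "0 \<le> w" "w \<le> 1" "snd q = snd p + snd b * w"
    using q b by (auto simp: w_def cell_def divide_le_eq)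
  define r where "r x n = real (nat \<lfloor>2 ^ n * x\<rfloor>) / 2 ^ n" for x :: real and n :: nat
  have r: "r x n \<le> x" "x - 1 / 2 ^ n \<le> r x n" if "0 \<le> x" for x n
  proof -
    have "real (nat \<lfloor>2 ^ n * x\<rfloor>) = of_int \<lfloor>2 ^ n * x\<rfloor>" using that by simp
    then have "real (nat \<lfloor>2 ^ n * x\<rfloor>) \<le> 2 ^ n * x" "2 ^ n * x - 1 \<le> real (nat \<lfloor>2 ^ n * x\<rfloor>)" by linarith+
    then have "r x n \<le> 2 ^ n * x / 2 ^ n" "(2 ^ n * x - 1) / 2 ^ n \<le> r x n"
      unfolding r_def by (intro divide_right_mono; simp)+
    then show "r x n \<le> x" "x - 1 / 2 ^ n \<le> r x n" by (simp_all add: diff_divide_distrib)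
  qed
  have r_step: "\<bar>r x n - r x (Suc n)\<bar> \<le> 1 / 2 ^ n" if "0 \<le> x" for x n
  proof -
    have "(1 :: real) / 2 ^ Suc n \<le> 1 / 2 ^ n" by (simp add: field_simps)
    then show ?thesis using r[OF that, of n] r[OF that, of "Suc n"] by linarith
  qed
  have r_lim: "r x \<longlonglongrightarrow> x" if "0 \<le> x" for x
  proof (rule tendsto_sandwich)
    have "(\<lambda>n. x - (1 / 2) ^ n) \<longlonglongrightarrow> x - 0"
      by (intro tendsto_diff tendsto_const LIMSEQ_power_zero) simp
    then show "(\<lambda>n. x - 1 / 2 ^ n) \<longlonglongrightarrow> x" by (simp add: power_one_over)
  qed (use r[OF that] in auto)
  define f where "f n = (fst p + fst b * r u n, snd p + snd b * r w n)" for n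
  have nat_le: "nat \<lfloor>2 ^ n * x\<rfloor> \<le> 2 ^ n" if "0 \<le> x" "x \<le> 1" for x :: real and n
  proof -
    have "2 ^ n * x \<le> of_int (2 ^ n)" using that by simp
    then have "\<lfloor>2 ^ n * x\<rfloor> \<le> 2 ^ n" by (metis floor_mono floor_of_int)
    then show ?thesis by (simp add: nat_le_iff)
  qed
  show ?thesis
  proof (rule that)
    show f_dy: "f n \<in> dyadic p b n" for n
      unfolding dyadic_def f_def r_def using nat_le[of u n] nat_le[of w n] u w
      by (intro image_eqI[of _ _ "(nat \<lfloor>2 ^ n * u\<rfloor>, nat \<lfloor>2 ^ n * w\<rfloor>)"]) auto
    show "(f n, f (Suc n)) \<in> links p b n" for n
    proof -
      have "\<bar>c * r x n - c * r x (Suc n)\<bar> \<le> c / 2 ^ n" if "0 \<le> c" "0 \<le> x" for c x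
      proof -
        have "\<bar>c * r x n - c * r x (Suc n)\<bar> = c * \<bar>r x n - r x (Suc n)\<bar>"
          using that(1) by (simp add: right_diff_distrib[symmetric] abs_mult)
        also have "\<dots> \<le> c * (1 / 2 ^ n)" using that r_step by (intro mult_left_mono) auto
        finally show ?thesis by simp
      qed
      then have "\<bar>fst (f n) - fst (f (Suc n))\<bar> \<le> fst b / 2 ^ n" "\<bar>snd (f n) - snd (f (Suc n))\<bar> \<le> snd b / 2 ^ n"
        using b u w by (auto simp: f_def)
      then show ?thesis using f_dy by (simp add: links_def)
    qed
    have "(\<lambda>n. (fst p + fst b * r u n, snd p + snd b * r w n)) \<longlonglongrightarrow> (fst p + fst b * u, snd p + snd b * w)"
      by (intro tendsto_intros r_lim u w)
    moreover have "(fst p + fst b * u, snd p + snd b * w) = q" using u(3) w(3) by (metis prod.collapse)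
    ultimately show "f \<longlonglongrightarrow> q" unfolding f_def[abs_def] by simp
  qed
qed

text \<open>If \<open>y\<close> comes within \<open>\<epsilon>\<close> of \<open>z\<close> at the end of a chain, then it is already within \<open>2\<epsilon>\<close> at the
  start, or else, for the \<open>k\<close> that tells how far from \<open>z\<close> it starts, some link of the chain, of
  level \<open>n\<close> say, is longer than the \<open>n\<close>-th part of \<open>(k + 1) \<epsilon>\<close>, where the parts \<open>(1 - \<beta>) \<beta> ^ n\<close> sum up to 1.\<close>

lemma chain_dichotomy:
  fixes y :: "nat \<Rightarrow> real ^ 'd" and z y' :: "real ^ 'd"
  assumes \<epsilon>: "0 < \<epsilon>" and \<beta>: "0 < \<beta>" "\<beta> < 1"
    and lim: "y \<longlonglongrightarrow> y'" and near: "norm (y' - z) < \<epsilon>"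
  shows "(\<forall>i. \<bar>y 0 $ i - z $ i\<bar> \<le> 2 * \<epsilon>) \<or>
    (\<exists>k n j. (\<forall>i. \<bar>y 0 $ i - z $ i\<bar> \<le> (real k + 3) * \<epsilon>) \<and>
       (real k + 1) * \<epsilon> * ((1 - \<beta>) * \<beta> ^ n) < \<bar>y n $ j - y (Suc n) $ j\<bar>)"
proof (rule disjCI)
  assume "\<not> (\<exists>k n j. (\<forall>i. \<bar>y 0 $ i - z $ i\<bar> \<le> (real k + 3) * \<epsilon>) \<and>
       (real k + 1) * \<epsilon> * ((1 - \<beta>) * \<beta> ^ n) < \<bar>y n $ j - y (Suc n) $ j\<bar>)"
  then have short: "\<bar>y n $ j - y (Suc n) $ j\<bar> \<le> (real k + 1) * \<epsilon> * ((1 - \<beta>) * \<beta> ^ n)"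
    if "\<And>i. \<bar>y 0 $ i - z $ i\<bar> \<le> (real k + 3) * \<epsilon>" for k n j
    using that by (meson not_le)
  define D where "D = Max (range (\<lambda>i. \<bar>y 0 $ i - z $ i\<bar>))"
  have D: "\<bar>y 0 $ i - z $ i\<bar> \<le> D" for i unfolding D_def by (rule Max_ge) auto
  have "D \<in> range (\<lambda>i. \<bar>y 0 $ i - z $ i\<bar>)" unfolding D_def by (rule Max_in) auto
  then obtain j where j: "D = \<bar>y 0 $ j - z $ j\<bar>" by auto
  have "D \<le> 2 * \<epsilon>"
  proof (rule ccontr)
    assume "\<not> D \<le> 2 * \<epsilon>"
    then have big: "2 < D / \<epsilon>" using \<epsilon> by (simp add: field_simps)
    define k where "k = nat (\<lceil>D / \<epsilon>\<rceil> - 3)"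
    have k: "real k + 2 < D / \<epsilon>" "D / \<epsilon> \<le> real k + 3"
    proof -
      have "3 \<le> \<lceil>D / \<epsilon>\<rceil>" using big by linarith
      then have "real k = of_int \<lceil>D / \<epsilon>\<rceil> - 3" by (simp add: k_def)
      then show "real k + 2 < D / \<epsilon>" "D / \<epsilon> \<le> real k + 3" by linarith+
    qed
    then have k': "(real k + 2) * \<epsilon> < D" "D \<le> (real k + 3) * \<epsilon>" using \<epsilon> by (auto simp: field_simps)
    have s: "\<bar>y n $ j - y (Suc n) $ j\<bar> \<le> (real k + 1) * \<epsilon> * ((1 - \<beta>) * \<beta> ^ n)" for n
      using order_trans[OF D k'(2)] by (rule short)
    have "\<bar>y 0 $ j - y n $ j\<bar> \<le> (real k + 1) * \<epsilon> * (1 - \<beta> ^ n)" for n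
    proof (induction n)
      case (Suc n)
      have "\<bar>y 0 $ j - y (Suc n) $ j\<bar> \<le> \<bar>y 0 $ j - y n $ j\<bar> + \<bar>y n $ j - y (Suc n) $ j\<bar>" by linarith
      also have "\<dots> \<le> (real k + 1) * \<epsilon> * (1 - \<beta> ^ n) + (real k + 1) * \<epsilon> * ((1 - \<beta>) * \<beta> ^ n)"
        using Suc s by (rule add_mono)
      also have "\<dots> = (real k + 1) * \<epsilon> * (1 - \<beta> ^ Suc n)" by (simp add: algebra_simps)
      finally show ?case .
    qed simp
    moreover have "(real k + 1) * \<epsilon> * (1 - \<beta> ^ n) \<le> (real k + 1) * \<epsilon>" for n
      using \<beta> \<epsilon> by (intro mult_left_le) auto
    ultimately have "\<bar>y 0 $ j - y n $ j\<bar> \<le> (real k + 1) * \<epsilon>" for n by (meson order_trans)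
    moreover have "(\<lambda>n. \<bar>y 0 $ j - y n $ j\<bar>) \<longlonglongrightarrow> \<bar>y 0 $ j - y' $ j\<bar>"
      by (intro tendsto_intros lim)
    ultimately have "\<bar>y 0 $ j - y' $ j\<bar> \<le> (real k + 1) * \<epsilon>"
      by (intro LIMSEQ_le_const2) auto
    moreover have "\<bar>y' $ j - z $ j\<bar> < \<epsilon>"
      using component_le_norm_cart[of "y' - z" j] near by simp
    ultimately show False using k'(1) j by (simp add: distrib_right)
  qed
  then show "\<forall>i. \<bar>y 0 $ i - z $ i\<bar> \<le> 2 * \<epsilon>" using D order_trans by blast
qed


subsection \<open>Hitting a small ball from a small cell\<close>

text \<open>The outer probability that \<open>v\<close> maps some point of \<open>E\<close> into the ball is at most \<open>c\<close>. With a
  measurable superset, the event itself need not be shown to be measurable.\<close>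

definition ball_hit_le ::
    "'m measure \<Rightarrow> ('p \<Rightarrow> 'm \<Rightarrow> 'b::metric_space) \<Rightarrow> 'p set \<Rightarrow> 'b \<Rightarrow> real \<Rightarrow> real \<Rightarrow> bool" where
  "ball_hit_le M v E z r c \<longleftrightarrow>
     (\<exists>U\<in>sets M. {\<omega> \<in> space M. \<exists>q\<in>E. v q \<omega> \<in> ball z r} \<subseteq> U \<and> emeasure M U \<le> ennreal c)"

lemma ball_hit_le_mono: "ball_hit_le M v E z r c \<Longrightarrow> c \<le> c' \<Longrightarrow> ball_hit_le M v E z r c'"
  unfolding ball_hit_le_def by (meson ennreal_leI order_trans)

text \<open>The constant in the bound for a cell in dimension \<open>d\<close>: \<open>c\<close> bounds the densities, \<open>\<kappa>\<close> and
  \<open>\<eta>\<close> control the variances of the links. The outer factor 4 is the number of corners, \<open>2 ^ d\<close> comes from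
  the corner being mapped close to the target, and \<open>256 * d\<close> collects the number \<open>64 * 16 ^ n\<close> of
  links, the number of components and the factor 4 of the bound for Gaussian pairs.\<close>

definition chain_const :: "nat \<Rightarrow> real \<Rightarrow> real \<Rightarrow> real \<Rightarrow> real" where
  "chain_const d c \<kappa> \<eta> =
     (let e = (1 - 2 powr (- \<eta> / 4))\<^sup>2 / (32 * \<kappa>)
      in 4 * c ^ d * (2 ^ d + 256 * real d * (\<Sum>k. (real k + 3) ^ d * exp (- e * (real k + 1)))
           * (\<Sum>n. 16 ^ n * exp (- e * (2 powr (\<eta> / 2)) ^ n))))"

lemma chain_const_nonneg:
  assumes "0 < c" "0 < \<kappa>" "0 < \<eta>"
  shows "0 \<le> chain_const d c \<kappa> \<eta>"
proof -
  define e where "e = (1 - 2 powr (- \<eta> / 4))\<^sup>2 / (32 * \<kappa>)"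
  have "2 powr (- \<eta> / 4) < 1" using assms by (simp add: powr_less_one)
  then have e: "0 < e" using assms by (simp add: e_def)
  have "0 \<le> (\<Sum>k. (real k + 3) ^ d * exp (- e * (real k + 1)))"
    by (intro suminf_nonneg summable_chain_level e) auto
  moreover have "0 \<le> (\<Sum>n. 16 ^ n * exp (- e * (2 powr (\<eta> / 2)) ^ n))"
    using assms by (intro suminf_nonneg summable_chain_edges e) auto
  ultimately show ?thesis
    unfolding chain_const_def Let_def e_def[symmetric] using assms
    by (intro mult_nonneg_nonneg add_nonneg_nonneg) auto
qed

text \<open>The tail at a link of level \<open>n\<close> with threshold \<open>(k + 1) * \<epsilon> * ((1 - \<beta>) * \<beta> ^ n)\<close> has
  exponent of order $(k+1)^2 \gamma^n$ with $\gamma = 2^{\eta/2}$, since $\beta^{2n}$ decays more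
  slowly than the variance. This product is at least the average of \<open>k + 1\<close> and
  $\gamma^n$, which separates the two sums and turns the factor 16 into 32.\<close>

lemma link_exponent:
  fixes \<kappa> \<epsilon> \<eta> :: real
  assumes "0 < \<kappa>" "0 < \<epsilon>" "0 < \<eta>"
  defines "\<beta> \<equiv> 2 powr (- \<eta> / 4)"
  defines "e \<equiv> (1 - \<beta>)\<^sup>2 / (32 * \<kappa>)"
  shows "exp (- ((real k + 1) * \<epsilon> * ((1 - \<beta>) * \<beta> ^ n))\<^sup>2 / (16 * (\<kappa> * \<epsilon>\<^sup>2 * 2 powr (- \<eta> * real n))))
    \<le> exp (- e * (real k + 1)) * exp (- e * (2 powr (\<eta> / 2)) ^ n)"
proof -
  have \<beta>: "0 < \<beta>" "\<beta> < 1" using assms by (auto simp: powr_less_one)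
  then have e: "0 < e" using assms by (simp add: e_def)
  define g where "g = (2 powr (\<eta> / 2)) ^ n"
  have g: "1 \<le> g" unfolding g_def using assms by (intro one_le_power ge_one_powr_ge_zero) auto
  have \<beta>n: "(\<beta> ^ n)\<^sup>2 / 2 powr (- \<eta> * real n) = g"
  proof -
    have pw: "(2 powr r) ^ m = 2 powr (r * real m)" for r and m :: nat
      by (subst powr_realpow[symmetric]) (simp_all add: powr_powr)
    have "(\<beta> ^ n)\<^sup>2 = 2 powr (- \<eta> / 4 * real (n * 2))"
      unfolding \<beta>_def power_mult[symmetric] by (rule pw)
    moreover have "g = 2 powr (\<eta> / 2 * real n)"
      unfolding g_def by (rule pw)
    ultimately show ?thesis by (simp add: powr_diff[symmetric] field_simps)
  qed
  define m where "m = real k + 1"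
  have m: "1 \<le> m" by (simp add: m_def)
  have "(m * \<epsilon> * (B * C))\<^sup>2 / (16 * (\<kappa> * \<epsilon>\<^sup>2 * D)) = 2 * (B\<^sup>2 / (32 * \<kappa>)) * m\<^sup>2 * (C\<^sup>2 / D)"
    if "0 < D" for B C D
    using assms(1,2) that by (simp add: power_mult_distrib field_simps)
  then have "(m * \<epsilon> * ((1 - \<beta>) * \<beta> ^ n))\<^sup>2 / (16 * (\<kappa> * \<epsilon>\<^sup>2 * 2 powr (- \<eta> * real n)))
      = 2 * e * m\<^sup>2 * ((\<beta> ^ n)\<^sup>2 / 2 powr (- \<eta> * real n))"
    unfolding e_def by simp
  also have "\<dots> = 2 * e * m\<^sup>2 * g" unfolding \<beta>n ..
  also have "\<dots> \<ge> e * (m + g)"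
  proof -
    have "0 \<le> (m - 1) * g" "0 \<le> m * (g - 1)" "0 \<le> m * (m - 1) * g" using m g by (auto intro!: mult_nonneg_nonneg)
    then have "m + g \<le> 2 * m\<^sup>2 * g" by (simp add: power2_eq_square algebra_simps)
    then have "e * (m + g) \<le> e * (2 * m\<^sup>2 * g)" using e by (intro mult_left_mono) auto
    then show ?thesis by (simp add: mult_ac)
  qed
  finally show ?thesis by (simp add: m_def g_def exp_add[symmetric] distrib_left)
qed

text \<open>Hypotheses \<open>point\<close> and \<open>link\<close> are what joint Gaussianity gives for a value of the process
  and for a value together with an increment of level \<open>n\<close>, whose variance is at most
  $\kappa\epsilon^2 2^{-\eta n}$.\<close>

lemma (in prob_space) hit_ball_from_cell:
  fixes V :: "real \<times> real \<Rightarrow> 'a \<Rightarrow> real ^ 'd"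
  assumes \<epsilon>: "0 < \<epsilon>" and c: "0 < c" and \<kappa>: "0 < \<kappa>" and \<eta>: "0 < \<eta>"
    and b: "0 \<le> fst b" "0 \<le> snd b"
    and meas[measurable]: "\<And>q i. q \<in> cell p b \<Longrightarrow> (\<lambda>\<omega>. V q \<omega> $ i) \<in> borel_measurable M"
    and cont: "\<And>\<omega>. \<omega> \<in> space M \<Longrightarrow> continuous_on (cell p b) (\<lambda>q. V q \<omega>)"
    and point: "\<And>q s. q \<in> cell p b \<Longrightarrow> 0 < s \<Longrightarrow>
      prob {\<omega> \<in> space M. \<forall>i. \<bar>V q \<omega> $ i - z $ i\<bar> \<le> s} \<le> (c * s) ^ CARD('d)"
    and link: "\<And>q r r' n s u j. q \<in> cell p b \<Longrightarrow> r \<in> cell p b \<Longrightarrow> r' \<in> cell p b \<Longrightarrow> 0 < s \<Longrightarrow> 0 \<le> u \<Longrightarrow>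
      \<bar>fst r - fst r'\<bar> \<le> fst b / 2 ^ n \<Longrightarrow> \<bar>snd r - snd r'\<bar> \<le> snd b / 2 ^ n \<Longrightarrow>
      prob {\<omega> \<in> space M. (\<forall>i. \<bar>V q \<omega> $ i - z $ i\<bar> \<le> s) \<and> u < \<bar>V r \<omega> $ j - V r' \<omega> $ j\<bar>}
        \<le> 4 * (c * s) ^ CARD('d) * exp (- u\<^sup>2 / (16 * (\<kappa> * \<epsilon>\<^sup>2 * 2 powr (- \<eta> * real n))))"
  shows "ball_hit_le M V (cell p b) z \<epsilon> (chain_const CARD('d) c \<kappa> \<eta> * \<epsilon> ^ CARD('d))"
proof -
  let ?d = "CARD('d)"
  define \<beta> where "\<beta> = 2 powr (- \<eta> / 4)"
  have \<beta>: "0 < \<beta>" "\<beta> < 1" using \<eta> by (auto simp: \<beta>_def powr_less_one)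
  define e where "e = (1 - \<beta>)\<^sup>2 / (32 * \<kappa>)"
  have e: "0 < e" using \<beta> \<kappa> by (simp add: e_def)
  define near where "near q s = {\<omega> \<in> space M. \<forall>i. \<bar>V q \<omega> $ i - z $ i\<bar> \<le> s}" for q s
  define long where "long q k n l j = {\<omega> \<in> space M. (\<forall>i. \<bar>V q \<omega> $ i - z $ i\<bar> \<le> (real k + 3) * \<epsilon>) \<and>
    (real k + 1) * \<epsilon> * ((1 - \<beta>) * \<beta> ^ n) < \<bar>V (fst l) \<omega> $ j - V (snd l) \<omega> $ j\<bar>}"
    for q l and k n :: nat and j :: 'd
  define L where "L q k n = (\<Union>(l, j)\<in>links p b n \<times> UNIV. long q k n l j)" for q k n
  define A where "A q = near q (2 * \<epsilon>) \<union> (\<Union>k. \<Union>n. L q k n)" for q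
  define U where "U = (\<Union>q\<in>dyadic p b 0. A q)"
  have in_cell: "q \<in> cell p b" if "q \<in> dyadic p b n" for q n
    using subsetD[OF dyadic_subset_cell[OF b] that] .
  have l_cell: "fst l \<in> cell p b" "snd l \<in> cell p b" if "l \<in> links p b n" for l n
    using that in_cell by (auto simp: links_def)
  have near_meas: "near q s \<in> sets M" if "q \<in> cell p b" for q s
    unfolding near_def using meas[OF that] by measurable
  have long_meas: "long q k n l j \<in> sets M" if "q \<in> cell p b" "l \<in> links p b n" for q k n l j
  proof -
    note [measurable] = meas[OF that(1)] meas[OF l_cell(1)[OF that(2)]] meas[OF l_cell(2)[OF that(2)]]
    show ?thesis unfolding long_def by measurable
  qed
  have L_meas: "L q k n \<in> sets M" if "q \<in> cell p b" for q k n
    unfolding L_def using long_meas[OF that] finite_links by (intro sets.finite_UN) auto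
  have A_meas: "A q \<in> sets M" if "q \<in> cell p b" for q
    unfolding A_def using near_meas[OF that] L_meas[OF that] by (intro sets.Un sets.countable_UN) auto
  have U_meas: "U \<in> sets M"
    unfolding U_def using A_meas in_cell finite_dyadic by (intro sets.finite_UN) auto

  have sub: "{\<omega> \<in> space M. \<exists>q\<in>cell p b. V q \<omega> \<in> ball z \<epsilon>} \<subseteq> U"
  proof safe
    fix \<omega> q1 q2 assume \<omega>: "\<omega> \<in> space M" and q: "(q1, q2) \<in> cell p b" and hit: "V (q1, q2) \<omega> \<in> ball z \<epsilon>"
    obtain f where f: "\<And>n. f n \<in> dyadic p b n" "\<And>n. (f n, f (Suc n)) \<in> links p b n" "f \<longlonglongrightarrow> (q1, q2)"
      using dyadic_chain[OF b q] by blast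
    have "(\<lambda>n. V (f n) \<omega>) \<longlonglongrightarrow> V (q1, q2) \<omega>"
      by (rule continuous_on_tendsto_compose[OF cont[OF \<omega>] f(3) q]) (simp add: in_cell[OF f(1)])
    from chain_dichotomy[OF \<epsilon> \<beta> this, of z] hit
    consider "\<forall>i. \<bar>V (f 0) \<omega> $ i - z $ i\<bar> \<le> 2 * \<epsilon>"
      | k n j where "\<forall>i. \<bar>V (f 0) \<omega> $ i - z $ i\<bar> \<le> (real k + 3) * \<epsilon>"
         "(real k + 1) * \<epsilon> * ((1 - \<beta>) * \<beta> ^ n) < \<bar>V (f n) \<omega> $ j - V (f (Suc n)) \<omega> $ j\<bar>"
      by (auto simp: dist_norm norm_minus_commute)
    then have "\<omega> \<in> A (f 0)"
    proof cases
      case 1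
      then show ?thesis using \<omega> by (auto simp: A_def near_def)
    next
      case (2 k n j)
      then have "\<omega> \<in> long (f 0) k n (f n, f (Suc n)) j" using \<omega> by (auto simp: long_def)
      then have "\<omega> \<in> L (f 0) k n" using f(2)[of n] by (auto simp: L_def)
      then show ?thesis by (auto simp: A_def)
    qed
    then show "\<omega> \<in> U" using f(1)[of 0] by (auto simp: U_def)
  qed

  define x where "x k = (real k + 3) ^ ?d * exp (- e * (real k + 1))" for k
  define y where "y n = 16 ^ n * exp (- e * (2 powr (\<eta> / 2)) ^ n)" for n :: nat
  have x: "summable x" "\<And>k. 0 \<le> x k" unfolding x_def using summable_chain_level[OF e] by auto
  have y: "summable y" "\<And>n. 0 \<le> y n" unfolding y_def using summable_chain_edges[OF e, of "2 powr (\<eta> / 2)"] \<eta> by auto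
  define w where "w = 256 * real ?d * (c * \<epsilon>) ^ ?d"
  have w: "0 \<le> w" using c \<epsilon> by (simp add: w_def)
  have long_le: "emeasure M (long q k n l j) \<le> ennreal (4 * (c * \<epsilon>) ^ ?d * x k * exp (- e * (2 powr (\<eta> / 2)) ^ n))"
    if "q \<in> cell p b" "l \<in> links p b n" for q k n l j
  proof -
    have "prob (long q k n l j) \<le> 4 * (c * ((real k + 3) * \<epsilon>)) ^ ?d
       * exp (- ((real k + 1) * \<epsilon> * ((1 - \<beta>) * \<beta> ^ n))\<^sup>2 / (16 * (\<kappa> * \<epsilon>\<^sup>2 * 2 powr (- \<eta> * real n))))"
      unfolding long_def using that l_cell[OF that(2)] \<epsilon> \<beta>
      by (intro link) (auto simp: links_def)
    also have "\<dots> \<le> 4 * (c * ((real k + 3) * \<epsilon>)) ^ ?d * (exp (- e * (real k + 1)) * exp (- e * (2 powr (\<eta> / 2)) ^ n))"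
      unfolding \<beta>_def e_def using c \<epsilon> by (intro mult_left_mono link_exponent \<kappa> \<epsilon> \<eta>) auto
    also have "\<dots> = 4 * (c * \<epsilon>) ^ ?d * x k * exp (- e * (2 powr (\<eta> / 2)) ^ n)"
      by (simp add: x_def power_mult_distrib)
    finally show ?thesis unfolding emeasure_eq_measure by (rule ennreal_leI)
  qed
  have L_le: "emeasure M (L q k n) \<le> ennreal w * (ennreal (x k) * ennreal (y n))" if q: "q \<in> cell p b" for q k n
  proof -
    let ?I = "links p b n \<times> (UNIV :: 'd set)" and ?m = "4 * (c * \<epsilon>) ^ ?d * x k * exp (- e * (2 powr (\<eta> / 2)) ^ n)"
    have m: "0 \<le> ?m" using x(2) c \<epsilon> by simp
    have "emeasure M (L q k n) \<le> (\<Sum>i\<in>?I. emeasure M (case i of (l, j) \<Rightarrow> long q k n l j))"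
      unfolding L_def using long_meas[OF q] finite_links by (intro emeasure_subadditive_finite) auto
    also have "\<dots> \<le> (\<Sum>i\<in>?I. ennreal ?m)"
      using long_le[OF q] by (intro sum_mono) auto
    also have "\<dots> = ennreal (real (card ?I) * ?m)" using m by (simp add: ennreal_mult ennreal_of_nat_eq_real_of_nat)
    also have "\<dots> \<le> ennreal (real (64 * 16 ^ n * ?d) * ?m)"
    proof (intro ennreal_leI mult_right_mono m)
      have "card ?I \<le> 64 * 16 ^ n * ?d"
        unfolding card_cartesian_product by (intro mult_right_mono card_links) simp
      then show "real (card ?I) \<le> real (64 * 16 ^ n * ?d)" by (simp only: of_nat_le_iff)
    qed
    also have "real (64 * 16 ^ n * ?d) * ?m = w * (x k * y n)" by (simp add: w_def y_def)
    finally show ?thesis using w x y by (simp add: ennreal_mult)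
  qed
  have A_le: "emeasure M (A q) \<le> ennreal ((c * (2 * \<epsilon>)) ^ ?d + w * (suminf x * suminf y))" if q: "q \<in> cell p b" for q
  proof -
    have "emeasure M (\<Union>k. \<Union>n. L q k n) \<le> (\<Sum>k. emeasure M (\<Union>n. L q k n))"
      using L_meas[OF q] by (intro emeasure_subadditive_countably) auto
    also have "\<dots> \<le> (\<Sum>k. \<Sum>n. emeasure M (L q k n))"
      using L_meas[OF q] by (intro suminf_le emeasure_subadditive_countably) auto
    also have "\<dots> \<le> (\<Sum>k. \<Sum>n. ennreal w * (ennreal (x k) * ennreal (y n)))"
      using L_le[OF q] by (intro suminf_le) auto
    also have "\<dots> = ennreal w * ((\<Sum>k. ennreal (x k)) * (\<Sum>n. ennreal (y n)))"
      by (simp add: ennreal_suminf_cmult ennreal_suminf_multc)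
    also have "\<dots> = ennreal (w * (suminf x * suminf y))"
      using x y w by (simp add: suminf_ennreal2 ennreal_mult suminf_nonneg)
    finally have "emeasure M (\<Union>k. \<Union>n. L q k n) \<le> ennreal (w * (suminf x * suminf y))" .
    moreover have "emeasure M (near q (2 * \<epsilon>)) \<le> ennreal ((c * (2 * \<epsilon>)) ^ ?d)"
      unfolding near_def emeasure_eq_measure using point[OF q, of "2 * \<epsilon>"] \<epsilon> by (intro ennreal_leI) auto
    moreover have "emeasure M (A q) \<le> emeasure M (near q (2 * \<epsilon>)) + emeasure M (\<Union>k. \<Union>n. L q k n)"
      unfolding A_def using near_meas[OF q] L_meas[OF q] by (intro emeasure_subadditive) auto
    ultimately have "emeasure M (A q) \<le> ennreal ((c * (2 * \<epsilon>)) ^ ?d) + ennreal (w * (suminf x * suminf y))"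
      by (meson add_mono order_trans)
    then show ?thesis using w x y c \<epsilon> by (simp add: suminf_nonneg)
  qed
  have "emeasure M U \<le> (\<Sum>q\<in>dyadic p b 0. emeasure M (A q))"
    unfolding U_def using A_meas in_cell finite_dyadic by (intro emeasure_subadditive_finite) auto
  also have "\<dots> \<le> (\<Sum>q\<in>dyadic p b 0. ennreal ((c * (2 * \<epsilon>)) ^ ?d + w * (suminf x * suminf y)))"
    using A_le in_cell by (intro sum_mono) auto
  also have "\<dots> = of_nat (card (dyadic p b 0)) * ennreal ((c * (2 * \<epsilon>)) ^ ?d + w * (suminf x * suminf y))"
    by simp
  also have "\<dots> \<le> of_nat 4 * ennreal ((c * (2 * \<epsilon>)) ^ ?d + w * (suminf x * suminf y))"
  proof (intro mult_right_mono)
    have "card (dyadic p b 0) \<le> 4"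
      using card_dyadic[of p b 0] by (simp add: power2_eq_square)
    then show "of_nat (card (dyadic p b 0)) \<le> (of_nat 4 :: ennreal)" by (simp only: of_nat_mono)
  qed simp
  also have "\<dots> = ennreal (chain_const ?d c \<kappa> \<eta> * \<epsilon> ^ ?d)"
  proof -
    have "chain_const ?d c \<kappa> \<eta> = 4 * c ^ ?d * (2 ^ ?d + 256 * real ?d * suminf x * suminf y)"
      unfolding chain_const_def Let_def x_def[abs_def] y_def[abs_def] e_def \<beta>_def ..
    then have "chain_const ?d c \<kappa> \<eta> * \<epsilon> ^ ?d = 4 * ((c * (2 * \<epsilon>)) ^ ?d + w * (suminf x * suminf y))"
      by (simp add: w_def power_mult_distrib algebra_simps)
    then show ?thesis using w x y c \<epsilon> by (simp add: ennreal_mult suminf_nonneg)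
  qed
  finally show ?thesis unfolding ball_hit_le_def using U_meas sub by blast
qed

section \<open>Small balls for the heat equation\<close>

lemma nn_integral_strip_heat_integrand:
  assumes "t \<le> T"
  shows "(\<integral>\<^sup>+q. ennreal ((heat_integrand \<alpha> (t, x) q)\<^sup>2) \<partial>strip T) = (\<integral>\<^sup>+q. ennreal ((heat_integrand \<alpha> (t, x) q)\<^sup>2) \<partial>lborel)"
proof -
  have "(\<integral>\<^sup>+q. ennreal ((heat_integrand \<alpha> (t, x) q)\<^sup>2) \<partial>strip T)
      = (\<integral>\<^sup>+q\<in>{0..T} \<times> UNIV. ennreal ((heat_integrand \<alpha> (t, x) q)\<^sup>2) \<partial>lborel)"
    by (rule nn_integral_strip) measurable
  also have "\<dots> = (\<integral>\<^sup>+q. ennreal ((heat_integrand \<alpha> (t, x) q)\<^sup>2) \<partial>lborel)"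
    using assms by (intro nn_integral_cong) (auto simp: heat_integrand_def indicator_def)
  finally show ?thesis .
qed

lemma mild_solution_wiener:
  assumes "mild_solution \<alpha> T M W v" "0 \<le> t" "t \<le> T"
  shows "has_wiener_integral T M (W i) (heat_integrand \<alpha> (t, x)) (\<lambda>\<omega>. v (t, x) \<omega> $ i)"
  using assms unfolding mild_solution_def heat_integrand_def by auto

lemma mild_solution_increment_wiener:
  assumes W: "white_noise T M (W i)" and v: "mild_solution \<alpha> T M W v"
    and t: "0 \<le> t" "t \<le> T" "0 \<le> s" "s \<le> T"
  shows "has_wiener_integral T M (W i) (\<lambda>q. heat_integrand \<alpha> (t, x) q - heat_integrand \<alpha> (s, y) q)
    (\<lambda>\<omega>. v (t, x) \<omega> $ i - v (s, y) \<omega> $ i)"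
  using has_wiener_integral_lincomb[OF W mild_solution_wiener[OF v t(1,2)] mild_solution_wiener[OF v t(3,4)], of 1 x "-1" y]
  by simp

context prob_space
begin

lemma heat_variance_pos:
  assumes \<alpha>: "1 < \<alpha>" and a: "0 < a" "a \<le> T"
    and W: "white_noise T M (W i)" and v: "mild_solution \<alpha> T M W v"
  shows "0 < (\<integral>q. (heat_integrand \<alpha> (a, 0) q)\<^sup>2 \<partial>strip T)"
    and "a \<le> t \<Longrightarrow> t \<le> T \<Longrightarrow>
      (\<integral>q. (heat_integrand \<alpha> (a, 0) q)\<^sup>2 \<partial>strip T) \<le> (\<integral>q. (heat_integrand \<alpha> (t, x) q)\<^sup>2 \<partial>strip T)"
proof -
  have eq: "ennreal (\<integral>q. (heat_integrand \<alpha> (t, x) q)\<^sup>2 \<partial>strip T) = (\<integral>\<^sup>+q. ennreal ((heat_integrand \<alpha> (t, x) q)\<^sup>2) \<partial>lborel)"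
    if "a \<le> t" "t \<le> T" for t x
  proof -
    have "integrable (strip T) (\<lambda>q. (heat_integrand \<alpha> (t, x) q)\<^sup>2)"
      using that a by (intro wiener_integral_gaussian(2)[OF W mild_solution_wiener[OF v]]) auto
    then have "ennreal (\<integral>q. (heat_integrand \<alpha> (t, x) q)\<^sup>2 \<partial>strip T) = (\<integral>\<^sup>+q. ennreal ((heat_integrand \<alpha> (t, x) q)\<^sup>2) \<partial>strip T)"
      by (intro nn_integral_eq_integral[symmetric]) auto
    then show ?thesis using that nn_integral_strip_heat_integrand by simp
  qed
  show "0 < (\<integral>q. (heat_integrand \<alpha> (a, 0) q)\<^sup>2 \<partial>strip T)"
    using nn_integral_heat_integrand_pos[OF \<alpha> a(1)] eq[of a 0] a by (metis ennreal_less_zero_iff order_refl)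
  show "(\<integral>q. (heat_integrand \<alpha> (a, 0) q)\<^sup>2 \<partial>strip T) \<le> (\<integral>q. (heat_integrand \<alpha> (t, x) q)\<^sup>2 \<partial>strip T)"
    if "a \<le> t" "t \<le> T"
  proof -
    have "ennreal (\<integral>q. (heat_integrand \<alpha> (a, 0) q)\<^sup>2 \<partial>strip T) \<le> ennreal (\<integral>q. (heat_integrand \<alpha> (t, x) q)\<^sup>2 \<partial>strip T)"
      using nn_integral_heat_integrand_ge[OF that(1), of \<alpha> x] eq[of a 0] eq[OF that] a by simp
    then show ?thesis by (simp add: integral_nonneg_AE)
  qed
qed

lemma heat_increment_variance:
  assumes \<alpha>: "1 < \<alpha>" "\<alpha> \<le> 2"
    and W: "white_noise T M (W i)" and v: "mild_solution \<alpha> T M W v"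
    and t: "0 \<le> t" "t \<le> T" "0 \<le> s" "s \<le> T"
  shows "(\<integral>q. (heat_integrand \<alpha> (t, x) q - heat_integrand \<alpha> (s, y) q)\<^sup>2 \<partial>strip T)
    \<le> (2 + 2 / (\<alpha> - 1)) * (\<bar>t - s\<bar> powr (1 - 1 / \<alpha>) + \<bar>x - y\<bar> powr (\<alpha> - 1))"
proof -
  let ?g = "\<lambda>q. heat_integrand \<alpha> (t, x) q - heat_integrand \<alpha> (s, y) q"
  have "integrable (strip T) (\<lambda>q. (?g q)\<^sup>2)"
    by (rule wiener_integral_gaussian(2)[OF W mild_solution_increment_wiener[OF W v t]])
  then have "ennreal (\<integral>q. (?g q)\<^sup>2 \<partial>strip T) = (\<integral>\<^sup>+q. ennreal ((?g q)\<^sup>2) \<partial>strip T)"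
    by (intro nn_integral_eq_integral[symmetric]) auto
  also have "\<dots> = (\<integral>\<^sup>+q\<in>{0..T} \<times> UNIV. ennreal ((?g q)\<^sup>2) \<partial>lborel)"
    by (rule nn_integral_strip) measurable
  also have "\<dots> \<le> (\<integral>\<^sup>+q. ennreal ((?g q)\<^sup>2) \<partial>lborel)"
    by (intro nn_integral_mono) (auto simp: indicator_def)
  also have "\<dots> \<le> ennreal ((2 + 2 / (\<alpha> - 1)) * (\<bar>t - s\<bar> powr (1 - 1 / \<alpha>) + \<bar>x - y\<bar> powr (\<alpha> - 1)))"
    by (rule nn_integral_heat_integrand_diff[OF \<alpha>])
  finally show ?thesis
    using \<alpha> by (subst (asm) ennreal_le_iff) (auto intro!: mult_nonneg_nonneg add_nonneg_nonneg)
qed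

text \<open>On dyadic level \<open>n\<close> the decay in time, with exponent $1 - 1/\alpha$, is slower than the one in
  space, with exponent \<open>\<alpha> - 1\<close>, and determines the sum.\<close>

lemma link_variance:
  fixes \<alpha> \<epsilon> :: real
  assumes \<alpha>: "1 < \<alpha>" and \<epsilon>: "0 < \<epsilon>"
    and \<tau>: "0 \<le> \<tau>" "\<tau> \<le> \<epsilon> powr (2 * \<alpha> / (\<alpha> - 1)) / 2 ^ n"
    and l: "0 \<le> l" "l \<le> \<epsilon> powr (2 / (\<alpha> - 1)) / 2 ^ n"
  shows "\<tau> powr (1 - 1 / \<alpha>) + l powr (\<alpha> - 1) \<le> 2 * (\<epsilon>\<^sup>2 * 2 powr (- (1 - 1 / \<alpha>) * real n))"
proof -
  have two: "(1 / 2 ^ n) powr r = 2 powr (- r * real n)" for r :: real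
  proof -
    have "1 / 2 ^ n = 2 powr (- real n)" by (simp add: powr_minus powr_realpow divide_inverse)
    then show ?thesis by (simp add: powr_powr mult.commute)
  qed
  have e2: "\<epsilon> powr 2 = \<epsilon>\<^sup>2" using \<epsilon> by (simp add: powr_numeral)
  have "\<tau> powr (1 - 1 / \<alpha>) \<le> (\<epsilon> powr (2 * \<alpha> / (\<alpha> - 1)) * (1 / 2 ^ n)) powr (1 - 1 / \<alpha>)"
    using \<tau> \<alpha> by (intro powr_mono2) auto
  also have "\<dots> = \<epsilon> powr (2 * \<alpha> / (\<alpha> - 1) * (1 - 1 / \<alpha>)) * 2 powr (- (1 - 1 / \<alpha>) * real n)"
    unfolding powr_mult two powr_powr ..
  also have "2 * \<alpha> / (\<alpha> - 1) * (1 - 1 / \<alpha>) = 2"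
  proof -
    have "1 - 1 / \<alpha> = (\<alpha> - 1) / \<alpha>" using \<alpha> by (simp add: field_simps)
    then show ?thesis using \<alpha> by simp
  qed
  finally have 1: "\<tau> powr (1 - 1 / \<alpha>) \<le> \<epsilon>\<^sup>2 * 2 powr (- (1 - 1 / \<alpha>) * real n)" unfolding e2 .
  have "l powr (\<alpha> - 1) \<le> (\<epsilon> powr (2 / (\<alpha> - 1)) * (1 / 2 ^ n)) powr (\<alpha> - 1)"
    using l \<alpha> by (intro powr_mono2) auto
  also have "\<dots> = \<epsilon> powr (2 / (\<alpha> - 1) * (\<alpha> - 1)) * 2 powr (- (\<alpha> - 1) * real n)"
    unfolding powr_mult two powr_powr ..
  also have "2 / (\<alpha> - 1) * (\<alpha> - 1) = 2"
    using \<alpha> by (subst nonzero_eq_divide_eq[symmetric]) simp_all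
  also have "2 powr (- (\<alpha> - 1) * real n) \<le> 2 powr (- (1 - 1 / \<alpha>) * real n)"
  proof (intro powr_mono mult_right_mono)
    have "0 \<le> (\<alpha> - 1) * (1 - 1 / \<alpha>)" using \<alpha> by (intro mult_nonneg_nonneg) auto
    also have "(\<alpha> - 1) * (1 - 1 / \<alpha>) = \<alpha> - 1 - (1 - 1 / \<alpha>)" using \<alpha> by (simp add: field_simps)
    finally show "- (\<alpha> - 1) \<le> - (1 - 1 / \<alpha>)" by simp
  qed auto
  finally have "l powr (\<alpha> - 1) \<le> \<epsilon>\<^sup>2 * 2 powr (- (1 - 1 / \<alpha>) * real n)"
    unfolding e2 by (simp add: mult_left_mono)
  with 1 show ?thesis by simp
qed

text \<open>If the sides of a cell are adapted to the Hoelder exponents of the solution, then its image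
  meets a ball of radius \<open>\<epsilon>\<close> with probability of the same order as the image of a single point
  does.\<close>

lemma heat_hit_ball_from_cell:
  fixes W :: "'d :: finite \<Rightarrow> (real \<times> real) set \<Rightarrow> 'a \<Rightarrow> real" and v :: "real \<times> real \<Rightarrow> 'a \<Rightarrow> real ^ 'd"
  assumes \<alpha>: "1 < \<alpha>" "\<alpha> \<le> 2" and W: "indep_white_noises T M W" and v: "mild_solution \<alpha> T M W v"
    and a: "0 < a" "a \<le> T"
  shows "\<exists>C\<ge>0. \<forall>p b \<epsilon> z. 0 < \<epsilon> \<longrightarrow> a \<le> fst p \<longrightarrow> fst p + fst b \<le> T \<longrightarrow>
    0 \<le> fst b \<longrightarrow> fst b \<le> \<epsilon> powr (2 * \<alpha> / (\<alpha> - 1)) \<longrightarrow> 0 \<le> snd b \<longrightarrow> snd b \<le> \<epsilon> powr (2 / (\<alpha> - 1)) \<longrightarrow>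
    ball_hit_le M v (cell p b) z \<epsilon> (C * \<epsilon> ^ CARD('d))"
proof -
  have Wi: "white_noise T M (W i)" for i using W by (simp add: indep_white_noises_def)
  define v0 where "v0 = (\<integral>q. (heat_integrand \<alpha> (a, 0) q)\<^sup>2 \<partial>strip T)"
  have v0: "0 < v0" unfolding v0_def by (rule heat_variance_pos(1)[OF \<alpha>(1) a Wi v])
  define K where "K = 2 + 2 / (\<alpha> - 1)"
  have K: "0 < K" using \<alpha> by (simp add: K_def add_pos_nonneg)
  define \<eta> where "\<eta> = 1 - 1 / \<alpha>"
  have \<eta>: "0 < \<eta>" using \<alpha> by (simp add: \<eta>_def)
  have C: "0 \<le> chain_const CARD('d) (1 / sqrt v0) (2 * K) \<eta>"
    using v0 K \<eta> by (intro chain_const_nonneg) auto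
  show ?thesis
  proof (intro exI[of _ "chain_const CARD('d) (1 / sqrt v0) (2 * K) \<eta>"] conjI C allI impI)
    fix p b :: "real \<times> real" and \<epsilon> :: real and z :: "real ^ 'd"
    assume \<epsilon>: "0 < \<epsilon>" and p: "a \<le> fst p" "fst p + fst b \<le> T"
      and b: "0 \<le> fst b" "fst b \<le> \<epsilon> powr (2 * \<alpha> / (\<alpha> - 1))" "0 \<le> snd b" "snd b \<le> \<epsilon> powr (2 / (\<alpha> - 1))"
    have cellD: "a \<le> fst q" "0 \<le> fst q" "fst q \<le> T" if "q \<in> cell p b" for q
      using that p a by (auto simp: cell_def)
    have wi: "has_wiener_integral T M (W i) (heat_integrand \<alpha> q) (\<lambda>\<omega>. v q \<omega> $ i)" if "q \<in> cell p b" for q i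
      using mild_solution_wiener[OF v cellD(2,3)[OF that], of i "snd q"] by simp
    have low: "v0 \<le> (\<integral>q'. (heat_integrand \<alpha> q q')\<^sup>2 \<partial>strip T)" if "q \<in> cell p b" for q
      using heat_variance_pos(2)[OF \<alpha>(1) a Wi v cellD(1,3)[OF that], of "snd q"] by (simp add: v0_def)
    show "ball_hit_le M v (cell p b) z \<epsilon> (chain_const CARD('d) (1 / sqrt v0) (2 * K) \<eta> * \<epsilon> ^ CARD('d))"
    proof (rule hit_ball_from_cell)
      show "(\<lambda>\<omega>. v q \<omega> $ i) \<in> borel_measurable M" if "q \<in> cell p b" for q i
        using wi[OF that] by (simp add: has_wiener_integral_def)
      show "continuous_on (cell p b) (\<lambda>q. v q \<omega>)" if "\<omega> \<in> space M" for \<omega>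
      proof (rule continuous_on_subset)
        show "continuous_on ({0..T} \<times> UNIV) (\<lambda>q. v q \<omega>)" using v that by (simp add: mild_solution_def)
        show "cell p b \<subseteq> {0..T} \<times> UNIV" using cellD by auto
      qed
      show "prob {\<omega> \<in> space M. \<forall>i. \<bar>v q \<omega> $ i - z $ i\<bar> \<le> s} \<le> (1 / sqrt v0 * s) ^ CARD('d)"
        if "q \<in> cell p b" "0 < s" for q s
        using wiener_vector_bound[OF W wi[OF that(1)] v0 low[OF that(1)], of s "\<lambda>i. z $ i"] that by simp
      show "prob {\<omega> \<in> space M. (\<forall>i. \<bar>v q \<omega> $ i - z $ i\<bar> \<le> s) \<and> u < \<bar>v r \<omega> $ j - v r' \<omega> $ j\<bar>}
          \<le> 4 * (1 / sqrt v0 * s) ^ CARD('d) * exp (- u\<^sup>2 / (16 * (2 * K * \<epsilon>\<^sup>2 * 2 powr (- \<eta> * real n))))"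
        if q: "q \<in> cell p b" and r: "r \<in> cell p b" and r': "r' \<in> cell p b" and s: "0 < s" and u: "0 \<le> u"
          and link: "\<bar>fst r - fst r'\<bar> \<le> fst b / 2 ^ n" "\<bar>snd r - snd r'\<bar> \<le> snd b / 2 ^ n" for q r r' n s u j
      proof -
        have inc: "has_wiener_integral T M (W i) (\<lambda>q. heat_integrand \<alpha> r q - heat_integrand \<alpha> r' q) (\<lambda>\<omega>. v r \<omega> $ i - v r' \<omega> $ i)" for i
          using mild_solution_increment_wiener[OF Wi v cellD(2,3)[OF r] cellD(2,3)[OF r'], of i "snd r" "snd r'"] by simp
        have "(\<integral>q. (heat_integrand \<alpha> r q - heat_integrand \<alpha> r' q)\<^sup>2 \<partial>strip T)
            \<le> K * (\<bar>fst r - fst r'\<bar> powr (1 - 1 / \<alpha>) + \<bar>snd r - snd r'\<bar> powr (\<alpha> - 1))"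
          using heat_increment_variance[OF \<alpha> Wi v cellD(2,3)[OF r] cellD(2,3)[OF r'], of "snd r" "snd r'"] by (simp add: K_def)
        also have "\<dots> \<le> K * (2 * (\<epsilon>\<^sup>2 * 2 powr (- (1 - 1 / \<alpha>) * real n)))"
        proof (intro mult_left_mono link_variance \<alpha>(1) \<epsilon>)
          show "\<bar>fst r - fst r'\<bar> \<le> \<epsilon> powr (2 * \<alpha> / (\<alpha> - 1)) / 2 ^ n"
            using link(1) divide_right_mono[OF b(2), of "2 ^ n"] by simp
          show "\<bar>snd r - snd r'\<bar> \<le> \<epsilon> powr (2 / (\<alpha> - 1)) / 2 ^ n"
            using link(2) divide_right_mono[OF b(4), of "2 ^ n"] by simp
        qed (use K in auto)
        also have "\<dots> = 2 * K * \<epsilon>\<^sup>2 * 2 powr (- \<eta> * real n)" by (simp add: \<eta>_def)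
        finally have var: "(\<integral>q. (heat_integrand \<alpha> r q - heat_integrand \<alpha> r' q)\<^sup>2 \<partial>strip T) \<le> 2 * K * \<epsilon>\<^sup>2 * 2 powr (- \<eta> * real n)" .
        show ?thesis
          using wiener_vector_pair_bound[OF W wi[OF q] inc v0 low[OF q] var _ s u, of "\<lambda>i. z $ i" j] K \<epsilon> by simp
      qed
    qed (use \<epsilon> b K v0 \<eta> in auto)
  qed
qed

end

subsection \<open>Covering a rectangle by cells\<close>

lemma grid_index:
  fixes t :: real
  assumes t: "t0 \<le> t" "t \<le> t1" and N: "0 < N"
  shows "\<exists>i<N. t0 + real i * ((t1 - t0) / real N) \<le> t \<and> t \<le> t0 + real i * ((t1 - t0) / real N) + (t1 - t0) / real N"
proof -
  define \<delta> where "\<delta> = (t1 - t0) / real N"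
  have N\<delta>: "t1 = t0 + real N * \<delta>" using N by (simp add: \<delta>_def)
  have "0 \<le> \<delta>" using t N by (simp add: \<delta>_def)
  have "\<exists>i<N. t0 + real i * \<delta> \<le> t \<and> t \<le> t0 + real i * \<delta> + \<delta>"
  proof (cases "t = t1")
    case True
    have "real (N - 1) = real N - 1" using N by (simp add: of_nat_diff)
    then show ?thesis
      using N N\<delta> True \<open>0 \<le> \<delta>\<close> by (intro exI[of _ "N - 1"]) (auto simp: algebra_simps)
  next
    case False
    then have \<delta>: "0 < \<delta>" using t N by (simp add: \<delta>_def)
    define y where "y = (t - t0) / \<delta>"
    have y: "0 \<le> y" "y < real N" "t = t0 + y * \<delta>"
      using t False \<delta> N\<delta> by (auto simp: y_def divide_less_eq)
    define i where "i = nat \<lfloor>y\<rfloor>"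
    have "real i = of_int \<lfloor>y\<rfloor>" using y by (simp add: i_def)
    then have i: "real i \<le> y" "y \<le> real i + 1" by linarith+
    have "i < N" using i(1) y(2) by linarith
    moreover have "real i * \<delta> \<le> y * \<delta>" "y * \<delta> \<le> (real i + 1) * \<delta>"
      using i \<delta> by (auto intro!: mult_right_mono)
    ultimately show ?thesis using y(3) by (intro exI[of _ i]) (auto simp: distrib_right)
  qed
  then show ?thesis by (simp add: \<delta>_def)
qed

lemma cell_count:
  fixes len \<tau> :: real
  assumes "0 \<le> len" "0 < \<tau>" "\<tau> \<le> 1"
  shows "\<exists>N>0. len / real N \<le> \<tau> \<and> real N \<le> (len + 2) / \<tau>"
proof (intro exI conjI)
  let ?N = "nat \<lceil>len / \<tau>\<rceil> + 1"
  have nn: "0 \<le> len / \<tau>" using assms by simp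
  then have "real (nat \<lceil>len / \<tau>\<rceil>) = of_int \<lceil>len / \<tau>\<rceil>" by simp
  then have N: "len / \<tau> \<le> real ?N" "real ?N \<le> len / \<tau> + 2" by linarith+
  show "0 < ?N" by simp
  have "len \<le> real ?N * \<tau>" using N(1) assms by (simp add: divide_le_eq del: of_nat_add)
  then show "len / real ?N \<le> \<tau>" by (simp add: divide_le_eq mult.commute del: of_nat_add)
  have "2 \<le> 2 / \<tau>" using assms by (simp add: le_divide_eq)
  then show "real ?N \<le> (len + 2) / \<tau>" using N(2) by (simp add: add_divide_distrib del: of_nat_add)
qed

lemma (in prob_space) heat_hit_ball_from_rectangle:
  fixes W :: "'d :: finite \<Rightarrow> (real \<times> real) set \<Rightarrow> 'a \<Rightarrow> real" and v :: "real \<times> real \<Rightarrow> 'a \<Rightarrow> real ^ 'd"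
  assumes \<alpha>: "1 < \<alpha>" "\<alpha> \<le> 2" and W: "indep_white_noises T M W" and v: "mild_solution \<alpha> T M W v"
    and t: "0 < t0" "t0 \<le> t1" "t1 \<le> T" and x: "x0 \<le> x1"
  shows "\<exists>C\<ge>0. \<forall>N m \<epsilon> z. 0 < \<epsilon> \<longrightarrow> 0 < N \<longrightarrow> 0 < m \<longrightarrow>
    (t1 - t0) / real N \<le> \<epsilon> powr (2 * \<alpha> / (\<alpha> - 1)) \<longrightarrow> (x1 - x0) / real m \<le> \<epsilon> powr (2 / (\<alpha> - 1)) \<longrightarrow>
    ball_hit_le M v ({t0..t1} \<times> {x0..x1}) z \<epsilon> (real N * real m * (C * \<epsilon> ^ CARD('d)))"
proof -
  obtain C where C: "0 \<le> C" and cell: "\<And>p b \<epsilon> z. 0 < \<epsilon> \<Longrightarrow> t0 \<le> fst p \<Longrightarrow> fst p + fst b \<le> T \<Longrightarrow>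
    0 \<le> fst b \<Longrightarrow> fst b \<le> \<epsilon> powr (2 * \<alpha> / (\<alpha> - 1)) \<Longrightarrow> 0 \<le> snd b \<Longrightarrow> snd b \<le> \<epsilon> powr (2 / (\<alpha> - 1)) \<Longrightarrow>
    ball_hit_le M v (cell p b) z \<epsilon> (C * \<epsilon> ^ CARD('d))"
    using heat_hit_ball_from_cell[OF \<alpha> W v t(1) order_trans[OF t(2,3)]] by blast
  show ?thesis
  proof (intro exI[of _ C] conjI C allI impI)
    fix N m :: nat and \<epsilon> :: real and z :: "real ^ 'd"
    assume \<epsilon>: "0 < \<epsilon>" and N: "0 < N" and m: "0 < m"
      and len: "(t1 - t0) / real N \<le> \<epsilon> powr (2 * \<alpha> / (\<alpha> - 1))" "(x1 - x0) / real m \<le> \<epsilon> powr (2 / (\<alpha> - 1))"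
    define b where "b = ((t1 - t0) / real N, (x1 - x0) / real m)"
    define p where "p i j = (t0 + real i * ((t1 - t0) / real N), x0 + real j * ((x1 - x0) / real m))" for i j
    have ex: "ball_hit_le M v (cell (p i j) b) z \<epsilon> (C * \<epsilon> ^ CARD('d))" if "i < N" for i j
    proof (rule cell[OF \<epsilon>])
      show "t0 \<le> fst (p i j)" using t by (simp add: p_def)
      have "(real i + 1) * ((t1 - t0) / real N) \<le> real N * ((t1 - t0) / real N)"
        using that t by (intro mult_right_mono) auto
      also have "\<dots> = t1 - t0" using N by simp
      finally show "fst (p i j) + fst b \<le> T" using t(3) unfolding p_def b_def fst_conv distrib_right by linarith
    qed (use len t x in \<open>auto simp: b_def\<close>)
    define U where "U i j = (SOME U. U \<in> sets M
      \<and> {\<omega> \<in> space M. \<exists>q\<in>cell (p i j) b. v q \<omega> \<in> ball z \<epsilon>} \<subseteq> U \<and> emeasure M U \<le> ennreal (C * \<epsilon> ^ CARD('d)))" for i j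
    have U: "U i j \<in> sets M" "{\<omega> \<in> space M. \<exists>q\<in>cell (p i j) b. v q \<omega> \<in> ball z \<epsilon>} \<subseteq> U i j"
      "emeasure M (U i j) \<le> ennreal (C * \<epsilon> ^ CARD('d))" if "i < N" for i j
    proof -
      have "\<exists>U. U \<in> sets M \<and> {\<omega> \<in> space M. \<exists>q\<in>cell (p i j) b. v q \<omega> \<in> ball z \<epsilon>} \<subseteq> U
        \<and> emeasure M U \<le> ennreal (C * \<epsilon> ^ CARD('d))"
        using ex[OF that, of j] unfolding ball_hit_le_def by blast
      from someI_ex[OF this] show "U i j \<in> sets M"
        "{\<omega> \<in> space M. \<exists>q\<in>cell (p i j) b. v q \<omega> \<in> ball z \<epsilon>} \<subseteq> U i j"
        "emeasure M (U i j) \<le> ennreal (C * \<epsilon> ^ CARD('d))"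
        unfolding U_def by blast+
    qed
    let ?I = "{..<N} \<times> {..<m}"
    have cover: "\<exists>i<N. \<exists>j<m. q \<in> cell (p i j) b" if "q \<in> {t0..t1} \<times> {x0..x1}" for q
      using grid_index[of t0 "fst q" t1 N] grid_index[of x0 "snd q" x1 m] that N m
      by (fastforce simp: cell_def p_def b_def)
    show "ball_hit_le M v ({t0..t1} \<times> {x0..x1}) z \<epsilon> (real N * real m * (C * \<epsilon> ^ CARD('d)))"
      unfolding ball_hit_le_def
    proof (intro bexI[of _ "\<Union>(i, j)\<in>?I. U i j"] conjI)
      show meas: "(\<Union>(i, j)\<in>?I. U i j) \<in> sets M" using U(1) by (intro sets.finite_UN) auto
      show "{\<omega> \<in> space M. \<exists>q\<in>{t0..t1} \<times> {x0..x1}. v q \<omega> \<in> ball z \<epsilon>} \<subseteq> (\<Union>(i, j)\<in>?I. U i j)"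
      proof (intro subsetI)
        fix \<omega> assume "\<omega> \<in> {\<omega> \<in> space M. \<exists>q\<in>{t0..t1} \<times> {x0..x1}. v q \<omega> \<in> ball z \<epsilon>}"
        then obtain q where \<omega>: "\<omega> \<in> space M" and q: "q \<in> {t0..t1} \<times> {x0..x1}" "v q \<omega> \<in> ball z \<epsilon>" by blast
        obtain i j where ij: "i < N" "j < m" "q \<in> cell (p i j) b" using cover[OF q(1)] by blast
        then have "\<omega> \<in> U i j" using U(2)[OF ij(1), of j] \<omega> q(2) by blast
        then show "\<omega> \<in> (\<Union>(i, j)\<in>?I. U i j)" using ij by auto
      qed
      have "emeasure M (\<Union>(i, j)\<in>?I. U i j) \<le> (\<Sum>ij\<in>?I. emeasure M (case ij of (i, j) \<Rightarrow> U i j))"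
        using U(1) by (intro emeasure_subadditive_finite) auto
      also have "\<dots> \<le> (\<Sum>ij\<in>?I. ennreal (C * \<epsilon> ^ CARD('d)))"
        using U(3) by (intro sum_mono) auto
      also have "\<dots> = ennreal (real (card ?I) * (C * \<epsilon> ^ CARD('d)))"
        using C \<epsilon> by (simp add: ennreal_mult ennreal_of_nat_eq_real_of_nat del: card_cartesian_product)
      finally show "emeasure M (\<Union>(i, j)\<in>?I. U i j) \<le> ennreal (real N * real m * (C * \<epsilon> ^ CARD('d)))"
        by (simp add: card_cartesian_product)
    qed
  qed
qed

section \<open>From small balls to Hausdorff measure\<close>

lemma hausdorff_content_antimono:
  assumes "\<epsilon> \<le> \<delta>"
  shows "hausdorff_content \<beta> \<delta> F \<le> hausdorff_content \<beta> \<epsilon> F"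
  unfolding hausdorff_content_def
proof (rule Inf_superset_mono, safe)
  fix x :: "nat \<Rightarrow> 'a" and r :: "nat \<Rightarrow> real"
  assume "\<forall>i. 0 \<le> r i \<and> r i \<le> \<epsilon>" "F \<subseteq> (\<Union>i. ball (x i) (r i))"
  moreover from this have "\<forall>i. 0 \<le> r i \<and> r i \<le> \<delta>" using assms order_trans by blast
  ultimately show "\<exists>x' r'. (\<Sum>i. ennreal ((2 * r i) powr \<beta>)) = (\<Sum>i. ennreal ((2 * r' i) powr \<beta>))
      \<and> (\<forall>i. 0 \<le> r' i \<and> r' i \<le> \<delta>) \<and> F \<subseteq> (\<Union>i. ball (x' i) (r' i))"
    by blast
qed

lemma hausdorff_content_le_measure:
  assumes "0 \<le> \<beta>" "0 < \<delta>"
  shows "hausdorff_content \<beta> \<delta> F \<le> hausdorff_measure \<beta> F"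
proof -
  let ?h = "\<lambda>\<epsilon>. hausdorff_content \<beta> \<epsilon> F"
  have "(?h \<longlongrightarrow> (SUP \<epsilon>\<in>{0<..}. ?h \<epsilon>)) (at_right 0)"
  proof (rule order_tendstoI)
    fix y assume "y < (SUP \<epsilon>\<in>{0<..}. ?h \<epsilon>)"
    then obtain \<epsilon> where \<epsilon>: "0 < \<epsilon>" "y < ?h \<epsilon>" by (auto simp: less_SUP_iff)
    have "eventually (\<lambda>x. x \<in> {0<..<\<epsilon>}) (at_right 0)" using \<epsilon> by (intro eventually_at_right_real) 
    then show "eventually (\<lambda>x. y < ?h x) (at_right 0)"
    proof eventually_elim
      case (elim x)
      then have "?h \<epsilon> \<le> ?h x" by (intro hausdorff_content_antimono) auto
      then show ?case using \<epsilon> by simp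
    qed
  next
    fix y assume y: "(SUP \<epsilon>\<in>{0<..}. ?h \<epsilon>) < y"
    have "eventually (\<lambda>x::real. x \<in> {0<..<1}) (at_right 0)" by (intro eventually_at_right_real) simp
    then show "eventually (\<lambda>x. ?h x < y) (at_right 0)"
    proof eventually_elim
      case (elim x)
      then have "?h x \<le> (SUP \<epsilon>\<in>{0<..}. ?h \<epsilon>)" by (intro SUP_upper) auto
      then show ?case using y by (rule order.strict_trans1)
    qed
  qed
  then have "hausdorff_measure \<beta> F = (SUP \<epsilon>\<in>{0<..}. ?h \<epsilon>)"
    using assms by (simp add: hausdorff_measure_def tendsto_Lim)
  then show ?thesis using assms by (auto intro: SUP_upper)
qed

text \<open>Subadditivity over the balls of a cover. If hitting \<open>A\<close> is not a measurable event, then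
  \<open>emeasure\<close> is 0 there.\<close>

lemma (in prob_space) hitting_hausdorff:
  fixes v :: "'p \<Rightarrow> 'a \<Rightarrow> 'b :: euclidean_space"
  assumes C: "0 < C"
    and ball: "\<And>z r. 0 < r \<Longrightarrow> r \<le> 1 \<Longrightarrow> ball_hit_le M v E z r (C * r powr \<beta>)"
  shows "emeasure M (hitting_event M v E A) \<le> ennreal C * hausdorff_measure \<beta> A"
proof (cases "\<beta> < 0")
  case True
  then show ?thesis using C by (simp add: hausdorff_measure_def ennreal_mult_top)
next
  case False
  then have \<beta>: "0 \<le> \<beta>" by simp
  have cover: "emeasure M (hitting_event M v E A) \<le> ennreal C * (\<Sum>i. ennreal ((2 * r i) powr \<beta>))"
    if r: "\<And>i. 0 \<le> r i \<and> r i \<le> 1" and A: "A \<subseteq> (\<Union>i. ball (x i) (r i))" for x :: "nat \<Rightarrow> 'b" and r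
  proof -
    have "\<exists>U\<in>sets M. {\<omega> \<in> space M. \<exists>q\<in>E. v q \<omega> \<in> ball (x i) (r i)} \<subseteq> U \<and> emeasure M U \<le> ennreal C * ennreal ((2 * r i) powr \<beta>)" for i
    proof (cases "r i = 0")
      case True
      \<comment> \<open>a ball of radius 0 is empty\<close>
      then show ?thesis by (intro bexI[of _ "{}"]) auto
    next
      case False
      then have ri: "0 < r i" "r i \<le> 1" using r[of i] by auto
      have "C * r i powr \<beta> \<le> C * (2 * r i) powr \<beta>"
        using ri C \<beta> by (intro mult_left_mono powr_mono2) auto
      then have "ennreal (C * r i powr \<beta>) \<le> ennreal C * ennreal ((2 * r i) powr \<beta>)"
        using C by (simp add: ennreal_mult[symmetric] ennreal_leI)
      then show ?thesis using ball[OF ri, of "x i"] unfolding ball_hit_le_def by (meson order_trans)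
    qed
    then have "\<forall>i. \<exists>U. U \<in> sets M \<and> {\<omega> \<in> space M. \<exists>q\<in>E. v q \<omega> \<in> ball (x i) (r i)} \<subseteq> U
        \<and> emeasure M U \<le> ennreal C * ennreal ((2 * r i) powr \<beta>)"
      by blast
    from choice[OF this] obtain U where U: "\<And>i. U i \<in> sets M"
      "\<And>i. {\<omega> \<in> space M. \<exists>q\<in>E. v q \<omega> \<in> ball (x i) (r i)} \<subseteq> U i"
      "\<And>i. emeasure M (U i) \<le> ennreal C * ennreal ((2 * r i) powr \<beta>)"
      by blast
    have "hitting_event M v E A \<subseteq> (\<Union>i. U i)"
    proof (intro subsetI)
      fix \<omega> assume "\<omega> \<in> hitting_event M v E A"
      then obtain q where q: "\<omega> \<in> space M" "q \<in> E" "v q \<omega> \<in> A" by (auto simp: hitting_event_def)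
      then obtain i where "v q \<omega> \<in> ball (x i) (r i)" using A by auto
      then have "\<omega> \<in> U i" using U(2)[of i] q by auto
      then show "\<omega> \<in> (\<Union>i. U i)" by auto
    qed
    then have "emeasure M (hitting_event M v E A) \<le> emeasure M (\<Union>i. U i)"
      using U(1) by (intro emeasure_mono) auto
    also have "\<dots> \<le> (\<Sum>i. emeasure M (U i))"
      using U(1) by (intro emeasure_subadditive_countably) auto
    also have "\<dots> \<le> (\<Sum>i. ennreal C * ennreal ((2 * r i) powr \<beta>))"
      using U(3) by (intro suminf_le) auto
    also have "\<dots> = ennreal C * (\<Sum>i. ennreal ((2 * r i) powr \<beta>))"
      by (rule ennreal_suminf_cmult)
    finally show ?thesis .
  qed
  have inv: "ennreal (1 / C) * (ennreal C * c) = c" "ennreal C * (ennreal (1 / C) * c) = c" for c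
    using C by (simp_all add: mult.assoc[symmetric] ennreal_mult[symmetric])
  have "ennreal (1 / C) * emeasure M (hitting_event M v E A) \<le> hausdorff_content \<beta> 1 A"
    unfolding hausdorff_content_def
  proof (rule Inf_greatest, safe)
    fix x :: "nat \<Rightarrow> 'b" and r :: "nat \<Rightarrow> real"
    assume "\<forall>i. 0 \<le> r i \<and> r i \<le> 1" "A \<subseteq> (\<Union>i. ball (x i) (r i))"
    then have "ennreal (1 / C) * emeasure M (hitting_event M v E A)
        \<le> ennreal (1 / C) * (ennreal C * (\<Sum>i. ennreal ((2 * r i) powr \<beta>)))"
      by (intro mult_left_mono cover) auto
    then show "ennreal (1 / C) * emeasure M (hitting_event M v E A) \<le> (\<Sum>i. ennreal ((2 * r i) powr \<beta>))"
      unfolding inv .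
  qed
  also have "\<dots> \<le> hausdorff_measure \<beta> A" by (rule hausdorff_content_le_measure[OF \<beta>]) simp
  finally have "ennreal C * (ennreal (1 / C) * emeasure M (hitting_event M v E A)) \<le> ennreal C * hausdorff_measure \<beta> A"
    by (rule mult_left_mono) simp
  then show ?thesis unfolding inv .
qed

text \<open>The exponents \<open>\<theta>\<close> and \<open>\<theta>'\<close> say how the numbers of cells in the two directions grow as the
  radius of the ball decreases.\<close>

lemma (in prob_space) heat_hitting:
  fixes W :: "'d :: finite \<Rightarrow> (real \<times> real) set \<Rightarrow> 'a \<Rightarrow> real" and v :: "real \<times> real \<Rightarrow> 'a \<Rightarrow> real ^ 'd"
  assumes \<alpha>: "1 < \<alpha>" "\<alpha> \<le> 2" and W: "indep_white_noises T M W" and v: "mild_solution \<alpha> T M W v"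
    and t: "0 < t0" "t0 \<le> t1" "t1 \<le> T" and x: "x0 \<le> x1"
    and N: "\<And>r. 0 < r \<Longrightarrow> r \<le> 1 \<Longrightarrow> \<exists>N>0. (t1 - t0) / real N \<le> r powr (2 * \<alpha> / (\<alpha> - 1)) \<and> real N \<le> c * r powr - \<theta>"
    and m: "\<And>r. 0 < r \<Longrightarrow> r \<le> 1 \<Longrightarrow> \<exists>m>0. (x1 - x0) / real m \<le> r powr (2 / (\<alpha> - 1)) \<and> real m \<le> c' * r powr - \<theta>'"
  shows "\<exists>C>0. \<forall>A. emeasure M (hitting_event M v ({t0..t1} \<times> {x0..x1}) A)
    \<le> ennreal C * hausdorff_measure (real CARD('d) - (\<theta> + \<theta>')) A"
proof -
  obtain C where C: "0 \<le> C" and rect: "\<And>N m \<epsilon> z. 0 < \<epsilon> \<Longrightarrow> 0 < N \<Longrightarrow> 0 < m \<Longrightarrow>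
    (t1 - t0) / real N \<le> \<epsilon> powr (2 * \<alpha> / (\<alpha> - 1)) \<Longrightarrow> (x1 - x0) / real m \<le> \<epsilon> powr (2 / (\<alpha> - 1)) \<Longrightarrow>
    ball_hit_le M v ({t0..t1} \<times> {x0..x1}) z \<epsilon> (real N * real m * (C * \<epsilon> ^ CARD('d)))"
    using heat_hit_ball_from_rectangle[OF \<alpha> W v t x] by blast
  have c: "0 \<le> c" "0 \<le> c'"
    using N[of 1] m[of 1] by (auto dest: order_trans[OF of_nat_0_le_iff])
  define D where "D = c * c' * C + 1"
  have D: "0 < D" "c * c' * C \<le> D" using c C by (auto simp: D_def add_nonneg_pos)
  have "emeasure M (hitting_event M v ({t0..t1} \<times> {x0..x1}) A)
    \<le> ennreal D * hausdorff_measure (real CARD('d) - (\<theta> + \<theta>')) A" for A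
  proof (rule hitting_hausdorff[OF D(1)])
    fix z :: "real ^ 'd" and r :: real assume r: "0 < r" "r \<le> 1"
    obtain N where N: "0 < N" "(t1 - t0) / real N \<le> r powr (2 * \<alpha> / (\<alpha> - 1))" "real N \<le> c * r powr - \<theta>"
      using N[OF r] by blast
    obtain m where m: "0 < m" "(x1 - x0) / real m \<le> r powr (2 / (\<alpha> - 1))" "real m \<le> c' * r powr - \<theta>'"
      using m[OF r] by blast
    have "real N * real m * (C * r ^ CARD('d)) \<le> (c * r powr - \<theta>) * (c' * r powr - \<theta>') * (C * r ^ CARD('d))"
      using N m c C r by (intro mult_right_mono mult_mono) auto
    also have "\<dots> = c * c' * C * r powr (real CARD('d) - (\<theta> + \<theta>'))"
    proof -
      have "real CARD('d) - (\<theta> + \<theta>') = real CARD('d) + (- \<theta> + - \<theta>')" by linarith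
      then have "r powr (real CARD('d) - (\<theta> + \<theta>')) = r powr (real CARD('d) + (- \<theta> + - \<theta>'))" by (rule arg_cong)
      also have "\<dots> = r ^ CARD('d) * (r powr - \<theta> * r powr - \<theta>')"
        unfolding powr_add using r by (simp add: powr_realpow)
      finally show ?thesis by (simp add: mult_ac)
    qed
    also have "\<dots> \<le> D * r powr (real CARD('d) - (\<theta> + \<theta>'))"
      using D by (intro mult_right_mono) auto
    finally show "ball_hit_le M v ({t0..t1} \<times> {x0..x1}) z r (D * r powr (real CARD('d) - (\<theta> + \<theta>')))"
      by (rule ball_hit_le_mono[OF rect[OF r(1) N(1) m(1) N(2) m(2)]])
  qed
  then show ?thesis using D(1) by blast
qed

lemma cell_count_powr:
  fixes len r e :: real
  assumes "0 \<le> len" "0 \<le> e" "0 < r" "r \<le> 1"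
  shows "\<exists>N>0. len / real N \<le> r powr e \<and> real N \<le> (len + 2) * r powr - e"
  using cell_count[of len "r powr e"] assms by (simp add: powr_le1 powr_minus divide_inverse)

theorem theorem1p6:
  fixes \<alpha> T a b a' b' :: real
    and I J :: "real set"
    and M :: "'m measure"
    and W :: "'d::finite \<Rightarrow> (real \<times> real) set \<Rightarrow> 'm \<Rightarrow> real"
    and v :: "real \<times> real \<Rightarrow> 'm \<Rightarrow> real ^ 'd"
  assumes "prob_space M"
    and "1 < \<alpha>" and "\<alpha> \<le> 2" and "0 < T"
    and "indep_white_noises T M W"
    and "mild_solution \<alpha> T M W v"
    and "I = {a..b}" and "0 < a" and "a < b" and "b \<le> T"
    and "J = {a'..b'}" and "a' < b'"
  shows "(\<exists>C>0. \<forall>A. compact A \<longrightarrow>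
            emeasure M (hitting_event M v (I \<times> J) A)
              \<le> ennreal C * hausdorff_measure (real CARD('d) - 2 * (\<alpha> + 1) / (\<alpha> - 1)) A) \<and>
         (\<forall>t. 0 < t \<and> t \<le> T \<longrightarrow> (\<exists>C>0. \<forall>A. compact A \<longrightarrow>
            emeasure M (hitting_event M v ({t} \<times> J) A)
              \<le> ennreal C * hausdorff_measure (real CARD('d) - 2 / (\<alpha> - 1)) A)) \<and>
         (\<forall>x. \<exists>C>0. \<forall>A. compact A \<longrightarrow>
            emeasure M (hitting_event M v (I \<times> {x}) A)
              \<le> ennreal C * hausdorff_measure (real CARD('d) - 2 * \<alpha> / (\<alpha> - 1)) A)"
proof -
  interpret prob_space M by fact
  note heat = heat_hitting[OF \<open>1 < \<alpha>\<close> \<open>\<alpha> \<le> 2\<close> \<open>indep_white_noises T M W\<close> \<open>mild_solution \<alpha> T M W v\<close>]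
  have exps: "0 \<le> 2 * \<alpha> / (\<alpha> - 1)" "0 \<le> 2 / (\<alpha> - 1)" using \<open>1 < \<alpha>\<close> by auto
  have sum_exp: "2 * \<alpha> / (\<alpha> - 1) + 2 / (\<alpha> - 1) = 2 * (\<alpha> + 1) / (\<alpha> - 1)"
    by (simp add: add_divide_distrib)
  \<comment> \<open>in a direction in which the parameter set is a point, one cell suffices\<close>
  have one: "\<exists>N>0. (u - u) / real N \<le> r powr e \<and> real N \<le> 1 * r powr - 0" if "0 < r" for u r e :: real
    using that by (intro exI[of _ 1]) auto
  have count_I: "\<exists>N>0. (b - a) / real N \<le> r powr (2 * \<alpha> / (\<alpha> - 1)) \<and> real N \<le> (b - a + 2) * r powr - (2 * \<alpha> / (\<alpha> - 1))"
    if "0 < r" "r \<le> 1" for r :: real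
    using that exps \<open>a < b\<close> by (intro cell_count_powr) auto
  have count_J: "\<exists>N>0. (b' - a') / real N \<le> r powr (2 / (\<alpha> - 1)) \<and> real N \<le> (b' - a' + 2) * r powr - (2 / (\<alpha> - 1))"
    if "0 < r" "r \<le> 1" for r :: real
    using that exps \<open>a' < b'\<close> by (intro cell_count_powr) auto
  show ?thesis
    unfolding \<open>I = {a..b}\<close> \<open>J = {a'..b'}\<close>
  proof (intro conjI allI impI)
    have "\<exists>C>0. \<forall>A. emeasure M (hitting_event M v ({a..b} \<times> {a'..b'}) A)
        \<le> ennreal C * hausdorff_measure (real CARD('d) - (2 * \<alpha> / (\<alpha> - 1) + 2 / (\<alpha> - 1))) A"
      using assms by (intro heat[OF _ _ _ _ count_I count_J]) auto
    then show "\<exists>C>0. \<forall>A. compact A \<longrightarrow> emeasure M (hitting_event M v ({a..b} \<times> {a'..b'}) A)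
        \<le> ennreal C * hausdorff_measure (real CARD('d) - 2 * (\<alpha> + 1) / (\<alpha> - 1)) A"
      unfolding sum_exp by blast
  next
    fix t assume "0 < t \<and> t \<le> T"
    then have "\<exists>C>0. \<forall>A. emeasure M (hitting_event M v ({t..t} \<times> {a'..b'}) A)
        \<le> ennreal C * hausdorff_measure (real CARD('d) - (0 + 2 / (\<alpha> - 1))) A"
      using assms by (intro heat[OF _ _ _ _ one count_J]) auto
    then show "\<exists>C>0. \<forall>A. compact A \<longrightarrow> emeasure M (hitting_event M v ({t} \<times> {a'..b'}) A)
        \<le> ennreal C * hausdorff_measure (real CARD('d) - 2 / (\<alpha> - 1)) A"
      unfolding atLeastAtMost_singleton add_0_left by blast
  next
    fix x
    have "\<exists>C>0. \<forall>A. emeasure M (hitting_event M v ({a..b} \<times> {x..x}) A)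
        \<le> ennreal C * hausdorff_measure (real CARD('d) - (2 * \<alpha> / (\<alpha> - 1) + 0)) A"
      using assms by (intro heat[OF _ _ _ _ count_I one]) auto
    then show "\<exists>C>0. \<forall>A. compact A \<longrightarrow> emeasure M (hitting_event M v ({a..b} \<times> {x}) A)
        \<le> ennreal C * hausdorff_measure (real CARD('d) - 2 * \<alpha> / (\<alpha> - 1)) A"
      unfolding atLeastAtMost_singleton add_0_right by blast
  qed
qed

end
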